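(* Let $G$ be an amenable unimodular locally compact second countable compactly generated group, let $k$ be a finite product of local fields, and let $d\ge1$. If there exists a regular embedding from $G$ to $GL(d,k)$, then for every $p\in[1,\infty)$, $$\log t\preccurlyeq j_{p,G}(t).$$
   Context: Conventions. Every locally compact second countable compactly generated group $G$ (in particular $GL(d,k)$) is equipped with a compact symmetric generating subset $S_G$, a left-invariant proper metric $d_G$ compatible with the topology and quasi-isometric to the word metric, and a Haar measure $\lambda_G$. Regular embedding. A metric space is balanced if for all $r_1>r_2>0$ there is $N$ such that every $r_1$-ball is covered by at most $N$ $r_2$-balls; the groups above with their metrics are balanced. A map $f\colon X\to Y$ between balanced metric spaces is a regular embedding if there are $r,r'>0$, $L>0$, $N\in\mathbb N$ such that $d(f(x),f(x'))\le L d(x,x')+L$ for all $x,x'\in X$, and the preimage of every $r$-ball of $Y$ can be covered by at most $N$ $r'$-balls of $X$. Isoperimetric profile. For $f\in L^p(G,\lambda_G)$ put $\|\nabla_G^r f\|_p=\sup_{t\in S_G}\|f-\rho(t)f\|_p$, where $(\rho(t)f)(g)=f(gt)$. For $A\subset G$ of finite measure, $J_{p,G}(A)=\sup\|f\|_p/\|\nabla_G^r f\|_p\in[0,+\infty]$, the supremum being over nonzero $f\in L^p(G)$ vanishing outside $A$ (ratio $+\infty$ if the gradient vanishes), and $j_{p,G}(v)=\sup_{\lambda_G(A)\le v}J_{p,G}(A)$. For nondecreasing functions $a,b$, $a\preccurlyeq b$ means there is $C>0$ with $a(t)=O(b(Ct))$ as $t\to\infty$. *)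

theory Defs
  imports "HOL-Analysis.Analysis" "HOL-Algebra.Coset" "HOL-Algebra.Generated_Groups" "HOL-Algebra.Ring"
begin

section \<open>Topological groups and fields\<close>

locale topological_group = group G for G (structure) +
  fixes T
  assumes topspace_eq: "topspace T = carrier G"
    and continuous_mult: "continuous_map (prod_topology T T) T (\<lambda>(x, y). x \<otimes> y)"
    and continuous_inv: "continuous_map T T (\<lambda>x. inv x)"

locale lcsc_group = topological_group +
  assumes hausdorff: "Hausdorff_space T"
    and locally_compact: "locally_compact_space T"
    and second_countable: "second_countable T"

locale topological_field = field K for K (structure) +
  fixes T
  assumes topspace_eq: "topspace T = carrier K"
    and continuous_add: "continuous_map (prod_topology T T) T (\<lambda>(x, y). x \<oplus> y)"
    and continuous_minus: "continuous_map T T (\<lambda>x. \<ominus> x)"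
    and continuous_mult: "continuous_map (prod_topology T T) T (\<lambda>(x, y). x \<otimes> y)"
    and continuous_inverse:
      "continuous_map (subtopology T (carrier K - {\<zero>})) T (\<lambda>x. inv x)"

text \<open>The archimedean local fields are included.\<close>

locale local_field = topological_field +
  assumes hausdorff: "Hausdorff_space T"
    and locally_compact: "locally_compact_space T"
    and nondiscrete: "T \<noteq> discrete_topology (carrier K)"


section \<open>General linear groups\<close>

text \<open>The product of a family of rings; its topology is \<^const>\<open>product_topology\<close>.\<close>

definition product_ring :: "'i set \<Rightarrow> ('i \<Rightarrow> ('a, 'm) ring_scheme) \<Rightarrow> ('i \<Rightarrow> 'a) ring" where
  "product_ring I K =
     \<lparr>carrier = (\<Pi>\<^sub>E i\<in>I. carrier (K i)),
      monoid.mult = (\<lambda>x y. \<lambda>i\<in>I. x i \<otimes>\<^bsub>K i\<^esub> y i),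
      one = (\<lambda>i\<in>I. \<one>\<^bsub>K i\<^esub>),
      ring.zero = (\<lambda>i\<in>I. \<zero>\<^bsub>K i\<^esub>),
      add = (\<lambda>x y. \<lambda>i\<in>I. x i \<oplus>\<^bsub>K i\<^esub> y i)\<rparr>"

text \<open>A matrix is an extensional function on pairs of indices below \<open>d\<close>.\<close>

definition mat_monoid :: "nat \<Rightarrow> ('a, 'm) ring_scheme \<Rightarrow> (nat \<times> nat \<Rightarrow> 'a) monoid" where
  "mat_monoid d R =
     \<lparr>carrier = ({..<d} \<times> {..<d} \<rightarrow>\<^sub>E carrier R),
      monoid.mult = (\<lambda>A B. restrict
        (\<lambda>(i, j). \<Oplus>\<^bsub>R\<^esub> l\<in>{..<d}. A (i, l) \<otimes>\<^bsub>R\<^esub> B (l, j)) ({..<d} \<times> {..<d})),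
      one = restrict (\<lambda>(i, j). if i = j then \<one>\<^bsub>R\<^esub> else \<zero>\<^bsub>R\<^esub>) ({..<d} \<times> {..<d})\<rparr>"

definition GL :: "nat \<Rightarrow> ('a, 'm) ring_scheme \<Rightarrow> (nat \<times> nat \<Rightarrow> 'a) monoid" where
  "GL d R = units_of (mat_monoid d R)"

text \<open>The subspace topology from the space of matrices is a group topology here because inversion
  is continuous on the units of a product of topological fields.\<close>

definition GL_topology ::
    "nat \<Rightarrow> ('a, 'm) ring_scheme \<Rightarrow> 'a topology \<Rightarrow> (nat \<times> nat \<Rightarrow> 'a) topology" where
  "GL_topology d R T =
     subtopology (product_topology (\<lambda>_. T) ({..<d} \<times> {..<d})) (carrier (GL d R))"


section \<open>Generating sets and metrics\<close>

primrec set_power :: "('a, 'm) monoid_scheme \<Rightarrow> 'a set \<Rightarrow> nat \<Rightarrow> 'a set" where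
  "set_power G S 0 = {\<one>\<^bsub>G\<^esub>}"
| "set_power G S (Suc n) = set_power G S n <#>\<^bsub>G\<^esub> S"

text \<open>For symmetric \<open>S\<close>, no inverses are needed in words.\<close>

definition word_length :: "('a, 'm) monoid_scheme \<Rightarrow> 'a set \<Rightarrow> 'a \<Rightarrow> nat" where
  "word_length G S g = (LEAST n. g \<in> set_power G S n)"

definition word_metric :: "('a, 'm) monoid_scheme \<Rightarrow> 'a set \<Rightarrow> 'a \<Rightarrow> 'a \<Rightarrow> real" where
  "word_metric G S x y = real (word_length G S (inv\<^bsub>G\<^esub> x \<otimes>\<^bsub>G\<^esub> y))"

definition compact_symmetric_generating ::
    "('a, 'm) monoid_scheme \<Rightarrow> 'a topology \<Rightarrow> 'a set \<Rightarrow> bool" where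
  "compact_symmetric_generating G T S \<longleftrightarrow>
     compactin T S \<and> (\<forall>s\<in>S. inv\<^bsub>G\<^esub> s \<in> S) \<and> generate G S = carrier G"

text \<open>The identity map is a quasi-isometry between the two metrics.\<close>

definition quasi_isometric_metrics ::
    "'a set \<Rightarrow> ('a \<Rightarrow> 'a \<Rightarrow> real) \<Rightarrow> ('a \<Rightarrow> 'a \<Rightarrow> real) \<Rightarrow> bool" where
  "quasi_isometric_metrics X d d' \<longleftrightarrow>
     (\<exists>L\<ge>1. \<exists>C\<ge>0. \<forall>x\<in>X. \<forall>y\<in>X. d' x y / L - C \<le> d x y \<and> d x y \<le> L * d' x y + C)"

definition admissible_metric ::
    "('a, 'm) monoid_scheme \<Rightarrow> 'a topology \<Rightarrow> 'a set \<Rightarrow> ('a \<Rightarrow> 'a \<Rightarrow> real) \<Rightarrow> bool" where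
  "admissible_metric G T S d \<longleftrightarrow>
     Metric_space (carrier G) d \<and>
     Metric_space.mtopology (carrier G) d = T \<and>
     (\<forall>x\<in>carrier G. \<forall>r. compactin T (Metric_space.mcball (carrier G) d x r)) \<and>
     (\<forall>g\<in>carrier G. \<forall>x\<in>carrier G. \<forall>y\<in>carrier G. d (g \<otimes>\<^bsub>G\<^esub> x) (g \<otimes>\<^bsub>G\<^esub> y) = d x y) \<and>
     quasi_isometric_metrics (carrier G) d (word_metric G S)"

definition regular_embedding ::
    "'a set \<Rightarrow> ('a \<Rightarrow> 'a \<Rightarrow> real) \<Rightarrow> 'b set \<Rightarrow> ('b \<Rightarrow> 'b \<Rightarrow> real) \<Rightarrow> ('a \<Rightarrow> 'b) \<Rightarrow> bool" where
  "regular_embedding X dX Y dY f \<longleftrightarrow>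
     f \<in> X \<rightarrow> Y \<and>
     (\<exists>r>0. \<exists>r'>0. \<exists>L>0. \<exists>N::nat.
        (\<forall>x\<in>X. \<forall>x'\<in>X. dY (f x) (f x') \<le> L * dX x x' + L) \<and>
        (\<forall>y\<in>Y. \<exists>F\<subseteq>X. finite F \<and> card F \<le> N \<and>
           {x \<in> X. f x \<in> Metric_space.mball Y dY y r}
             \<subseteq> (\<Union>c\<in>F. Metric_space.mball X dX c r')))"


section \<open>Haar measure, unimodularity, amenability\<close>

text \<open>Regularity is automatic, as only second countable locally compact groups are considered.\<close>

definition left_haar_measure ::
    "('a, 'm) monoid_scheme \<Rightarrow> 'a topology \<Rightarrow> 'a measure \<Rightarrow> bool" where
  "left_haar_measure G T M \<longleftrightarrow>
     space M = topspace T \<and>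
     sets M = sigma_sets (topspace T) {U. openin T U} \<and>
     (\<forall>C. compactin T C \<longrightarrow> emeasure M C < \<infinity>) \<and>
     emeasure M (space M) \<noteq> 0 \<and>
     (\<forall>g\<in>carrier G. \<forall>A\<in>sets M. emeasure M (g <#\<^bsub>G\<^esub> A) = emeasure M A)"

definition unimodular :: "('a, 'm) monoid_scheme \<Rightarrow> 'a topology \<Rightarrow> bool" where
  "unimodular G T \<longleftrightarrow>
     (\<forall>M. left_haar_measure G T M \<longrightarrow>
        (\<forall>g\<in>carrier G. \<forall>A\<in>sets M. emeasure M (A #>\<^bsub>G\<^esub> g) = emeasure M A))"

definition Linfty :: "'a measure \<Rightarrow> ('a \<Rightarrow> real) set" where
  "Linfty M = {f \<in> borel_measurable M. \<exists>C. AE x in M. \<bar>f x\<bar> \<le> C}"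

text \<open>Existence of a left-invariant mean on the space of essentially bounded functions; the
  fourth and fifth clauses make \<open>m\<close> a positive functional on classes modulo null sets.\<close>

definition amenable :: "('a, 'm) monoid_scheme \<Rightarrow> 'a measure \<Rightarrow> bool" where
  "amenable G M \<longleftrightarrow>
     (\<exists>m :: ('a \<Rightarrow> real) \<Rightarrow> real.
        m (\<lambda>_. 1) = 1 \<and>
        (\<forall>f\<in>Linfty M. \<forall>h\<in>Linfty M. m (\<lambda>x. f x + h x) = m f + m h) \<and>
        (\<forall>c. \<forall>f\<in>Linfty M. m (\<lambda>x. c * f x) = c * m f) \<and>
        (\<forall>f\<in>Linfty M. \<forall>h\<in>Linfty M. (AE x in M. f x = h x) \<longrightarrow> m f = m h) \<and>
        (\<forall>f\<in>Linfty M. (AE x in M. 0 \<le> f x) \<longrightarrow> 0 \<le> m f) \<and>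
        (\<forall>g\<in>carrier G. \<forall>f\<in>Linfty M. m (\<lambda>x. f (g \<otimes>\<^bsub>G\<^esub> x)) = m f))"


section \<open>Isoperimetric profile\<close>

definition Lp :: "real \<Rightarrow> 'a measure \<Rightarrow> ('a \<Rightarrow> real) set" where
  "Lp p M = {f \<in> borel_measurable M. integrable M (\<lambda>x. \<bar>f x\<bar> powr p)}"

definition Lp_norm :: "real \<Rightarrow> 'a measure \<Rightarrow> ('a \<Rightarrow> real) \<Rightarrow> real" where
  "Lp_norm p M f = (LINT x|M. \<bar>f x\<bar> powr p) powr (1 / p)"

text \<open>The Bochner integral in \<^const>\<open>Lp_norm\<close> is the correct value here when \<open>M\<close> is
  right-invariant, since then \<open>f\<close> in \<^term>\<open>Lp p M\<close> has its right translates in \<^term>\<open>Lp p M\<close>.\<close>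

definition right_gradient_norm ::
    "('a, 'm) monoid_scheme \<Rightarrow> 'a measure \<Rightarrow> 'a set \<Rightarrow> real \<Rightarrow> ('a \<Rightarrow> real) \<Rightarrow> ennreal" where
  "right_gradient_norm G M S p f =
     (SUP t\<in>S. ennreal (Lp_norm p M (\<lambda>g. f g - f (g \<otimes>\<^bsub>G\<^esub> t))))"

text \<open>In \<^typ>\<open>ennreal\<close>, \<open>x / 0 = \<infinity>\<close> for \<open>x \<noteq> 0\<close>, as required when the gradient vanishes.
  The function \<open>f\<close> is nonzero as an element of \<open>L\<^sup>p\<close>, that is, modulo null functions.\<close>

definition isop_ratio ::
    "('a, 'm) monoid_scheme \<Rightarrow> 'a measure \<Rightarrow> 'a set \<Rightarrow> real \<Rightarrow> 'a set \<Rightarrow> ennreal" where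
  "isop_ratio G M S p A =
     (SUP f\<in>{f \<in> Lp p M. \<not> (AE x in M. f x = 0) \<and> (AE x in M. x \<notin> A \<longrightarrow> f x = 0)}.
        ennreal (Lp_norm p M f) / right_gradient_norm G M S p f)"

definition isop_profile ::
    "('a, 'm) monoid_scheme \<Rightarrow> 'a measure \<Rightarrow> 'a set \<Rightarrow> real \<Rightarrow> real \<Rightarrow> ennreal" where
  "isop_profile G M S p v =
     (SUP A\<in>{A \<in> sets M. emeasure M A \<le> ennreal v}. isop_ratio G M S p A)"

definition asymp_le :: "(real \<Rightarrow> ennreal) \<Rightarrow> (real \<Rightarrow> ennreal) \<Rightarrow> bool"
    (infix \<open>\<preceq>\<close> 50) where
  "a \<preceq> b \<longleftrightarrow>
     (\<exists>C>0. \<exists>K::real. \<forall>\<^sub>F t in at_top. a t \<le> ennreal K * b (C * t))"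

end

theory Submission
  imports Defs
begin

text \<open>For every \<open>n\<close>, the group \<open>GL d k\<close> has a cover by sets of diameter \<open>O(n)\<close> with Lebesgue number
  \<open>n\<close> and multiplicity bounded independently of \<open>n\<close> (finite asymptotic Assouad--Nagata dimension). This
  is seen from the decomposition of a matrix into a unipotent, a diagonal and a bounded factor: the
  diagonal part is coarsely a lattice, and the unipotent part looks the same at all scales up to
  conjugation by diagonal matrices. A regular embedding pulls the cover back to a cover of \<open>G\<close> by sets
  of volume at most exponential in \<open>n\<close>. Since \<open>G\<close> is amenable and unimodular, transporting mass inside
  the members of the cover and averaging with an invariant mean shows that some member \<open>A\<close> has a core
  \<open>{g. d(g, A\<^sup>c) > n}\<close> that occupies a fixed proportion of its volume. A function that decreases with slope 1 from
  \<open>n\<close> on this core to 0 near the boundary then has a gradient \<open>O(1/n)\<close> times its norm, in every \<open>L\<^sup>p\<close>. As the volume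
  is exponential in \<open>n\<close>, the profile is at least logarithmic.\<close>

text \<open>Unipotent elements are exponentially distorted: along n bounded steps the unipotent
  displacement, seen from a fixed frame, may grow by a factor exponential in n, and every ring
  operation loses a constant besides. The frames are therefore tilted by a contraction exponential
  in n between consecutive basis directions, which makes each step so small that n of them, losses
  included, give a bounded displacement. Distances in \<open>GL d K\<close> are lengths of words in
  the bounded sets \<open>Bd q\<close>; the metric enters only through compactness and the
  comparison with word length. Pulling back loses control of the diameters, but test functions need
  only volumes; a finite diameter, however huge, keeps measures finite and lets finitely many
  translates suffice for the mean. In the mass transport a receiver sees its senders through
  inverses, so the set of senders of a member appears inverted and must be compared with the set
  itself. Each discretization costs a unit of depth: senders are used at depth 1, counted at depth
  2, and the function is supported at depth 3.\<close>

section \<open>Separated sets and powers of subsets of a group\<close>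

text \<open>Zorn's lemma: a point related to no member of a maximal separated set could be added to
  it. The relation need not be transitive, so it can express closeness, both for the metric and for
  displacements in the unipotent group.\<close>

lemma maximal_separated:
  assumes refl: "\<And>x. x \<in> X \<Longrightarrow> r x x" and sym: "\<And>x y. x \<in> X \<Longrightarrow> y \<in> X \<Longrightarrow> r x y \<Longrightarrow> r y x"
  shows "\<exists>N\<subseteq>X. (\<forall>x\<in>N. \<forall>y\<in>N. x \<noteq> y \<longrightarrow> \<not> r x y) \<and> (\<forall>x\<in>X. \<exists>z\<in>N. r z x)"
proof -
  define \<A> where "\<A> = {N. N \<subseteq> X \<and> (\<forall>x\<in>N. \<forall>y\<in>N. x \<noteq> y \<longrightarrow> \<not> r x y)}"
  have "\<exists>N\<in>\<A>. \<forall>Y\<in>\<A>. N \<subseteq> Y \<longrightarrow> Y = N"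
  proof (rule subset_Zorn')
    fix \<C> assume C: "subset.chain \<A> \<C>"
    show "\<Union> \<C> \<in> \<A>" unfolding \<A>_def
    proof (intro CollectI conjI ballI impI)
      show "\<Union> \<C> \<subseteq> X" using C unfolding subset.chain_def \<A>_def by blast
      fix x y assume xy: "x \<in> \<Union> \<C>" "y \<in> \<Union> \<C>" "x \<noteq> y"
      then obtain A B where AB: "A \<in> \<C>" "B \<in> \<C>" "x \<in> A" "y \<in> B" by blast
      then have "A \<subseteq> B \<or> B \<subseteq> A" using C unfolding subset_chain_def by blast
      then obtain D where "D \<in> \<C>" "x \<in> D" "y \<in> D" using AB by blast
      then show "\<not> r x y" using C xy(3) unfolding subset.chain_def \<A>_def by blast
    qed
  qed
  then obtain N where N: "N \<in> \<A>" "\<And>Y. Y \<in> \<A> \<Longrightarrow> N \<subseteq> Y \<Longrightarrow> Y = N" by blast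
  have "\<exists>z\<in>N. r z x" if x: "x \<in> X" for x
  proof (rule ccontr)
    assume n: "\<not> ?thesis"
    have NX: "N \<subseteq> X" using N(1) unfolding \<A>_def by blast
    have xN: "\<not> r y x" if "y \<in> N" for y using n that by blast
    have xN': "\<not> r x y" if "y \<in> N" for y using xN[OF that] sym[OF x, of y] subsetD[OF NX that] by blast
    have NN: "\<not> r y z" if "y \<in> N" "z \<in> N" "y \<noteq> z" for y z using N(1) that unfolding \<A>_def by blast
    have "insert x N \<in> \<A>" unfolding \<A>_def
    proof (intro CollectI conjI ballI impI)
      show "insert x N \<subseteq> X" using NX x by blast
      fix y z assume "y \<in> insert x N" "z \<in> insert x N" "y \<noteq> z"
      then show "\<not> r y z" using xN xN' NN by (metis insertE)
    qed
    then have "x \<in> N" using N(2)[of "insert x N"] by blast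
    then show False using n refl[OF x] by blast
  qed
  moreover have "N \<subseteq> X" "\<And>x y. x \<in> N \<Longrightarrow> y \<in> N \<Longrightarrow> x \<noteq> y \<Longrightarrow> \<not> r x y"
    using N(1) unfolding \<A>_def by blast+
  ultimately show ?thesis by blast
qed

lemma (in group) set_power_closed: "S \<subseteq> carrier G \<Longrightarrow> set_power G S n \<subseteq> carrier G"
  by (induction n) (auto simp: set_mult_def)

lemma (in group) set_power_SucI: "x \<in> set_power G S n \<Longrightarrow> s \<in> S \<Longrightarrow> x \<otimes> s \<in> set_power G S (Suc n)"
  by (auto simp: set_mult_def)

lemma (in group) set_power_SucE:
  assumes "x \<in> set_power G S (Suc n)"
  obtains y s where "y \<in> set_power G S n" "s \<in> S" "x = y \<otimes> s"
  using assms by (auto simp: set_mult_def)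

lemma (in group) set_power_mult:
  assumes S: "S \<subseteq> carrier G" and x: "x \<in> set_power G S m" and y: "y \<in> set_power G S n"
  shows "x \<otimes> y \<in> set_power G S (m + n)"
  using y
proof (induction n arbitrary: y)
  case 0
  then show ?case using x set_power_closed[OF S, of m] by (metis add_0_right r_one set_power.simps(1) singletonD subsetD)
next
  case (Suc n)
  then obtain z s where z: "z \<in> set_power G S n" "s \<in> S" "y = z \<otimes> s" by (elim set_power_SucE)
  have "x \<otimes> z \<otimes> s \<in> set_power G S (Suc (m + n))" by (intro set_power_SucI Suc.IH z)
  moreover have "x \<in> carrier G" "z \<in> carrier G" "s \<in> carrier G"
    using x z S set_power_closed[OF S] by blast+
  ultimately show ?case using z(3) by (simp add: m_assoc)
qed

lemma (in group) set_power_subset: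
  assumes "S \<subseteq> S'"
  shows "set_power G S n \<subseteq> set_power G S' n"
proof (induction n)
  case (Suc n) then show ?case using assms by (auto simp: set_mult_def)
qed simp

lemma (in group) set_power_mono:
  assumes S: "S \<subseteq> carrier G" "\<one> \<in> S" and mn: "m \<le> n"
  shows "set_power G S m \<subseteq> set_power G S n"
  using mn
proof (induction n rule: dec_induct)
  case (step n)
  have "set_power G S n \<subseteq> set_power G S (Suc n)"
    using set_power_SucI[of _ S n \<one>] S(2) set_power_closed[OF S(1), of n] by (metis r_one subsetD subsetI)
  then show ?case using step by blast
qed simp

text \<open>Used with \<open>P n\<close> meaning \<open>x \<in> L n\<close>: it provides the exact
  level of a nonzero field element.\<close>

lemma int_threshold:
  fixes a b :: int
  assumes mono: "\<And>m n. m \<le> n \<Longrightarrow> P m \<Longrightarrow> P n" and a: "P a" and b: "\<not> P b"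
  shows "\<exists>k. P k \<and> \<not> P (k - 1)"
proof (rule ccontr)
  assume n: "\<not> ?thesis"
  have "b \<le> a" using mono[of a b] a b by linarith
  then have "P b"
  proof (induction b rule: int_le_induct)
    case (step i) then show ?case using n by blast
  qed (rule a)
  then show False using b by simp
qed

section \<open>Filtration of a local field\<close>

text \<open>The sets \<open>L n\<close> stand for the balls \<open>{x. \<bar>x\<bar> \<le> exp n}\<close> of an absolute value, but the ring operations
  may lose the constant \<open>c\<close>. This covers the archimedean and the non-archimedean fields uniformly and
  avoids the classification of local fields.\<close>

locale filtered_field = field K for K (structure) +
  fixes L :: "int \<Rightarrow> 'a set" and c :: int and \<pi> :: 'a
  assumes c_nonneg: "0 \<le> c"
    and L_carrier: "L n \<subseteq> carrier K"
    and L_mono: "m \<le> n \<Longrightarrow> L m \<subseteq> L n"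
    and L_zero: "\<zero> \<in> L n"
    and L_one: "\<one> \<in> L 0"
    and L_mult: "x \<in> L m \<Longrightarrow> y \<in> L n \<Longrightarrow> x \<otimes> y \<in> L (m + n + c)"
    and L_add: "x \<in> L n \<Longrightarrow> y \<in> L n \<Longrightarrow> x \<oplus> y \<in> L (n + c)"
    and L_minus: "x \<in> L n \<Longrightarrow> \<ominus> x \<in> L (n + c)"
    and L_inv: "x \<in> carrier K \<Longrightarrow> x \<notin> L n \<Longrightarrow> inv x \<in> L (- n + c)"
    and L_exhaust: "x \<in> carrier K \<Longrightarrow> \<exists>n. x \<in> L n"
    and L_separated: "x \<in> carrier K \<Longrightarrow> x \<noteq> \<zero> \<Longrightarrow> \<exists>n. x \<notin> L n"
    and \<pi>_carrier: "\<pi> \<in> carrier K" and \<pi>_nonzero: "\<pi> \<noteq> \<zero>"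
    and \<pi>_shift: "x \<in> carrier K \<Longrightarrow> \<pi> \<otimes> x \<in> L n \<longleftrightarrow> x \<in> L (n + 1)"
    and L_cover: "\<exists>F. finite F \<and> F \<subseteq> carrier K \<and> (\<forall>x\<in>L n. \<exists>y\<in>F. x \<ominus> y \<in> L m)"

section \<open>Continuity arguments in a topological field\<close>

context topological_field
begin

lemma continuous_lmult:
  assumes "b \<in> carrier K"
  shows "continuous_map T T (\<lambda>x. b \<otimes> x)"
proof -
  have "continuous_map T (prod_topology T T) (\<lambda>x. (b, x))"
    using assms by (simp add: continuous_map_pairwise o_def topspace_eq)
  from continuous_map_compose[OF this continuous_mult] show ?thesis by (simp add: o_def)
qed

lemma continuous_ladd:
  assumes "b \<in> carrier K"
  shows "continuous_map T T (\<lambda>x. b \<oplus> x)"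
proof -
  have "continuous_map T (prod_topology T T) (\<lambda>x. (b, x))"
    using assms by (simp add: continuous_map_pairwise o_def topspace_eq)
  from continuous_map_compose[OF this continuous_add] show ?thesis by (simp add: o_def)
qed

lemma openin_lmult_image:
  assumes "b \<in> carrier K" "b \<noteq> \<zero>" "openin T U"
  shows "openin T ((\<lambda>x. b \<otimes> x) ` U)"
proof -
  have U: "U \<subseteq> carrier K" using openin_subset[OF assms(3)] topspace_eq by simp
  have ib: "inv b \<in> carrier K" using assms(1,2) field_Units by auto
  have bi: "b \<otimes> inv b = \<one>" "inv b \<otimes> b = \<one>" using assms(1,2) field_Units by auto
  have "(\<lambda>x. b \<otimes> x) ` U = {x \<in> topspace T. inv b \<otimes> x \<in> U}"
  proof (intro equalityI subsetI)
    fix x assume "x \<in> (\<lambda>x. b \<otimes> x) ` U"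
    then obtain u where u: "u \<in> U" "x = b \<otimes> u" by auto
    have "inv b \<otimes> (b \<otimes> u) = u" using u U assms ib bi by (metis l_one m_assoc subsetD)
    then show "x \<in> {x \<in> topspace T. inv b \<otimes> x \<in> U}" using u U assms by (auto simp: topspace_eq)
  next
    fix x assume x: "x \<in> {x \<in> topspace T. inv b \<otimes> x \<in> U}"
    then have xc: "x \<in> carrier K" by (simp add: topspace_eq)
    have "b \<otimes> (inv b \<otimes> x) = x" using xc assms ib bi by (metis l_one m_assoc)
    then show "x \<in> (\<lambda>x. b \<otimes> x) ` U" using x by (metis (mono_tags, lifting) image_eqI mem_Collect_eq)
  qed
  then show ?thesis using openin_continuous_map_preimage[OF continuous_lmult[OF ib] assms(3)] by simp
qed

lemma openin_ladd_image:
  assumes "b \<in> carrier K" "openin T U"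
  shows "openin T ((\<lambda>x. b \<oplus> x) ` U)"
proof -
  have U: "U \<subseteq> carrier K" using openin_subset[OF assms(2)] topspace_eq by simp
  have ib: "\<ominus> b \<in> carrier K" using assms by auto
  have "(\<lambda>x. b \<oplus> x) ` U = {x \<in> topspace T. \<ominus> b \<oplus> x \<in> U}"
  proof (intro equalityI subsetI)
    fix x assume "x \<in> (\<lambda>x. b \<oplus> x) ` U"
    then obtain u where u: "u \<in> U" "x = b \<oplus> u" by auto
    have "\<ominus> b \<oplus> (b \<oplus> u) = u" using u U assms by (simp add: r_neg1 subsetD)
    then show "x \<in> {x \<in> topspace T. \<ominus> b \<oplus> x \<in> U}" using u U assms by (auto simp: topspace_eq)
  next
    fix x assume x: "x \<in> {x \<in> topspace T. \<ominus> b \<oplus> x \<in> U}"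
    then have xc: "x \<in> carrier K" by (simp add: topspace_eq)
    have "b \<oplus> (\<ominus> b \<oplus> x) = x" using xc assms by (simp add: r_neg2)
    then show "x \<in> (\<lambda>x. b \<oplus> x) ` U" using x by (metis (mono_tags, lifting) image_eqI mem_Collect_eq)
  qed
  then show ?thesis using openin_continuous_map_preimage[OF continuous_ladd[OF ib] assms(2)] by simp
qed

text \<open>Tube lemma around the compact set {y} x C: continuity at y becomes uniform over C. For y
  = 0 it says that small multipliers shrink C into a given neighbourhood of 0.\<close>

lemma tube_multiplier:
  assumes "compactin T C" "openin T U" "y \<in> carrier K" "\<forall>x\<in>C. y \<otimes> x \<in> U"
  shows "\<exists>V. openin T V \<and> y \<in> V \<and> (\<forall>b\<in>V. \<forall>x\<in>C. b \<otimes> x \<in> U)"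
proof -
  let ?W = "{z \<in> topspace (prod_topology T T). (\<lambda>(x, y). x \<otimes> y) z \<in> U}"
  have C: "C \<subseteq> carrier K" using compactin_subset_topspace[OF assms(1)] topspace_eq by simp
  have W: "openin (prod_topology T T) ?W"
    by (rule openin_continuous_map_preimage[OF continuous_mult assms(2)])
  have z: "compactin T {y}" using assms(3) by (simp add: topspace_eq)
  have "{y} \<times> C \<subseteq> ?W" using C assms(3,4) by (auto simp: topspace_eq)
  from Wallace_theorem_prod_topology[OF z assms(1) W this]
  obtain V V' where V: "openin T V" "openin T V'" "{y} \<subseteq> V" "C \<subseteq> V'" "V \<times> V' \<subseteq> ?W" by auto
  have "\<forall>b\<in>V. \<forall>x\<in>C. b \<otimes> x \<in> U"
  proof (intro ballI)
    fix b x assume "b \<in> V" "x \<in> C"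
    then have "(b, x) \<in> ?W" using V by blast
    then show "b \<otimes> x \<in> U" by simp
  qed
  then show ?thesis using V by blast
qed

lemma compactin_mult_set:
  assumes "compactin T A" "compactin T B"
  shows "compactin T ((\<lambda>(x, y). x \<otimes> y) ` (A \<times> B))"
  by (rule image_compactin[OF _ continuous_mult]) (simp add: compactin_Times assms)

lemma compactin_add_set:
  assumes "compactin T A" "compactin T B"
  shows "compactin T ((\<lambda>(x, y). x \<oplus> y) ` (A \<times> B))"
  by (rule image_compactin[OF _ continuous_add]) (simp add: compactin_Times assms)

end

context local_field
begin

lemma not_openin_zero: "\<not> openin T {\<zero>}"
proof
  assume o: "openin T {\<zero>}"
  have "openin T {x}" if "x \<in> carrier K" for x
  proof -
    have "(\<lambda>y. x \<oplus> y) ` {\<zero>} = {x}" using that by auto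
    then show ?thesis using openin_ladd_image[OF that o] by metis
  qed
  then have "T = discrete_topology (carrier K)"
    using topspace_eq discrete_topology_unique[of "carrier K" T] by metis
  then show False using nondiscrete by simp
qed

lemma open_zero_nontrivial:
  assumes "openin T U" "\<zero> \<in> U"
  shows "\<exists>b\<in>U. b \<noteq> \<zero>"
proof (rule ccontr)
  assume "\<not> ?thesis"
  then have "U = {\<zero>}" using assms(2) by blast
  then show False using assms(1) not_openin_zero by metis
qed

lemma closedin_compact: "compactin T C \<Longrightarrow> closedin T C"
  using hausdorff compactin_imp_closedin by blast

end

section \<open>Construction of the filtration from a contraction\<close>

context local_field
begin

text \<open>Since 0 times V is contained in U, the tube lemma gives a neighbourhood of 0 whose
  elements map V into U, and nondiscreteness supplies a nonzero one. The point 1 is put into V but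
  removed from U, so aV is strictly smaller than V: a acts like a uniformizer, or like a real number
  below 1.\<close>

lemma contracting_element:
  obtains V U a where "compactin T V" "openin T U" "U \<subseteq> V" "\<zero> \<in> U" "\<one> \<in> V"
    "a \<in> carrier K" "a \<noteq> \<zero>" "\<And>x. x \<in> V \<Longrightarrow> a \<otimes> x \<in> V" "\<And>x. x \<in> V \<Longrightarrow> a \<otimes> x \<noteq> \<one>"
proof -
  have zt: "\<zero> \<in> topspace T" and ot: "\<one> \<in> topspace T" by (simp_all add: topspace_eq)
  obtain U0 V0 where U0: "openin T U0" "compactin T V0" "\<zero> \<in> U0" "U0 \<subseteq> V0"
    using locally_compact zt unfolding locally_compact_space_def by blast
  define U where "U = U0 - {\<one>}"
  define V where "V = insert \<one> V0"
  have c1: "compactin T {\<one>}" using ot by simp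
  have oU: "openin T U" unfolding U_def by (rule openin_diff[OF U0(1) closedin_compact[OF c1]])
  have cV: "compactin T V" unfolding V_def using compactin_Un[OF c1 U0(2)] by simp
  have VC: "V \<subseteq> carrier K" using compactin_subset_topspace[OF cV] topspace_eq by simp
  have zU: "\<zero> \<in> U" using U0(3) one_not_zero unfolding U_def by simp
  have UV: "U \<subseteq> V" using U0(4) unfolding U_def V_def by blast
  have "\<forall>x\<in>V. \<zero> \<otimes> x \<in> U" using VC zU by auto
  from tube_multiplier[OF cV oU zero_closed this]
  obtain W where W: "openin T W" "\<zero> \<in> W" "\<forall>b\<in>W. \<forall>x\<in>V. b \<otimes> x \<in> U" by blast
  obtain a where a: "a \<in> W" "a \<noteq> \<zero>" using open_zero_nontrivial[OF W(1,2)] by blast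
  have ac: "a \<in> carrier K" using a(1) openin_subset[OF W(1)] topspace_eq by blast
  show ?thesis
  proof (rule that[OF cV oU UV zU _ ac a(2)])
    show "\<one> \<in> V" unfolding V_def by simp
    show "a \<otimes> x \<in> V" if "x \<in> V" for x using W(3) a(1) that UV by blast
    show "a \<otimes> x \<noteq> \<one>" if "x \<in> V" for x using W(3) a(1) that unfolding U_def by blast
  qed
qed

end

locale contracted_field = local_field +
  fixes V U a
  assumes cV: "compactin T V" and oU: "openin T U" and UV: "U \<subseteq> V" and zU: "\<zero> \<in> U"
    and oneV: "\<one> \<in> V" and a_closed: "a \<in> carrier K" and a_nonzero: "a \<noteq> \<zero>"
    and aV: "x \<in> V \<Longrightarrow> a \<otimes> x \<in> V" and aV_one: "x \<in> V \<Longrightarrow> a \<otimes> x \<noteq> \<one>"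
begin

text \<open>The integer power a^(-n); the sign makes \<open>L n\<close> grow with n. All
  \<open>L n\<close> are dilates of the single compact set V, and this homogeneity reduces estimates
  on \<open>L n\<close> to estimates on V.\<close>

definition sh :: "int \<Rightarrow> 'a" where
  "sh n = (if n \<ge> 0 then inv a [^] nat n else a [^] nat (- n))"

definition L :: "int \<Rightarrow> 'a set" where
  "L n = (\<lambda>x. sh n \<otimes> x) ` V"

lemma V_carrier: "V \<subseteq> carrier K"
  using compactin_subset_topspace[OF cV] topspace_eq by simp

lemma a_inv: "inv a \<in> carrier K" "inv a \<noteq> \<zero>" "a \<otimes> inv a = \<one>"
proof -
  have "a \<in> Units K" using field_Units a_closed a_nonzero by blast
  then show "inv a \<in> carrier K" "a \<otimes> inv a = \<one>" by auto
  then show "inv a \<noteq> \<zero>" using a_closed by auto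
qed

lemma sh_closed: "sh n \<in> carrier K"
  unfolding sh_def using nat_pow_closed[OF a_closed] nat_pow_closed[OF a_inv(1)] by (simp del: pow_nat)

lemma pow_nonzero: "x \<in> carrier K \<Longrightarrow> x \<noteq> \<zero> \<Longrightarrow> x [^] (k::nat) \<noteq> \<zero>"
proof (induction k)
  case (Suc k) then show ?case using integral_iff by (metis nat_pow_Suc nat_pow_closed)
qed simp

lemma sh_nonzero: "sh n \<noteq> \<zero>"
  unfolding sh_def using pow_nonzero[OF a_closed a_nonzero] pow_nonzero[OF a_inv(1,2)]
  by (simp del: pow_nat)

lemma sh_0: "sh 0 = \<one>"
  by (simp add: sh_def del: pow_nat)

lemma sh_step: "sh n = a \<otimes> sh (n + 1)"
proof (cases "n \<ge> 0")
  case True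
  then have "nat (n + 1) = Suc (nat n)" by simp
  then have "sh (n + 1) = inv a [^] nat n \<otimes> inv a" using True by (simp add: sh_def del: pow_nat)
  also have "\<dots> = inv a \<otimes> inv a [^] nat n" using a_inv by (simp add: m_comm del: pow_nat)
  finally have "a \<otimes> sh (n + 1) = (a \<otimes> inv a) \<otimes> inv a [^] nat n"
    using m_assoc[OF a_closed a_inv(1) nat_pow_closed[OF a_inv(1), of "nat n"]] by metis
  then show ?thesis using True a_inv nat_pow_closed[OF a_inv(1)] by (simp add: sh_def del: pow_nat)
next
  case False
  then have "nat (- n) = Suc (nat (- (n + 1)))" by simp
  then have "sh n = a [^] nat (- (n + 1)) \<otimes> a" using False by (simp add: sh_def del: pow_nat)
  also have "\<dots> = a \<otimes> a [^] nat (- (n + 1))" using a_closed by (simp add: m_comm del: pow_nat)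
  also have "a [^] nat (- (n + 1)) = sh (n + 1)" using False by (cases "n = -1") (auto simp: sh_def simp del: pow_nat)
  finally show ?thesis .
qed

lemma sh_add: "sh (m + n) = sh m \<otimes> sh n"
proof (induction m rule: int_induct[of _ 0])
  case base then show ?case using sh_0 sh_closed by simp
next
  case (step1 i)
  have "a \<otimes> sh (i + 1 + n) = sh (i + n)" using sh_step[of "i + n"] by (simp add: add_ac)
  also have "\<dots> = a \<otimes> (sh (i + 1) \<otimes> sh n)"
    using step1 sh_step[of i] sh_closed a_closed by (simp add: m_assoc)
  finally show ?case using m_lcancel[OF a_nonzero a_closed] sh_closed by simp
next
  case (step2 i)
  have "sh (i - 1 + n) = a \<otimes> sh (i + n)" using sh_step[of "i - 1 + n"] by (simp add: algebra_simps)
  also have "\<dots> = (a \<otimes> sh i) \<otimes> sh n" using step2 sh_closed a_closed by (simp add: m_assoc)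
  also have "a \<otimes> sh i = sh (i - 1)" using sh_step[of "i - 1"] by simp
  finally show ?case .
qed

lemma sh_neg: "sh (- n) \<otimes> sh n = \<one>"
  using sh_add[of "- n" n] sh_0 by simp

lemma L_0: "L 0 = V"
  unfolding L_def using V_carrier sh_0 by (force simp: image_def)

lemma L_carrier: "L n \<subseteq> carrier K"
  unfolding L_def using V_carrier sh_closed by blast

lemma L_scale:
  assumes "x \<in> carrier K"
  shows "sh m \<otimes> x \<in> L (m + n) \<longleftrightarrow> x \<in> L n"
proof
  assume "sh m \<otimes> x \<in> L (m + n)"
  then obtain v where v: "v \<in> V" "sh m \<otimes> x = sh (m + n) \<otimes> v" unfolding L_def by blast
  then have vc: "v \<in> carrier K" using V_carrier by blast
  have "sh m \<otimes> x = sh m \<otimes> (sh n \<otimes> v)" using v(2) sh_add sh_closed vc by (simp add: m_assoc)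
  then have "x = sh n \<otimes> v" using m_lcancel[OF sh_nonzero sh_closed] assms vc sh_closed by simp
  then show "x \<in> L n" using v unfolding L_def by blast
next
  assume "x \<in> L n"
  then obtain v where v: "v \<in> V" "x = sh n \<otimes> v" unfolding L_def by blast
  then have vc: "v \<in> carrier K" using V_carrier by blast
  have "sh m \<otimes> x = sh (m + n) \<otimes> v" using v(2) sh_add sh_closed vc by (simp add: m_assoc)
  then show "sh m \<otimes> x \<in> L (m + n)" using v unfolding L_def by blast
qed

lemma L_mono1: "L n \<subseteq> L (n + 1)"
proof
  fix x assume "x \<in> L n"
  then obtain v where v: "v \<in> V" "x = sh n \<otimes> v" unfolding L_def by blast
  then have vc: "v \<in> carrier K" using V_carrier by blast
  have "x = sh (n + 1) \<otimes> (a \<otimes> v)" using v(2) sh_step[of n] sh_closed[of "n + 1"] a_closed vc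
    by (simp add: m_assoc m_comm m_lcomm)
  then show "x \<in> L (n + 1)" using aV[OF v(1)] unfolding L_def by blast
qed

lemma L_mono: "m \<le> n \<Longrightarrow> L m \<subseteq> L n"
proof (induction n rule: int_ge_induct)
  case (step i) then show ?case using L_mono1 by blast
qed simp

lemma sh_L: "sh n \<in> L n"
  unfolding L_def using oneV sh_closed by (metis image_eqI r_one)

lemma L_zero: "\<zero> \<in> L n"
  unfolding L_def using zU UV sh_closed by (metis image_eqI r_null subsetD)

lemma compactin_L: "compactin T (L n)"
  unfolding L_def by (rule image_compactin[OF cV continuous_lmult[OF sh_closed]])

text \<open>For i < j, \<open>sh i\<close> is \<open>sh j\<close> times an element of
  \<open>L (-1)\<close>, that is, of aV. Both cannot be close to y \<noteq> 0: as 1 is not in aV, y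
  can be separated from the compact set y \<open>L (-1)\<close>. Near 0 no \<open>sh i\<close> with
  i \<ge> 0 occurs at all, since products of W with V avoid 1 while
  \<open>sh i \<otimes> sh (- i)\<close> is 1.\<close>

lemma sh_isolated:
  assumes "y \<in> carrier K"
  shows "\<exists>W. openin T W \<and> y \<in> W \<and> (\<forall>i\<ge>0. \<forall>j>i. sh i \<in> W \<longrightarrow> sh j \<notin> W)"
proof (cases "y = \<zero>")
  case True
  have c1: "compactin T {\<one>}" by (simp add: topspace_eq)
  have o: "openin T (topspace T - {\<one>})" by (rule openin_diff[OF openin_topspace closedin_compact[OF c1]])
  have "\<forall>x\<in>V. \<zero> \<otimes> x \<in> topspace T - {\<one>}" using V_carrier by (auto simp: topspace_eq)
  from tube_multiplier[OF cV o zero_closed this]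
  obtain W where W: "openin T W" "\<zero> \<in> W" "\<forall>b\<in>W. \<forall>x\<in>V. b \<otimes> x \<in> topspace T - {\<one>}" by blast
  have "sh i \<notin> W" if "i \<ge> 0" for i
  proof
    assume "sh i \<in> W"
    moreover have "sh (- i) \<in> V" using sh_L[of "- i"] L_mono[of "- i" 0] that L_0 by auto
    ultimately have "sh i \<otimes> sh (- i) \<noteq> \<one>" using W(3) by blast
    then show False using sh_neg[of "- i"] by simp
  qed
  then show ?thesis using W True by blast
next
  case False
  define A where "A = (\<lambda>x. x \<otimes> y) ` L (-1)"
  have A_eq: "A = (\<lambda>x. y \<otimes> x) ` L (-1)"
    unfolding A_def by (rule image_cong[OF refl]) (use L_carrier[of "-1"] assms m_comm in blast)
  have cA: "compactin T A" unfolding A_eq by (rule image_compactin[OF compactin_L continuous_lmult[OF assms]])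
  have "y \<notin> A"
  proof
    assume "y \<in> A"
    then obtain x where x: "x \<in> L (-1)" "y = y \<otimes> x" unfolding A_eq by blast
    then have "y \<otimes> x = y \<otimes> \<one>" using assms by simp
    then have "x = \<one>" using m_lcancel[OF False assms] x(1) L_carrier by blast
    then obtain v where "v \<in> V" "\<one> = sh (-1) \<otimes> v" using x(1) unfolding L_def by blast
    moreover have "sh (-1) = a" using sh_step[of "-1"] sh_0 a_closed by simp
    ultimately show False using aV_one by metis
  qed
  then have "disjnt {y} A" unfolding disjnt_def by blast
  have cy: "compactin T {y}" using assms by (simp add: topspace_eq)
  obtain W1 W2 where W: "openin T W1" "openin T W2" "{y} \<subseteq> W1" "A \<subseteq> W2" "disjnt W1 W2"
    by (rule Hausdorff_space_compact_separation[OF hausdorff cy cA \<open>disjnt {y} A\<close>])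
  have "\<forall>x\<in>L (-1). y \<otimes> x \<in> W2" using W(4) unfolding A_eq by blast
  from tube_multiplier[OF compactin_L W(2) assms this]
  obtain W3 where W3: "openin T W3" "y \<in> W3" "\<forall>b\<in>W3. \<forall>x\<in>L (-1). b \<otimes> x \<in> W2" by blast
  show ?thesis
  proof (intro exI[of _ "W1 \<inter> W3"] conjI allI impI)
    show "openin T (W1 \<inter> W3)" using W(1) W3(1) by blast
    show "y \<in> W1 \<inter> W3" using W(3) W3(2) by blast
    fix i j :: int assume ij: "0 \<le> i" "i < j" "sh i \<in> W1 \<inter> W3"
    show "sh j \<notin> W1 \<inter> W3"
    proof
      assume j: "sh j \<in> W1 \<inter> W3"
      have "sh (i - j) \<in> L (-1)" using sh_L[of "i - j"] L_mono[of "i - j" "-1"] ij(2) by auto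
      then have "sh j \<otimes> sh (i - j) \<in> W2" using W3(3) j by blast
      then have "sh i \<in> W2" using sh_add[of j "i - j"] by simp
      then show False using ij(3) W(5) by (auto simp: disjnt_iff)
    qed
  qed
qed

text \<open>If \<open>w\<close> lay in every \<open>L n\<close>, all \<open>sh i\<close> with \<open>i \<ge> 0\<close> would lie in one compact set and
  two of them would be close, which is excluded by the previous lemma.\<close>

lemma L_separated:
  assumes "w \<in> carrier K" "w \<noteq> \<zero>"
  shows "\<exists>n. w \<notin> L n"
proof (rule ccontr)
  assume "\<not> ?thesis"
  then have all: "w \<in> L n" for n by blast
  have wU: "w \<in> Units K" using field_Units assms by blast
  then have iw: "inv w \<in> carrier K" "w \<otimes> inv w = \<one>" by auto
  define P where "P = (\<lambda>v. inv w \<otimes> v) ` V"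
  have cP: "compactin T P" unfolding P_def by (rule image_compactin[OF cV continuous_lmult[OF iw(1)]])
  have P: "sh (int k) \<in> P" for k
  proof -
    have "sh (int k) \<otimes> w \<in> L (int k + (- int k))" using L_scale[OF assms(1), of "int k" "- int k"] all by blast
    then have "sh (int k) \<otimes> w \<in> V" using L_0 by simp
    moreover have "inv w \<otimes> (sh (int k) \<otimes> w) = sh (int k)"
      using iw assms(1) sh_closed[of "int k"] by (metis l_one m_assoc m_comm m_closed)
    ultimately show ?thesis unfolding P_def by (metis image_eqI)
  qed
  define \<W> where "\<W> = {W. openin T W \<and> (\<forall>i\<ge>0. \<forall>j>i. sh i \<in> W \<longrightarrow> sh j \<notin> W)}"
  have PC: "P \<subseteq> carrier K" using compactin_subset_topspace[OF cP] topspace_eq by simp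
  have cov: "P \<subseteq> \<Union> \<W>"
  proof
    fix y assume "y \<in> P"
    then obtain W where "openin T W" "y \<in> W" "\<forall>i\<ge>0. \<forall>j>i. sh i \<in> W \<longrightarrow> sh j \<notin> W"
      using sh_isolated[of y] PC by blast
    then show "y \<in> \<Union> \<W>" unfolding \<W>_def by blast
  qed
  obtain \<F> where F: "finite \<F>" "\<F> \<subseteq> \<W>" "P \<subseteq> \<Union> \<F>"
    using compactinD[OF cP, of \<W>] cov unfolding \<W>_def by blast
  have "\<forall>k. \<exists>W\<in>\<F>. sh (int k) \<in> W" using P F(3) by blast
  then obtain h where h: "\<And>k. h k \<in> \<F>" "\<And>k. sh (int k) \<in> h k" by metis
  have "finite (range h)" by (rule finite_subset[OF _ F(1)]) (use h in blast)
  then have "\<not> inj h" using finite_imageD infinite_UNIV_nat by blast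
  then obtain i j where "i \<noteq> j" "h i = h j" unfolding inj_def by blast
  then obtain i j where ij: "i < j" "h i = h j" by (metis nat_neq_iff)
  have "h i \<in> \<W>" using h F by blast
  then have "\<forall>k\<ge>0. \<forall>l>k. sh k \<in> h i \<longrightarrow> sh l \<notin> h i" unfolding \<W>_def by blast
  from this[rule_format, of "int i" "int j"] have "sh (int j) \<notin> h i" using h(2)[of i] ij(1) by simp
  then show False using h(2)[of j] ij(2) by simp
qed

text \<open>The compact sets \<open>L (- k)\<close> decrease to {0} by \<open>L_separated\<close>,
  so one of them lies in W.\<close>

lemma L_small:
  assumes "openin T W" "\<zero> \<in> W"
  shows "\<exists>n. L n \<subseteq> W"
proof -
  define f where "f = (\<lambda>k::nat. W \<union> (topspace T - L (- int k)))"
  have o: "openin T (f k)" for k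
    unfolding f_def by (rule openin_Un[OF assms(1) openin_diff[OF openin_topspace closedin_compact[OF compactin_L]]])
  have cov: "L 0 \<subseteq> \<Union> (range f)"
  proof
    fix x assume x: "x \<in> L 0"
    then have xc: "x \<in> carrier K" using L_carrier by blast
    show "x \<in> \<Union> (range f)"
    proof (cases "x = \<zero>")
      case True then show ?thesis using assms(2) unfolding f_def by blast
    next
      case False
      then obtain n where n: "x \<notin> L n" using L_separated xc by blast
      have "L (- int (nat (- n))) \<subseteq> L n" by (rule L_mono) simp
      then have "x \<in> f (nat (- n))" using n xc unfolding f_def topspace_eq by blast
      then show ?thesis by blast
    qed
  qed
  obtain \<F> where F: "finite \<F>" "\<F> \<subseteq> range f" "L 0 \<subseteq> \<Union> \<F>"
    using compactinD[OF compactin_L[of 0], of "range f"] cov o by blast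
  obtain S where S: "finite S" "\<F> = f ` S" using finite_subset_image[OF F(1,2)] by blast
  define k where "k = Max (insert 0 S)"
  have "f i \<subseteq> f k" if "i \<in> S" for i
  proof -
    have "i \<le> k" unfolding k_def using S(1) that by simp
    then have "L (- int k) \<subseteq> L (- int i)" by (intro L_mono) simp
    then show ?thesis unfolding f_def by blast
  qed
  then have "L 0 \<subseteq> f k" using F(3) S(2) by blast
  moreover have "L (- int k) \<subseteq> L 0" by (rule L_mono) simp
  ultimately have "L (- int k) \<subseteq> W" unfolding f_def by blast
  then show ?thesis by blast
qed

text \<open>Multipliers near 0 map C into U, and \<open>sh n\<close> is near 0 for very negative n
  by \<open>L_small\<close>; undoing the dilation by \<open>sh n\<close> gives the level of
  C.\<close>

lemma compact_absorbed:
  assumes "compactin T C"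
  shows "\<exists>n. C \<subseteq> L n"
proof -
  have CC: "C \<subseteq> carrier K" using compactin_subset_topspace[OF assms] topspace_eq by simp
  have "\<forall>x\<in>C. \<zero> \<otimes> x \<in> U" using zU CC by auto
  from tube_multiplier[OF assms oU zero_closed this]
  obtain W where W: "openin T W" "\<zero> \<in> W" "\<forall>b\<in>W. \<forall>x\<in>C. b \<otimes> x \<in> U" by blast
  obtain n where n: "L n \<subseteq> W" using L_small W by blast
  have "C \<subseteq> L (- n)"
  proof
    fix x assume x: "x \<in> C"
    have "sh n \<otimes> x \<in> L (n + - n)" 
    proof -
      have "sh n \<in> W" using n sh_L by blast
      then have "sh n \<otimes> x \<in> V" using W(3) x UV by blast
      then show ?thesis using L_0 by simp
    qed
    then show "x \<in> L (- n)" using L_scale x CC by blast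
  qed
  then show ?thesis by blast
qed

lemma L_exhaust: "x \<in> carrier K \<Longrightarrow> \<exists>n. x \<in> L n"
  using compact_absorbed[of "{x}"] by (simp add: topspace_eq)

lemma sh_factor:
  assumes "x \<in> L n"
  obtains v where "v \<in> V" "x = sh n \<otimes> v" "v \<in> carrier K"
  using assms V_carrier unfolding L_def by blast

lemma L_level:
  assumes "x \<in> carrier K" "x \<noteq> \<zero>"
  shows "\<exists>k. x \<in> L k \<and> x \<notin> L (k - 1)"
proof -
  obtain n1 n2 where "x \<notin> L n1" "x \<in> L n2" using L_separated L_exhaust assms by blast
  then show ?thesis using int_threshold[of "\<lambda>n. x \<in> L n" n2 n1] L_mono by blast
qed

text \<open>By homogeneity each axiom with a loss need only be checked on V: the image of V under
  the operation is compact, hence absorbed by some level. Inversion is not defined on all of V;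
  there the compact set D serves, which avoids 0 and contains all elements of exact level 0.\<close>

lemma filtration: "\<exists>c. filtered_field K L c a"
proof -
  obtain c1 where c1: "(\<lambda>(x, y). x \<otimes> y) ` (V \<times> V) \<subseteq> L c1"
    using compact_absorbed[OF compactin_mult_set[OF cV cV]] by blast
  obtain c2 where c2: "(\<lambda>(x, y). x \<oplus> y) ` (V \<times> V) \<subseteq> L c2"
    using compact_absorbed[OF compactin_add_set[OF cV cV]] by blast
  obtain c3 where c3: "(\<lambda>x. \<ominus> x) ` V \<subseteq> L c3"
    using compact_absorbed[OF image_compactin[OF cV continuous_minus]] by blast
  define D where "D = V - (\<lambda>x. a \<otimes> x) ` U"
  have oD: "openin T ((\<lambda>x. a \<otimes> x) ` U)" by (rule openin_lmult_image[OF a_closed a_nonzero oU])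
  have "closedin T D" unfolding D_def by (rule closedin_diff[OF closedin_compact[OF cV] oD])
  then have cD: "compactin T D" using closed_compactin[OF cV, of D] unfolding D_def by blast
  have "\<zero> = a \<otimes> \<zero>" using a_closed by simp
  then have "\<zero> \<in> (\<lambda>x. a \<otimes> x) ` U" using zU by blast
  then have D0: "D \<subseteq> carrier K - {\<zero>}" using V_carrier unfolding D_def by blast
  have cD': "compactin (subtopology T (carrier K - {\<zero>})) D"
    using cD D0 by (simp add: compactin_subtopology)
  obtain c4 where c4: "(\<lambda>x. inv x) ` D \<subseteq> L c4"
    using compact_absorbed[OF image_compactin[OF cD' continuous_inverse]] by blast
  define c where "c = Max {0, c1, c2, c3, c4}"
  have cge: "0 \<le> c" "c1 \<le> c" "c2 \<le> c" "c3 \<le> c" "c4 \<le> c" unfolding c_def by simp_all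
  have "filtered_field K L c a"
  proof (unfold_locales)
    show "0 \<le> c" by (rule cge)
    show "L n \<subseteq> carrier K" for n by (rule L_carrier)
    show "L m \<subseteq> L n" if "m \<le> n" for m n by (rule L_mono[OF that])
    show "\<zero> \<in> L n" for n by (rule L_zero)
    show "\<one> \<in> L 0" using oneV L_0 by simp
    show "x \<otimes> y \<in> L (m + n + c)" if xy: "x \<in> L m" "y \<in> L n" for x y m n
    proof -
      obtain u where u: "u \<in> V" "x = sh m \<otimes> u" "u \<in> carrier K" using sh_factor xy by blast
      obtain v where v: "v \<in> V" "y = sh n \<otimes> v" "v \<in> carrier K" using sh_factor xy by blast
      have "u \<otimes> v \<in> L c" using c1 u v L_mono[OF cge(2)] by auto
      moreover have "x \<otimes> y = sh (m + n) \<otimes> (u \<otimes> v)"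
        using u v sh_closed sh_add by (simp add: m_ac)
      ultimately show ?thesis using L_scale[of "u \<otimes> v" "m + n" c] u v by simp
    qed
    show "x \<oplus> y \<in> L (n + c)" if xy: "x \<in> L n" "y \<in> L n" for x y n
    proof -
      obtain u where u: "u \<in> V" "x = sh n \<otimes> u" "u \<in> carrier K" using sh_factor xy by blast
      obtain v where v: "v \<in> V" "y = sh n \<otimes> v" "v \<in> carrier K" using sh_factor xy by blast
      have "u \<oplus> v \<in> L c" using c2 u v L_mono[OF cge(3)] by auto
      moreover have "x \<oplus> y = sh n \<otimes> (u \<oplus> v)"
        using u v sh_closed by (simp add: r_distr)
      ultimately show ?thesis using L_scale[of "u \<oplus> v" n c] u v by simp
    qed
    show "\<ominus> x \<in> L (n + c)" if x: "x \<in> L n" for x n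
    proof -
      obtain u where u: "u \<in> V" "x = sh n \<otimes> u" "u \<in> carrier K" using sh_factor x by blast
      have "\<ominus> u \<in> L c" using c3 u L_mono[OF cge(4)] by auto
      moreover have "\<ominus> x = sh n \<otimes> (\<ominus> u)" using u sh_closed by (simp add: r_minus)
      ultimately show ?thesis using L_scale[of "\<ominus> u" n c] u by simp
    qed
    show "inv x \<in> L (- n + c)" if x: "x \<in> carrier K" "x \<notin> L n" for x n
    proof -
      have x0: "x \<noteq> \<zero>" using x L_zero by blast
      obtain k where k: "x \<in> L k" "x \<notin> L (k - 1)" using L_level[OF x(1) x0] by blast
      have kn: "n < k" using k(1) x(2) L_mono by (meson not_le subsetD)
      \<comment> \<open>Normalization to exact level 0: y is in \<open>L 0\<close> but not in
        \<open>L (- 1)\<close>, hence in D.\<close>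
      define y where "y = sh (- k) \<otimes> x"
      have yc: "y \<in> carrier K" unfolding y_def using sh_closed x by simp
      have y: "y \<in> L 0" "y \<notin> L (- 1)"
        unfolding y_def using L_scale[OF x(1), of "- k" k] L_scale[OF x(1), of "- k" "k - 1"] k by auto
      have sh1: "sh (-1) = a" using sh_step[of "-1"] sh_0 a_closed by simp
      have "(\<lambda>x. a \<otimes> x) ` U \<subseteq> L (- 1)" unfolding L_def sh1 using UV by blast
      then have "y \<in> D" unfolding D_def using y L_0 by blast
      then have iy: "inv y \<in> L c" using c4 L_mono[OF cge(5)] by blast
      have y0: "y \<noteq> \<zero>" using y(2) L_zero by blast
      have U: "sh (- k) \<in> Units K" "x \<in> Units K" "y \<in> Units K"
        using field_Units sh_closed sh_nonzero x x0 yc y0 by auto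
      have xy: "x = sh k \<otimes> y" unfolding y_def using x sh_closed sh_neg[of "- k"]
        by (metis add.inverse_inverse l_one m_assoc)
      have "x \<otimes> (sh (- k) \<otimes> inv y) = (sh (- k) \<otimes> sh k) \<otimes> (y \<otimes> inv y)"
        unfolding xy using Units_closed[OF U(3)] Units_inv_closed[OF U(3)] sh_closed by (simp add: m_ac del: Units_r_inv)
      also have "\<dots> = \<one>" using sh_neg U by simp
      finally have ix: "inv x = sh (- k) \<otimes> inv y" using U x sh_closed by (simp add: comm_inv_char)
      have "inv x \<in> L (- k + c)" unfolding ix using L_scale[of "inv y" "- k" c] iy U by simp
      then show ?thesis using L_mono[of "- k + c" "- n + c"] kn by auto
    qed
    show "\<exists>n. x \<in> L n" if "x \<in> carrier K" for x by (rule L_exhaust[OF that])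
    show "\<exists>n. x \<notin> L n" if "x \<in> carrier K" "x \<noteq> \<zero>" for x by (rule L_separated[OF that])
    show "a \<in> carrier K" "a \<noteq> \<zero>" by (rule a_closed a_nonzero)+
    show "(a \<otimes> x \<in> L n) = (x \<in> L (n + 1))" if "x \<in> carrier K" for x n
      using L_scale[OF that, of "-1" "n + 1"] sh_step[of "-1"] sh_0 a_closed by simp
    show "\<exists>F. finite F \<and> F \<subseteq> carrier K \<and> (\<forall>x\<in>L n. \<exists>y\<in>F. x \<ominus> y \<in> L m)" for n m
    proof -
      define W where "W = (\<lambda>x. sh m \<otimes> x) ` U"
      have oW: "openin T W" unfolding W_def by (rule openin_lmult_image[OF sh_closed sh_nonzero oU])
      have WL: "W \<subseteq> L m" unfolding W_def L_def using UV by blast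
      have WC: "W \<subseteq> carrier K" using openin_subset[OF oW] topspace_eq by simp
      have "\<zero> = sh m \<otimes> \<zero>" using sh_closed by simp
      then have zW: "\<zero> \<in> W" unfolding W_def using zU by blast
      define f where "f = (\<lambda>y. (\<lambda>x. y \<oplus> x) ` W)"
      have "L n \<subseteq> \<Union> (f ` L n)"
      proof
        fix x assume x: "x \<in> L n"
        then have "x = x \<oplus> \<zero>" using L_carrier by (metis r_zero subsetD)
        then show "x \<in> \<Union> (f ` L n)" using x zW unfolding f_def by blast
      qed
      moreover have "openin T S" if "S \<in> f ` L n" for S
        using that openin_ladd_image[OF _ oW] L_carrier unfolding f_def by blast
      ultimately obtain \<F> where F: "finite \<F>" "\<F> \<subseteq> f ` L n" "L n \<subseteq> \<Union> \<F>"
        using compactinD[OF compactin_L[of n], of "f ` L n"] by blast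
      obtain S where S: "finite S" "S \<subseteq> L n" "\<F> = f ` S" using finite_subset_image[OF F(1,2)] by blast
      have "\<exists>y\<in>S. x \<ominus> y \<in> L m" if x: "x \<in> L n" for x
      proof -
        obtain y w where yw: "y \<in> S" "w \<in> W" "x = y \<oplus> w" using F(3) S(3) x unfolding f_def by blast
        have "y \<in> carrier K" "w \<in> carrier K" using yw S(2) L_carrier WC by blast+
        then have "x \<ominus> y = w" using yw(3) by (simp add: a_minus_def a_ac r_neg r_neg1 r_neg2)
        then show ?thesis using yw WL by blast
      qed
      then show ?thesis using S L_carrier by blast
    qed
  qed
  then show ?thesis by blast
qed

end

theorem (in local_field) filtration_exists:
  obtains L c \<pi> where "filtered_field K L c \<pi>" "\<And>n. compactin T (L n)"
    "\<And>C. compactin T C \<Longrightarrow> \<exists>n. C \<subseteq> L n"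
proof -
  obtain V U a where "compactin T V" "openin T U" "U \<subseteq> V" "\<zero> \<in> U" "\<one> \<in> V"
    "a \<in> carrier K" "a \<noteq> \<zero>" "\<And>x. x \<in> V \<Longrightarrow> a \<otimes> x \<in> V" "\<And>x. x \<in> V \<Longrightarrow> a \<otimes> x \<noteq> \<one>"
    using contracting_element by blast
  then interpret contracted_field K T V U a by unfold_locales
  show ?thesis using filtration that compactin_L compact_absorbed by blast
qed

section \<open>Matrices over a ring\<close>

lemma (in abelian_monoid) finsum_swap:
  assumes "finite A" "finite B" "\<And>i j. i \<in> A \<Longrightarrow> j \<in> B \<Longrightarrow> f i j \<in> carrier G"
  shows "(\<Oplus>i\<in>A. \<Oplus>j\<in>B. f i j) = (\<Oplus>j\<in>B. \<Oplus>i\<in>A. f i j)"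
  using assms(1,3)
proof (induction A rule: finite_induct)
  case empty then show ?case by (simp add: finsum_zero)
next
  case (insert a A)
  have 1: "f a \<in> B \<rightarrow> carrier G" using insert by auto
  have 2: "(\<lambda>j. \<Oplus>i\<in>A. f i j) \<in> B \<rightarrow> carrier G" using insert by (auto intro!: finsum_closed)
  have "(\<Oplus>i\<in>insert a A. \<Oplus>j\<in>B. f i j) = (\<Oplus>j\<in>B. f a j) \<oplus> (\<Oplus>i\<in>A. \<Oplus>j\<in>B. f i j)"
    using insert by (subst finsum_insert) (auto intro!: finsum_closed)
  also have "\<dots> = (\<Oplus>j\<in>B. f a j) \<oplus> (\<Oplus>j\<in>B. \<Oplus>i\<in>A. f i j)" using insert by simp
  also have "\<dots> = (\<Oplus>j\<in>B. f a j \<oplus> (\<Oplus>i\<in>A. f i j))" using finsum_addf[OF 1 2] by simp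
  also have "\<dots> = (\<Oplus>j\<in>B. \<Oplus>i\<in>insert a A. f i j)"
  proof (rule finsum_cong'[OF refl])
    show "(\<lambda>j. \<Oplus>i\<in>insert a A. f i j) \<in> B \<rightarrow> carrier G" using insert by (auto intro!: finsum_closed)
    fix j assume "j \<in> B"
    then show "f a j \<oplus> (\<Oplus>i\<in>A. f i j) = (\<Oplus>i\<in>insert a A. f i j)"
      using insert by (subst finsum_insert) auto
  qed
  finally show ?case .
qed

lemma (in abelian_monoid) finsum_single:
  assumes "finite A" "k \<in> A" "f k \<in> carrier G" "\<And>l. l \<in> A \<Longrightarrow> l \<noteq> k \<Longrightarrow> f l = \<zero>"
  shows "(\<Oplus>l\<in>A. f l) = f k"
proof -
  have "(\<Oplus>l\<in>A. f l) = (\<Oplus>l\<in>A. if k = l then f l else \<zero>)"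
    using assms by (intro finsum_cong') auto
  also have "\<dots> = f k" using assms by (intro finsum_singleton) (auto, metis zero_closed)
  finally show ?thesis .
qed

context ring
begin

lemma mat_carrier: "carrier (mat_monoid d R) = ({..<d} \<times> {..<d} \<rightarrow>\<^sub>E carrier R)"
  by (simp add: mat_monoid_def)

lemma mat_entry: "A \<in> carrier (mat_monoid d R) \<Longrightarrow> i < d \<Longrightarrow> j < d \<Longrightarrow> A (i, j) \<in> carrier R"
  by (auto simp: mat_carrier)

lemma mat_eqI:
  assumes "A \<in> carrier (mat_monoid d R)" "B \<in> carrier (mat_monoid d R)"
    "\<And>i j. i < d \<Longrightarrow> j < d \<Longrightarrow> A (i, j) = B (i, j)"
  shows "A = B"
  using assms(1,2) unfolding mat_carrier by (rule PiE_ext) (use assms(3) in auto)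

lemma mat_mult_entry:
  "i < d \<Longrightarrow> j < d \<Longrightarrow> (A \<otimes>\<^bsub>mat_monoid d R\<^esub> B) (i, j) = (\<Oplus>l\<in>{..<d}. A (i, l) \<otimes> B (l, j))"
  by (simp add: mat_monoid_def)

lemma mat_one_entry:
  "i < d \<Longrightarrow> j < d \<Longrightarrow> \<one>\<^bsub>mat_monoid d R\<^esub> (i, j) = (if i = j then \<one> else \<zero>)"
  by (simp add: mat_monoid_def)

lemma mat_one_closed: "\<one>\<^bsub>mat_monoid d R\<^esub> \<in> carrier (mat_monoid d R)"
  by (auto simp: mat_monoid_def)

lemma mat_mult_closed:
  assumes "A \<in> carrier (mat_monoid d R)" "B \<in> carrier (mat_monoid d R)"
  shows "A \<otimes>\<^bsub>mat_monoid d R\<^esub> B \<in> carrier (mat_monoid d R)"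
proof -
  have "(\<Oplus>l\<in>{..<d}. A (i, l) \<otimes> B (l, j)) \<in> carrier R" if "i < d" "j < d" for i j
    using that mat_entry[OF assms(1)] mat_entry[OF assms(2)] by (intro finsum_closed) auto
  then show ?thesis by (auto simp: mat_monoid_def)
qed

lemma mat_monoid_monoid: "monoid (mat_monoid d R)"
proof
  let ?M = "mat_monoid d R"
  show "x \<otimes>\<^bsub>?M\<^esub> y \<in> carrier ?M" if "x \<in> carrier ?M" "y \<in> carrier ?M" for x y
    by (rule mat_mult_closed[OF that])
  show "\<one>\<^bsub>?M\<^esub> \<in> carrier ?M" by (rule mat_one_closed)
  show "\<one>\<^bsub>?M\<^esub> \<otimes>\<^bsub>?M\<^esub> x = x" if x: "x \<in> carrier ?M" for x
  proof (rule mat_eqI[OF mat_mult_closed[OF mat_one_closed x] x])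
    fix i j assume ij: "i < d" "j < d"
    have "(\<one>\<^bsub>?M\<^esub> \<otimes>\<^bsub>?M\<^esub> x) (i, j) = \<one>\<^bsub>?M\<^esub> (i, i) \<otimes> x (i, j)"
      unfolding mat_mult_entry[OF ij]
      by (rule finsum_single) (use ij mat_entry[OF x] in \<open>auto simp: mat_one_entry\<close>)
    then show "(\<one>\<^bsub>?M\<^esub> \<otimes>\<^bsub>?M\<^esub> x) (i, j) = x (i, j)"
      using ij mat_entry[OF x] by (simp add: mat_one_entry)
  qed
  show "x \<otimes>\<^bsub>?M\<^esub> \<one>\<^bsub>?M\<^esub> = x" if x: "x \<in> carrier ?M" for x
  proof (rule mat_eqI[OF mat_mult_closed[OF x mat_one_closed] x])
    fix i j assume ij: "i < d" "j < d"
    have "(x \<otimes>\<^bsub>?M\<^esub> \<one>\<^bsub>?M\<^esub>) (i, j) = x (i, j) \<otimes> \<one>\<^bsub>?M\<^esub> (j, j)"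
      unfolding mat_mult_entry[OF ij]
      by (rule finsum_single) (use ij mat_entry[OF x] in \<open>auto simp: mat_one_entry\<close>)
    then show "(x \<otimes>\<^bsub>?M\<^esub> \<one>\<^bsub>?M\<^esub>) (i, j) = x (i, j)"
      using ij mat_entry[OF x] by (simp add: mat_one_entry)
  qed
  show "x \<otimes>\<^bsub>?M\<^esub> y \<otimes>\<^bsub>?M\<^esub> z = x \<otimes>\<^bsub>?M\<^esub> (y \<otimes>\<^bsub>?M\<^esub> z)"
    if xyz: "x \<in> carrier ?M" "y \<in> carrier ?M" "z \<in> carrier ?M" for x y z
  proof (rule mat_eqI)
    fix i j assume ij: "i < d" "j < d"
    note e = mat_entry[OF xyz(1)] mat_entry[OF xyz(2)] mat_entry[OF xyz(3)]
    have "(x \<otimes>\<^bsub>?M\<^esub> y \<otimes>\<^bsub>?M\<^esub> z) (i, j) = (\<Oplus>l\<in>{..<d}. (\<Oplus>k\<in>{..<d}. x (i, k) \<otimes> y (k, l)) \<otimes> z (l, j))"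
      unfolding mat_mult_entry[OF ij]
      by (rule finsum_cong') (use ij e in \<open>auto simp: mat_mult_entry intro!: finsum_closed\<close>)
    also have "\<dots> = (\<Oplus>l\<in>{..<d}. \<Oplus>k\<in>{..<d}. x (i, k) \<otimes> y (k, l) \<otimes> z (l, j))"
      by (rule finsum_cong') (use ij e in \<open>auto intro!: finsum_ldistr finsum_closed\<close>)
    also have "\<dots> = (\<Oplus>k\<in>{..<d}. \<Oplus>l\<in>{..<d}. x (i, k) \<otimes> y (k, l) \<otimes> z (l, j))"
      by (rule finsum_swap) (use ij e in auto)
    also have "\<dots> = (\<Oplus>k\<in>{..<d}. \<Oplus>l\<in>{..<d}. x (i, k) \<otimes> (y (k, l) \<otimes> z (l, j)))"
      by (intro finsum_cong') (use ij e in \<open>auto simp: m_assoc intro!: finsum_closed\<close>)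
    also have "\<dots> = (\<Oplus>k\<in>{..<d}. x (i, k) \<otimes> (\<Oplus>l\<in>{..<d}. y (k, l) \<otimes> z (l, j)))"
      by (rule finsum_cong') (use ij e in \<open>auto intro!: finsum_rdistr[symmetric] finsum_closed\<close>)
    also have "\<dots> = (x \<otimes>\<^bsub>?M\<^esub> (y \<otimes>\<^bsub>?M\<^esub> z)) (i, j)"
      unfolding mat_mult_entry[OF ij]
      by (rule finsum_cong') (use ij e in \<open>auto simp: mat_mult_entry intro!: finsum_closed\<close>)
    finally show "(x \<otimes>\<^bsub>?M\<^esub> y \<otimes>\<^bsub>?M\<^esub> z) (i, j) = (x \<otimes>\<^bsub>?M\<^esub> (y \<otimes>\<^bsub>?M\<^esub> z)) (i, j)" .
  qed (intro mat_mult_closed xyz)+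
qed

lemma GL_group: "group (GL d R)"
  unfolding GL_def by (rule monoid.units_group[OF mat_monoid_monoid])

lemma GL_mult: "x \<otimes>\<^bsub>GL d R\<^esub> y = x \<otimes>\<^bsub>mat_monoid d R\<^esub> y"
  by (simp add: GL_def units_of_mult)

lemma GL_one: "\<one>\<^bsub>GL d R\<^esub> = \<one>\<^bsub>mat_monoid d R\<^esub>"
  by (simp add: GL_def units_of_one)

lemma GL_carrier_mat: "x \<in> carrier (GL d R) \<Longrightarrow> x \<in> carrier (mat_monoid d R)"
  by (simp add: GL_def units_of_carrier Units_def)

lemma GL_I:
  assumes "x \<in> carrier (mat_monoid d R)" "y \<in> carrier (mat_monoid d R)"
    "x \<otimes>\<^bsub>mat_monoid d R\<^esub> y = \<one>\<^bsub>mat_monoid d R\<^esub>" "y \<otimes>\<^bsub>mat_monoid d R\<^esub> x = \<one>\<^bsub>mat_monoid d R\<^esub>"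
  shows "x \<in> carrier (GL d R)" "inv\<^bsub>GL d R\<^esub> x = y"
proof -
  show x: "x \<in> carrier (GL d R)" using assms by (auto simp: GL_def units_of_carrier Units_def)
  have y: "y \<in> carrier (GL d R)" using assms by (auto simp: GL_def units_of_carrier Units_def)
  show "inv\<^bsub>GL d R\<^esub> x = y"
    using group.inv_equality[OF GL_group[of d], of y x] x y assms by (simp add: GL_mult GL_one)
qed

end

section \<open>Triangular decomposition with bounded remainder\<close>

locale filtered_GL = filtered_field +
  fixes d :: nat
begin

sublocale GL: group "GL d K" by (rule GL_group)

abbreviation gmult (infixl \<open>\<cdot>\<close> 70) where "x \<cdot> y \<equiv> x \<otimes>\<^bsub>GL d K\<^esub> y"
abbreviation ginv where "ginv x \<equiv> inv\<^bsub>GL d K\<^esub> x"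
abbreviation Mat where "Mat \<equiv> carrier (mat_monoid d K)"
abbreviation \<Gamma> where "\<Gamma> \<equiv> carrier (GL d K)"

lemma gmult_entry: "i < d \<Longrightarrow> j < d \<Longrightarrow> (A \<cdot> B) (i, j) = (\<Oplus>l\<in>{..<d}. A (i, l) \<otimes> B (l, j))"
  by (simp add: GL_mult mat_mult_entry)

lemma gone_entry: "i < d \<Longrightarrow> j < d \<Longrightarrow> \<one>\<^bsub>GL d K\<^esub> (i, j) = (if i = j then \<one> else \<zero>)"
  by (simp add: GL_one mat_one_entry)

lemma gmult_Mat: "A \<in> Mat \<Longrightarrow> B \<in> Mat \<Longrightarrow> A \<cdot> B \<in> Mat"
  by (simp add: GL_mult mat_mult_closed)

lemma gmult_assoc: "A \<in> Mat \<Longrightarrow> B \<in> Mat \<Longrightarrow> C \<in> Mat \<Longrightarrow> A \<cdot> B \<cdot> C = A \<cdot> (B \<cdot> C)"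
  by (simp add: GL_mult monoid.m_assoc[OF mat_monoid_monoid])

lemma gone_mult: "A \<in> Mat \<Longrightarrow> \<one>\<^bsub>GL d K\<^esub> \<cdot> A = A" "A \<in> Mat \<Longrightarrow> A \<cdot> \<one>\<^bsub>GL d K\<^esub> = A"
  by (simp_all add: GL_mult GL_one monoid.l_one[OF mat_monoid_monoid] monoid.r_one[OF mat_monoid_monoid])

lemma GL_entry: "x \<in> \<Gamma> \<Longrightarrow> i < d \<Longrightarrow> j < d \<Longrightarrow> x (i, j) \<in> carrier K"
  using GL_carrier_mat mat_entry by blast

lemma L_closed: "x \<in> L n \<Longrightarrow> x \<in> carrier K"
  using L_carrier by blast

lemma L_up: "x \<in> L m \<Longrightarrow> m \<le> n \<Longrightarrow> x \<in> L n"
  using L_mono by blast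

lemma finsum_L:
  assumes "finite A" "\<And>i. i \<in> A \<Longrightarrow> f i \<in> L n"
  shows "(\<Oplus>i\<in>A. f i) \<in> L (n + c * int (card A))"
  using assms
proof (induction A rule: finite_induct)
  case empty then show ?case using L_zero by simp
next
  case (insert a A)
  have f: "f \<in> A \<rightarrow> carrier K" "f a \<in> carrier K" using insert L_closed by auto
  have "f a \<in> L (n + c * int (card A))" by (rule L_up[of _ n]) (use insert c_nonneg in auto)
  then have "f a \<oplus> (\<Oplus>i\<in>A. f i) \<in> L (n + c * int (card A) + c)" using insert by (intro L_add) auto
  then show ?case using insert f by (simp add: finsum_insert algebra_simps)
qed

text \<open>The loss in a product of matrices: a product of entries costs \<open>c\<close>, each of the \<open>d\<close> additions another \<open>c\<close>.\<close>

definition cc :: int where "cc = c + c * int d"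

lemma cc: "0 \<le> cc" "c \<le> cc"
  using c_nonneg by (auto simp: cc_def)

definition matL :: "int \<Rightarrow> (nat \<times> nat \<Rightarrow> 'a) set" where
  "matL n = {A \<in> Mat. \<forall>i<d. \<forall>j<d. A (i, j) \<in> L n}"

text \<open>Plays the part of a ball about the identity. Bounding the inverse as well makes the
  family symmetric and keeps its members away from singular matrices.\<close>

definition Bd :: "int \<Rightarrow> (nat \<times> nat \<Rightarrow> 'a) set" where
  "Bd n = {g \<in> \<Gamma>. g \<in> matL n \<and> ginv g \<in> matL n}"

lemma matL_mult:
  assumes "A \<in> matL m" "B \<in> matL n"
  shows "A \<cdot> B \<in> matL (m + n + cc)"
proof -
  have "(A \<cdot> B) (i, j) \<in> L (m + n + cc)" if ij: "i < d" "j < d" for i j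
  proof -
    have "(\<Oplus>l\<in>{..<d}. A (i, l) \<otimes> B (l, j)) \<in> L (m + n + c + c * int (card {..<d}))"
      by (rule finsum_L) (use assms ij in \<open>auto simp: matL_def intro!: L_mult\<close>)
    then show ?thesis by (simp add: gmult_entry ij cc_def add.assoc)
  qed
  then show ?thesis using assms gmult_Mat by (auto simp: matL_def)
qed

lemma Bd_mult: "x \<in> Bd m \<Longrightarrow> y \<in> Bd n \<Longrightarrow> x \<cdot> y \<in> Bd (m + n + cc)"
  using matL_mult[of x m y n] matL_mult[of "ginv y" n "ginv x" m]
  by (simp add: Bd_def GL.inv_mult_group add.commute)

lemma Bd_inv: "x \<in> Bd m \<Longrightarrow> ginv x \<in> Bd m"
  by (simp add: Bd_def)

lemma Bd_\<Gamma>: "x \<in> Bd m \<Longrightarrow> x \<in> \<Gamma>"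
  by (simp add: Bd_def)

lemma matL_mono: "m \<le> n \<Longrightarrow> matL m \<subseteq> matL n"
  using L_mono by (auto simp: matL_def subset_iff)

lemma Bd_mono: "m \<le> n \<Longrightarrow> Bd m \<subseteq> Bd n"
  using matL_mono by (auto simp: Bd_def)

lemma one_matL: "\<one>\<^bsub>GL d K\<^esub> \<in> matL 0"
  using mat_one_closed L_one L_zero by (auto simp: matL_def gone_entry) (simp add: GL_one)

lemma Bd_one: "0 \<le> m \<Longrightarrow> \<one>\<^bsub>GL d K\<^esub> \<in> Bd m"
  using one_matL Bd_mono[of 0 m] by (auto simp: Bd_def)

lemma ginv_entry: "x \<in> Bd m \<Longrightarrow> i < d \<Longrightarrow> j < d \<Longrightarrow> ginv x (i, j) \<in> L m"
  by (simp add: Bd_def matL_def)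

lemma Bd_entry: "x \<in> Bd m \<Longrightarrow> i < d \<Longrightarrow> j < d \<Longrightarrow> x (i, j) \<in> L m"
  by (simp add: Bd_def matL_def)

section \<open>Operations on two columns and triangularization\<close>

definition blk :: "nat \<Rightarrow> nat \<Rightarrow> 'a \<Rightarrow> 'a \<Rightarrow> 'a \<Rightarrow> 'a \<Rightarrow> nat \<times> nat \<Rightarrow> 'a" where
  "blk s t p q r w = restrict (\<lambda>(i, j).
     if (i, j) = (s, s) then p else if (i, j) = (s, t) then q else
     if (i, j) = (t, s) then r else if (i, j) = (t, t) then w else
     if i = j then \<one> else \<zero>) ({..<d} \<times> {..<d})"

lemma blk_Mat:
  assumes "p \<in> carrier K" "q \<in> carrier K" "r \<in> carrier K" "w \<in> carrier K"
  shows "blk s t p q r w \<in> Mat"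
  using assms unfolding mat_carrier blk_def by auto

lemma finsum_two:
  assumes "finite A" "s \<in> A" "t \<in> A" "s \<noteq> t" "f s \<in> carrier K" "f t \<in> carrier K"
    "\<And>l. l \<in> A \<Longrightarrow> l \<noteq> s \<Longrightarrow> l \<noteq> t \<Longrightarrow> f l = \<zero>"
  shows "(\<Oplus>l\<in>A. f l) = f s \<oplus> f t"
proof -
  have f: "f \<in> A - {s} \<rightarrow> carrier K" "f s \<in> carrier K" using assms by (auto, metis zero_closed)
  have "(\<Oplus>l\<in>A. f l) = (\<Oplus>l\<in>insert s (A - {s}). f l)" using assms(2) by (simp add: insert_absorb)
  also have "\<dots> = f s \<oplus> (\<Oplus>l\<in>A - {s}. f l)" using assms(1) f by (subst finsum_insert) auto
  also have "(\<Oplus>l\<in>A - {s}. f l) = f t" using assms by (intro finsum_single) auto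
  finally show ?thesis .
qed

lemma mult_blk:
  assumes pq: "p \<in> carrier K" "q \<in> carrier K" "r \<in> carrier K" "w \<in> carrier K"
    and st: "s < d" "t < d" "s \<noteq> t" and x: "x \<in> Mat" and ij: "i < d" "j < d"
  shows "(x \<cdot> blk s t p q r w) (i, j) =
    (if j = s then x (i, s) \<otimes> p \<oplus> x (i, t) \<otimes> r
     else if j = t then x (i, s) \<otimes> q \<oplus> x (i, t) \<otimes> w else x (i, j))"
proof -
  note xe = mat_entry[OF x]
  show ?thesis
  proof (cases "j = s \<or> j = t")
    case True
    have "(x \<cdot> blk s t p q r w) (i, j) =
        x (i, s) \<otimes> blk s t p q r w (s, j) \<oplus> x (i, t) \<otimes> blk s t p q r w (t, j)"
      unfolding gmult_entry[OF ij]
      by (rule finsum_two) (use True st pq ij xe in \<open>auto simp: blk_def\<close>)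
    then show ?thesis using True st ij by (auto simp: blk_def)
  next
    case False
    have "(x \<cdot> blk s t p q r w) (i, j) = x (i, j) \<otimes> blk s t p q r w (j, j)"
      unfolding gmult_entry[OF ij]
      by (rule finsum_single) (use False st pq ij xe in \<open>auto simp: blk_def\<close>)
    then show ?thesis using False st ij xe by (auto simp: blk_def)
  qed
qed

text \<open>Hypothesis \<open>e\<close> says that the two blocks are inverse to each other, phrased
  as an action on row vectors (y, z) because this is what \<open>mult_blk\<close> yields for a row
  of the identity matrix.\<close>

lemma blk_Bd:
  assumes pq: "p \<in> L n" "q \<in> L n" "r \<in> L n" "w \<in> L n"
    and pq': "p' \<in> L n" "q' \<in> L n" "r' \<in> L n" "w' \<in> L n"
    and n: "0 \<le> n" and st: "s < d" "t < d" "s \<noteq> t"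
    and e: "\<And>y z. y \<in> carrier K \<Longrightarrow> z \<in> carrier K \<Longrightarrow>
       (y \<otimes> p \<oplus> z \<otimes> r) \<otimes> p' \<oplus> (y \<otimes> q \<oplus> z \<otimes> w) \<otimes> r' = y \<and>
       (y \<otimes> p \<oplus> z \<otimes> r) \<otimes> q' \<oplus> (y \<otimes> q \<oplus> z \<otimes> w) \<otimes> w' = z \<and>
       (y \<otimes> p' \<oplus> z \<otimes> r') \<otimes> p \<oplus> (y \<otimes> q' \<oplus> z \<otimes> w') \<otimes> r = y \<and>
       (y \<otimes> p' \<oplus> z \<otimes> r') \<otimes> q \<oplus> (y \<otimes> q' \<oplus> z \<otimes> w') \<otimes> w = z"
  shows "blk s t p q r w \<in> Bd n"
proof -
  let ?A = "blk s t p q r w" and ?B = "blk s t p' q' r' w'" and ?o = "\<one>\<^bsub>GL d K\<^esub>"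
  note cl = pq[THEN L_closed] and cl' = pq'[THEN L_closed]
  have A: "?A \<in> Mat" using cl by (intro blk_Mat)
  have B: "?B \<in> Mat" using cl' by (intro blk_Mat)
  have o: "?o \<in> Mat" by (simp add: GL_one mat_one_closed)
  have AB: "?o \<cdot> ?A \<cdot> ?B = ?o"
  proof (rule mat_eqI[of _ d])
    show "?o \<cdot> ?A \<cdot> ?B \<in> Mat" by (intro gmult_Mat o A B)
    fix i j assume ij: "i < d" "j < d"
    show "(?o \<cdot> ?A \<cdot> ?B) (i, j) = ?o (i, j)"
      using e[OF mat_entry[OF o ij(1) st(1)] mat_entry[OF o ij(1) st(2)]]
      by (simp add: mult_blk[OF cl' st gmult_Mat[OF o A]] mult_blk[OF cl st o] ij st st(3)[symmetric])
  qed (rule o)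
  have BA: "?o \<cdot> ?B \<cdot> ?A = ?o"
  proof (rule mat_eqI[of _ d])
    show "?o \<cdot> ?B \<cdot> ?A \<in> Mat" by (intro gmult_Mat o A B)
    fix i j assume ij: "i < d" "j < d"
    show "(?o \<cdot> ?B \<cdot> ?A) (i, j) = ?o (i, j)"
      using e[OF mat_entry[OF o ij(1) st(1)] mat_entry[OF o ij(1) st(2)]]
      by (simp add: mult_blk[OF cl st gmult_Mat[OF o B]] mult_blk[OF cl' st o] ij st st(3)[symmetric])
  qed (rule o)
  have 1: "?A \<otimes>\<^bsub>mat_monoid d K\<^esub> ?B = \<one>\<^bsub>mat_monoid d K\<^esub>" "?B \<otimes>\<^bsub>mat_monoid d K\<^esub> ?A = \<one>\<^bsub>mat_monoid d K\<^esub>"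
    using AB BA by (simp_all add: gone_mult A B) (simp_all add: GL_mult GL_one)
  note G = GL_I[OF A B 1]
  have m: "\<one> \<in> L n" "\<zero> \<in> L n" using L_one L_zero L_up n by auto
  have "?A \<in> matL n" "?B \<in> matL n" using A B pq pq' m by (auto simp: matL_def blk_def)
  then show ?thesis using G by (simp add: Bd_def)
qed

text \<open>The larger of the two entries serves as the pivot, so that the coefficient of the column
  operation is bounded.\<close>

lemma eliminate_entry:
  assumes x: "x \<in> Mat" and st: "s < d" "t < d" "s \<noteq> t"
  shows "\<exists>g\<in>Bd (3 * c). (x \<cdot> g) (t, s) = \<zero> \<and>
    (\<forall>i<d. \<forall>j<d. j \<noteq> s \<longrightarrow> j \<noteq> t \<longrightarrow> (x \<cdot> g) (i, j) = x (i, j)) \<and>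
    (\<forall>i<d. x (i, s) = \<zero> \<longrightarrow> x (i, t) = \<zero> \<longrightarrow> (x \<cdot> g) (i, s) = \<zero> \<and> (x \<cdot> g) (i, t) = \<zero>)"
proof -
  note xe = mat_entry[OF x]
  have c3: "0 \<le> 3 * c" using c_nonneg by simp
  have m: "\<one> \<in> L (3 * c)" "\<zero> \<in> L (3 * c)" using L_one L_zero L_up c3 by auto
  \<comment> \<open>\<open>lower\<close> adds a multiple of column t to column s.
    \<open>swap\<close> takes the entry at (t, s) as the pivot and exchanges the columns, so that
    the vanishing entry lands at (t, s). If the entry at (t, t) is 0, the plain exchange with l = 0
    is enough.\<close>
  consider (lower) l where "l \<in> L (2 * c)" "x (t, s) \<oplus> x (t, t) \<otimes> l = \<zero>"
    | (swap) l where "l \<in> L (2 * c)" "x (t, s) \<otimes> l \<oplus> x (t, t) = \<zero>"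
  proof (cases "x (t, t) = \<zero>")
    case True
    then have "x (t, s) \<otimes> \<zero> \<oplus> x (t, t) = \<zero>" using xe st by simp
    then show ?thesis using that(2)[of \<zero>] L_zero by simp
  next
    case False
    then have U: "x (t, t) \<in> Units K" using xe st field_Units by simp
    then have iv: "inv (x (t, t)) \<in> carrier K" "inv (x (t, t)) \<otimes> x (t, t) = \<one>" by auto
    define q where "q = x (t, s) \<otimes> inv (x (t, t))"
    have q: "q \<in> carrier K" "q \<otimes> x (t, t) = x (t, s)"
      unfolding q_def using xe[OF st(2,1)] xe[OF st(2,2)] iv by (simp_all add: m_assoc)
    show ?thesis
    \<comment> \<open>q is the ratio of the two entries; if it is not small, its inverse is, by
      \<open>L_inv\<close>.\<close>
    proof (cases "q \<in> L 0")
      case True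
      have "\<ominus> q \<in> L (0 + c)" by (rule L_minus[OF True])
      then have "\<ominus> q \<in> L (2 * c)" by (rule L_up) (use c_nonneg in simp)
      moreover have "x (t, s) \<oplus> x (t, t) \<otimes> (\<ominus> q) = \<zero>"
      proof -
        have "x (t, t) \<otimes> (\<ominus> q) = \<ominus> x (t, s)" using q xe[OF st(2,2)] by (metis r_minus m_comm)
        then show ?thesis using xe[OF st(2,1)] by (simp add: r_neg)
      qed
      ultimately show ?thesis by (rule that(1))
    next
      case F: False
      have "inv q \<in> L (- 0 + c)" by (rule L_inv[OF q(1) F])
      then have "\<ominus> (inv q) \<in> L (c + c)" using L_minus[of "inv q" c] by simp
      moreover have "q \<noteq> \<zero>" using F L_zero by auto
      then have "q \<in> Units K" using q field_Units by simp
      then have iq: "inv q \<in> carrier K" "q \<otimes> inv q = \<one>" by auto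
      have "x (t, s) \<otimes> inv q = x (t, t)"
      proof -
        have "x (t, s) \<otimes> inv q = x (t, t) \<otimes> (q \<otimes> inv q)"
          using q iq(1) xe[OF st(2,2)] m_assoc m_comm by metis
        then show ?thesis using iq xe[OF st(2,2)] by simp
      qed
      then have "x (t, s) \<otimes> (\<ominus> (inv q)) \<oplus> x (t, t) = \<zero>"
        using iq xe[OF st(2,1)] xe[OF st(2,2)] by (simp add: r_minus l_neg)
      ultimately show ?thesis using that(2)[of "\<ominus> (inv q)"] by simp
    qed
  qed
  then show ?thesis
  proof cases
    case lower
    have l: "l \<in> carrier K" "l \<in> L (3 * c)" using lower L_closed L_up c_nonneg by auto
    \<comment> \<open>The inverse block contains the negative of l, whose level is one
      \<open>c\<close> above that of l: hence 3 * c.\<close>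
    have ml: "\<ominus> l \<in> L (3 * c)" using L_minus[OF lower(1)] by simp
    let ?g = "blk s t \<one> \<zero> l \<one>"
    have B: "?g \<in> Bd (3 * c)"
      by (rule blk_Bd[of \<one> _ \<zero> l \<one> \<one> \<zero> "\<ominus> l" \<one>])
         (use m l ml c3 st in \<open>auto simp: a_assoc r_minus r_neg l_neg\<close>)
    have e: "(x \<cdot> ?g) (i, j) = (if j = s then x (i, s) \<oplus> x (i, t) \<otimes> l else x (i, j))"
      if "i < d" "j < d" for i j
      using mult_blk[of \<one> \<zero> l \<one>, OF _ _ _ _ st x that] that xe st l by simp
    show ?thesis by (rule bexI[OF _ B]) (use e st lower l in auto)
  next
    case swap
    have l: "l \<in> carrier K" "l \<in> L (3 * c)" using swap L_closed L_up c_nonneg by auto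
    have ml: "\<ominus> l \<in> L (3 * c)" using L_minus[OF swap(1)] by simp
    let ?g = "blk s t l \<one> \<one> \<zero>"
    have B: "?g \<in> Bd (3 * c)"
      by (rule blk_Bd[of l _ \<one> \<one> \<zero> \<zero> \<one> \<one> "\<ominus> l"])
         (use m l ml c3 st in \<open>auto simp: a_ac r_minus r_neg l_neg r_neg1 r_neg2\<close>)
    have e: "(x \<cdot> ?g) (i, j) = (if j = s then x (i, s) \<otimes> l \<oplus> x (i, t) else if j = t then x (i, s) else x (i, j))"
      if "i < d" "j < d" for i j
      using mult_blk[of l \<one> \<one> \<zero>, OF _ _ _ _ st x that] that xe st l by simp
    show ?thesis by (rule bexI[OF _ B]) (use e st swap l in auto)
  qed
qed

definition tri_from :: "nat \<Rightarrow> (nat \<times> nat \<Rightarrow> 'a) \<Rightarrow> bool" where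
  "tri_from t x \<longleftrightarrow> (\<forall>i<d. t \<le> i \<longrightarrow> (\<forall>j<i. x (i, j) = \<zero>))"

lemma Bd_Mat: "g \<in> Bd n \<Longrightarrow> g \<in> Mat"
  using Bd_\<Gamma> GL_carrier_mat by blast

text \<open>Column t is the pivot for all entries of row t to its left. The lower rows keep their
  zeros: in a row below t, both columns k and t lie left of the diagonal, so the operation only
  mixes zeros there. It matters that C is uniform in x.\<close>

lemma clear_row:
  assumes "k \<le> t" "t < d"
  shows "\<exists>C. \<forall>x\<in>Mat. tri_from (Suc t) x \<longrightarrow>
    (\<exists>g\<in>Bd C. tri_from (Suc t) (x \<cdot> g) \<and> (\<forall>j<k. (x \<cdot> g) (t, j) = \<zero>))"
  using assms(1)
proof (induction k)
  case 0
  show ?case by (rule exI[of _ 0]) (auto simp: gone_mult intro!: bexI[of _ "\<one>\<^bsub>GL d K\<^esub>"] Bd_one)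
next
  case (Suc k)
  then obtain C where C: "\<And>x. x \<in> Mat \<Longrightarrow> tri_from (Suc t) x \<Longrightarrow>
    \<exists>g\<in>Bd C. tri_from (Suc t) (x \<cdot> g) \<and> (\<forall>j<k. (x \<cdot> g) (t, j) = \<zero>)" by auto
  have kt: "k < d" "t < d" "k \<noteq> t" using Suc.prems assms by auto
  show ?case
  proof (rule exI[of _ "C + 3 * c + cc"], intro ballI impI)
    fix x assume x: "x \<in> Mat" "tri_from (Suc t) x"
    obtain g where g: "g \<in> Bd C" "tri_from (Suc t) (x \<cdot> g)" "\<forall>j<k. (x \<cdot> g) (t, j) = \<zero>" using C[OF x] by blast
    have xg: "x \<cdot> g \<in> Mat" by (intro gmult_Mat x Bd_Mat[OF g(1)])
    obtain h where h: "h \<in> Bd (3 * c)" "(x \<cdot> g \<cdot> h) (t, k) = \<zero>"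
      "\<And>i j. i < d \<Longrightarrow> j < d \<Longrightarrow> j \<noteq> k \<Longrightarrow> j \<noteq> t \<Longrightarrow> (x \<cdot> g \<cdot> h) (i, j) = (x \<cdot> g) (i, j)"
      "\<And>i. i < d \<Longrightarrow> (x \<cdot> g) (i, k) = \<zero> \<Longrightarrow> (x \<cdot> g) (i, t) = \<zero> \<Longrightarrow> (x \<cdot> g \<cdot> h) (i, k) = \<zero> \<and> (x \<cdot> g \<cdot> h) (i, t) = \<zero>"
      using eliminate_entry[OF xg kt] by blast
    have as: "x \<cdot> (g \<cdot> h) = x \<cdot> g \<cdot> h" using gmult_assoc x(1) Bd_Mat g(1) h(1) by simp
    show "\<exists>g\<in>Bd (C + 3 * c + cc). tri_from (Suc t) (x \<cdot> g) \<and> (\<forall>j<Suc k. (x \<cdot> g) (t, j) = \<zero>)"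
    proof (rule bexI[OF _ Bd_mult[OF g(1) h(1)]], unfold as, intro conjI)
      show "tri_from (Suc t) (x \<cdot> g \<cdot> h)" unfolding tri_from_def
      proof (intro allI impI)
        fix i j assume ij: "i < d" "Suc t \<le> i" "j < i"
        have z: "(x \<cdot> g) (i, l) = \<zero>" if "l < i" for l using g(2) ij that unfolding tri_from_def by blast
        show "(x \<cdot> g \<cdot> h) (i, j) = \<zero>"
          using h(3)[of i j] h(4)[of i] z[of j] z[of k] z[of t] ij Suc.prems by (cases "j = k \<or> j = t") auto
      qed
      show "\<forall>j<Suc k. (x \<cdot> g \<cdot> h) (t, j) = \<zero>"
        using h(2) h(3)[of t] g(3) Suc.prems assms(2) by (auto simp: less_Suc_eq)
    qed
  qed
qed

text \<open>The rows are cleared from the bottom upwards, so that \<open>clear_row\<close> always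
  finds the lower rows triangular.\<close>

lemma triangularize:
  assumes "t \<le> d"
  shows "\<exists>C. \<forall>x\<in>Mat. \<exists>g\<in>Bd C. tri_from t (x \<cdot> g)"
  using assms
proof (induction t rule: inc_induct)
  case base
  show ?case by (rule exI[of _ 0]) (auto simp: tri_from_def intro!: bexI[of _ "\<one>\<^bsub>GL d K\<^esub>"] Bd_one)
next
  case (step t)
  obtain C where C: "\<And>x. x \<in> Mat \<Longrightarrow> \<exists>g\<in>Bd C. tri_from (Suc t) (x \<cdot> g)" using step by blast
  obtain D where D: "\<And>x. x \<in> Mat \<Longrightarrow> tri_from (Suc t) x \<Longrightarrow>
    \<exists>g\<in>Bd D. tri_from (Suc t) (x \<cdot> g) \<and> (\<forall>j<t. (x \<cdot> g) (t, j) = \<zero>)"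
    using clear_row[of t t] step by blast
  show ?case
  proof (rule exI[of _ "C + D + cc"], intro ballI)
    fix x assume x: "x \<in> Mat"
    obtain g where g: "g \<in> Bd C" "tri_from (Suc t) (x \<cdot> g)" using C[OF x] by blast
    have xg: "x \<cdot> g \<in> Mat" by (intro gmult_Mat x Bd_Mat[OF g(1)])
    obtain h where h: "h \<in> Bd D" "tri_from (Suc t) (x \<cdot> g \<cdot> h)" "\<forall>j<t. (x \<cdot> g \<cdot> h) (t, j) = \<zero>"
      using D[OF xg g(2)] by blast
    have as: "x \<cdot> (g \<cdot> h) = x \<cdot> g \<cdot> h" using gmult_assoc x(1) Bd_Mat g(1) h(1) by simp
    show "\<exists>g\<in>Bd (C + D + cc). tri_from t (x \<cdot> g)"
    proof (rule bexI[OF _ Bd_mult[OF g(1) h(1)]], unfold as)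
      show "tri_from t (x \<cdot> g \<cdot> h)" using h(2,3) unfolding tri_from_def
        by (metis Suc_leI le_neq_implies_less)
    qed
  qed
qed

section \<open>Diagonal and unipotent matrices\<close>

definition dg :: "(nat \<Rightarrow> 'a) \<Rightarrow> nat \<times> nat \<Rightarrow> 'a" where
  "dg f = restrict (\<lambda>(i, j). if i = j then f i else \<zero>) ({..<d} \<times> {..<d})"

definition nz :: "(nat \<Rightarrow> 'a) \<Rightarrow> bool" where
  "nz f \<longleftrightarrow> (\<forall>j<d. f j \<in> carrier K \<and> f j \<noteq> \<zero>)"

lemma dg_Mat: "\<forall>j<d. f j \<in> carrier K \<Longrightarrow> dg f \<in> Mat"
  unfolding mat_carrier dg_def by auto

lemma dg_entry: "i < d \<Longrightarrow> j < d \<Longrightarrow> dg f (i, j) = (if i = j then f i else \<zero>)"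
  by (simp add: dg_def)

lemma dg_mult_left:
  assumes f: "\<forall>j<d. f j \<in> carrier K" and x: "x \<in> Mat" and ij: "i < d" "j < d"
  shows "(dg f \<cdot> x) (i, j) = f i \<otimes> x (i, j)"
proof -
  have "(dg f \<cdot> x) (i, j) = dg f (i, i) \<otimes> x (i, j)"
    unfolding gmult_entry[OF ij] by (rule finsum_single) (use f ij mat_entry[OF x] in \<open>auto simp: dg_entry\<close>)
  then show ?thesis using ij by (simp add: dg_entry)
qed

lemma dg_mult_right:
  assumes f: "\<forall>j<d. f j \<in> carrier K" and x: "x \<in> Mat" and ij: "i < d" "j < d"
  shows "(x \<cdot> dg f) (i, j) = x (i, j) \<otimes> f j"
proof -
  have "(x \<cdot> dg f) (i, j) = x (i, j) \<otimes> dg f (j, j)"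
    unfolding gmult_entry[OF ij] by (rule finsum_single) (use f ij mat_entry[OF x] in \<open>auto simp: dg_entry\<close>)
  then show ?thesis using ij by (simp add: dg_entry)
qed

lemma nz_inv: "nz f \<Longrightarrow> nz (\<lambda>j. inv (f j))"
  unfolding nz_def
proof (intro allI impI)
  fix j assume f: "\<forall>j<d. f j \<in> carrier K \<and> f j \<noteq> \<zero>" and j: "j < d"
  then have U: "f j \<in> Units K" using field_Units by simp
  then have "inv (f j) \<in> carrier K" "f j \<otimes> inv (f j) = \<one>" by auto
  then show "inv (f j) \<in> carrier K \<and> inv (f j) \<noteq> \<zero>" using f j by auto
qed

lemma nz_r_inv: "nz f \<Longrightarrow> j < d \<Longrightarrow> f j \<otimes> inv (f j) = \<one>" "nz f \<Longrightarrow> j < d \<Longrightarrow> inv (f j) \<otimes> f j = \<one>"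
  unfolding nz_def using field_Units by auto

lemma nz_closed: "nz f \<Longrightarrow> j < d \<Longrightarrow> f j \<in> carrier K" "nz f \<Longrightarrow> \<forall>j<d. f j \<in> carrier K"
  unfolding nz_def by auto

lemma dg_GL:
  assumes "nz f"
  shows "dg f \<in> \<Gamma>" "ginv (dg f) = dg (\<lambda>j. inv (f j))"
proof -
  let ?g = "\<lambda>j. inv (f j)"
  note f = nz_closed(2)[OF assms] and g = nz_closed(2)[OF nz_inv[OF assms]]
  have M: "dg f \<in> Mat" "dg ?g \<in> Mat" using dg_Mat f g by auto
  have 1: "dg f \<cdot> dg ?g = \<one>\<^bsub>GL d K\<^esub>"
    by (rule mat_eqI[of _ d]) (use M gmult_Mat nz_r_inv[OF assms] f g in
      \<open>auto simp: dg_mult_left dg_entry gone_entry\<close>, simp add: GL_one mat_one_closed)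
  have 2: "dg ?g \<cdot> dg f = \<one>\<^bsub>GL d K\<^esub>"
    by (rule mat_eqI[of _ d]) (use M gmult_Mat nz_r_inv[OF assms] f g in
      \<open>auto simp: dg_mult_left dg_entry gone_entry\<close>, simp add: GL_one mat_one_closed)
  show "dg f \<in> \<Gamma>" "ginv (dg f) = dg ?g"
    using GL_I[OF M] 1 2 by (simp_all add: GL_mult GL_one)
qed

text \<open>Induction on the column j. In entry (i, j) of the product of the inverse with b, the
  terms l < j vanish by induction and the terms l > j because b is triangular, so only
  \<open>ginv b (i, j) \<otimes> b (j, j)\<close> is left.\<close>

lemma inverse_triangular:
  assumes b: "b \<in> \<Gamma>" "tri_from 0 b" and j: "j < d"
  shows "ginv b (j, j) \<otimes> b (j, j) = \<one> \<and> (\<forall>i<d. j < i \<longrightarrow> ginv b (i, j) = \<zero>)"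
  using j
proof (induction j rule: less_induct)
  case (less j)
  have be: "b (i, k) \<in> carrier K" if "i < d" "k < d" for i k using GL_entry b that by blast
  have ce: "ginv b (i, k) \<in> carrier K" if "i < d" "k < d" for i k using GL_entry b that by simp
  have e: "ginv b (i, j) \<otimes> b (j, j) = (if i = j then \<one> else \<zero>)" if i: "i < d" "j \<le> i" for i
  proof -
    have "(ginv b \<cdot> b) (i, j) = ginv b (i, j) \<otimes> b (j, j)"
      unfolding gmult_entry[OF i(1) less.prems]
    proof (rule finsum_single)
      fix l assume l: "l \<in> {..<d}" "l \<noteq> j"
      show "ginv b (i, l) \<otimes> b (l, j) = \<zero>"
      proof (cases "l < j")
        case True
        then have "ginv b (i, l) = \<zero>" using less.IH[of l] l i by auto
        then show ?thesis using be l less.prems by simp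
      next
        case False
        then have "b (l, j) = \<zero>" using b(2) l unfolding tri_from_def by auto
        then show ?thesis using ce l i by simp
      qed
    qed (use less.prems i be ce in auto)
    then show ?thesis using b(1) i less.prems by (simp add: gone_entry)
  qed
  have d1: "ginv b (j, j) \<otimes> b (j, j) = \<one>" using e[of j] less.prems by simp
  then have nz: "b (j, j) \<noteq> \<zero>" using ce less.prems by auto
  have "ginv b (i, j) = \<zero>" if "i < d" "j < i" for i
    using e[of i] that nz integral ce be less.prems by (metis less_imp_le nat_neq_iff)
  then show ?case using d1 by blast
qed

definition unitri :: "(nat \<times> nat \<Rightarrow> 'a) \<Rightarrow> bool" where
  "unitri w \<longleftrightarrow> (\<forall>i<d. w (i, i) = \<one> \<and> (\<forall>j<i. w (i, j) = \<zero>))"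

text \<open>Including the condition on the inverse makes closure under inversion immediate; for the
  unipotent factor of a matrix it comes from \<open>inverse_triangular\<close>.\<close>

definition UU :: "(nat \<times> nat \<Rightarrow> 'a) set" where
  "UU = {w \<in> \<Gamma>. unitri w \<and> unitri (ginv w)}"

text \<open>The coarse Iwasawa decomposition, with \<open>Bd C\<close> in the role of the maximal compact subgroup.\<close>

lemma triangular_decomposition:
  "\<exists>C. \<forall>x\<in>\<Gamma>. \<exists>u f \<kappa>. u \<in> UU \<and> nz f \<and> \<kappa> \<in> Bd C \<and> x = u \<cdot> dg f \<cdot> \<kappa>"
proof -
  obtain C where C: "\<And>x. x \<in> Mat \<Longrightarrow> \<exists>g\<in>Bd C. tri_from 0 (x \<cdot> g)" using triangularize[of 0] by blast
  show ?thesis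
  proof (rule exI[of _ C], intro ballI)
    fix x assume x: "x \<in> \<Gamma>"
    obtain g where g: "g \<in> Bd C" "tri_from 0 (x \<cdot> g)" using C[OF GL_carrier_mat[OF x]] by blast
    define b where "b = x \<cdot> g"
    have b: "b \<in> \<Gamma>" "tri_from 0 b" unfolding b_def using x g Bd_\<Gamma> by auto
    define f where "f = (\<lambda>j. b (j, j))"
    note it = inverse_triangular[OF b]
    have ce: "ginv b (i, k) \<in> carrier K" if "i < d" "k < d" for i k using GL_entry b that by simp
    have be: "b (i, k) \<in> carrier K" if "i < d" "k < d" for i k using GL_entry b that by simp
    have f: "nz f" unfolding nz_def f_def
    proof (intro allI impI conjI)
      fix j assume j: "j < d"
      show "b (j, j) \<in> carrier K" using be j by simp
      show "b (j, j) \<noteq> \<zero>" using it[OF j] ce[OF j j] by auto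
    qed
    let ?g = "\<lambda>j. inv (f j)"
    note fc = nz_closed(2)[OF f] and gc = nz_closed(2)[OF nz_inv[OF f]]
    note dgG = dg_GL[OF f]
    have G': "dg ?g \<in> \<Gamma>" using dgG GL.inv_closed by metis
    define u where "u = b \<cdot> dg ?g"
    have uG: "u \<in> \<Gamma>" unfolding u_def using b G' by simp
    have gi: "ginv (dg ?g) = dg f" using dgG by (metis GL.inv_inv)
    have ui: "ginv u = dg f \<cdot> ginv b"
      unfolding u_def using b G' gi by (simp add: GL.inv_mult_group)
    have "unitri u" unfolding unitri_def u_def
      using nz_r_inv[OF f] b gc be GL_carrier_mat[OF b(1)]
      by (auto simp: dg_mult_right f_def[symmetric] tri_from_def) (simp add: f_def)
    moreover have "unitri (ginv u)" unfolding unitri_def ui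
    proof (intro allI impI conjI)
      fix i assume i: "i < d"
      have M: "ginv b \<in> Mat" using b GL_carrier_mat by simp
      show "(dg f \<cdot> ginv b) (i, i) = \<one>"
        using it[OF i] dg_mult_left[OF fc M i i] ce[OF i i] be[OF i i] by (simp add: f_def m_comm)
      fix j assume j: "j < i"
      then have jd: "j < d" using i by simp
      show "(dg f \<cdot> ginv b) (i, j) = \<zero>"
        using it[OF jd] dg_mult_left[OF fc M i jd] i j fc by simp
    qed
    ultimately have uU: "u \<in> UU" using uG by (simp add: UU_def)
    have "u \<cdot> dg f = b"
      unfolding u_def using b G' gi by (metis GL.inv_closed GL.l_inv GL.m_assoc GL.r_inv GL.r_one)
    then have "x = u \<cdot> dg f \<cdot> ginv g"
      unfolding b_def using x Bd_\<Gamma>[OF g(1)] by (simp add: GL.m_assoc)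
    then show "\<exists>u f \<kappa>. u \<in> UU \<and> nz f \<and> \<kappa> \<in> Bd C \<and> x = u \<cdot> dg f \<cdot> \<kappa>"
      using uU f Bd_inv[OF g(1)] by blast
  qed
qed

end

section \<open>Coarse covers of the general linear group\<close>

context filtered_field
begin

text \<open>For the exact level e, x is outside \<open>L (e - 1)\<close>, and \<open>L_inv\<close>
  at that place gives the level \<open>c + 1 - e\<close> of the inverse.\<close>

lemma level_exists:
  assumes x: "x \<in> carrier K" "x \<noteq> \<zero>"
  shows "\<exists>e. x \<in> L e \<and> inv x \<in> L (c + 1 - e)"
proof -
  obtain n1 n2 where "x \<notin> L n1" "x \<in> L n2" using L_separated L_exhaust assms by blast
  then have "\<exists>k. x \<in> L k \<and> x \<notin> L (k - 1)" using int_threshold[of "\<lambda>n. x \<in> L n" n2 n1] L_mono by blast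
  then obtain k where k: "x \<in> L k" "x \<notin> L (k - 1)" by blast
  have "inv x \<in> L (- (k - 1) + c)" by (rule L_inv[OF x(1) k(2)])
  then show ?thesis using k(1) by (intro exI[of _ k]) (simp add: algebra_simps)
qed

lemma \<pi>_Units: "\<pi> \<in> Units K"
  using field_Units \<pi>_carrier \<pi>_nonzero by blast

lemma \<pi>_inv: "inv \<pi> \<in> carrier K" "\<pi> \<otimes> inv \<pi> = \<one>" "inv \<pi> \<otimes> \<pi> = \<one>" "inv \<pi> \<noteq> \<zero>"
proof -
  show 1: "inv \<pi> \<in> carrier K" "\<pi> \<otimes> inv \<pi> = \<one>" "inv \<pi> \<otimes> \<pi> = \<one>" using \<pi>_Units by auto
  show "inv \<pi> \<noteq> \<zero>" using 1(2) \<pi>_carrier by (metis one_not_zero r_null)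
qed

lemma \<pi>_inv_shift:
  assumes "x \<in> carrier K"
  shows "inv \<pi> \<otimes> x \<in> L (n + 1) \<longleftrightarrow> x \<in> L n"
proof -
  have "\<pi> \<otimes> (inv \<pi> \<otimes> x) = x" using \<pi>_inv assms \<pi>_carrier by (metis l_one m_assoc)
  then show ?thesis using \<pi>_shift[of "inv \<pi> \<otimes> x" n] \<pi>_inv assms by simp
qed

lemma inv_mult_nonzero:
  assumes "x \<in> carrier K" "x \<noteq> \<zero>" "y \<in> carrier K" "y \<noteq> \<zero>"
  shows "inv (x \<otimes> y) = inv x \<otimes> inv y"
proof -
  have U: "x \<in> Units K" "y \<in> Units K" using assms field_Units by auto
  have "(x \<otimes> y) \<otimes> (inv x \<otimes> inv y) = (x \<otimes> inv x) \<otimes> (y \<otimes> inv y)"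
    using U assms by (simp add: m_ac del: Units_r_inv)
  then show ?thesis using U assms by (simp add: comm_inv_char)
qed

text \<open>Integer powers of \<pi>. Unlike \<open>L_mult\<close> and \<open>L_inv\<close>,
  \<open>\<pi>_shift\<close> is an equivalence without loss, so no error accumulates however large k
  is.\<close>

lemma element_of_level: "\<exists>g\<in>carrier K. g \<noteq> \<zero> \<and> g \<in> L k \<and> inv g \<in> L (- k)"
proof (induction k rule: int_induct[of _ 0])
  case base
  show ?case using L_one by (intro bexI[of _ \<one>]) auto
next
  case (step1 i)
  then obtain g where g: "g \<in> carrier K" "g \<noteq> \<zero>" "g \<in> L i" "inv g \<in> L (- i)" by blast
  have ig: "inv g \<in> carrier K" using g(4) L_carrier by blast
  have "inv (inv \<pi> \<otimes> g) = \<pi> \<otimes> inv g"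
    using inv_mult_nonzero[OF \<pi>_inv(1,4) g(1,2)] \<pi>_Units by simp
  moreover have "\<pi> \<otimes> inv g \<in> L (- (i + 1))" using \<pi>_shift[OF ig, of "- (i + 1)"] g(4) by simp
  ultimately show ?case using g \<pi>_inv \<pi>_inv_shift[OF g(1)] integral[of "inv \<pi>" g]
    by (intro bexI[of _ "inv \<pi> \<otimes> g"]) auto
next
  case (step2 i)
  then obtain g where g: "g \<in> carrier K" "g \<noteq> \<zero>" "g \<in> L i" "inv g \<in> L (- i)" by blast
  have ig: "inv g \<in> carrier K" using g(4) L_carrier by blast
  have "inv (\<pi> \<otimes> g) = inv \<pi> \<otimes> inv g"
    using inv_mult_nonzero[OF \<pi>_carrier \<pi>_nonzero g(1,2)] by simp
  moreover have "inv \<pi> \<otimes> inv g \<in> L (- (i - 1))" using \<pi>_inv_shift[OF ig, of "- i"] g(4) by simp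
  moreover have "\<pi> \<otimes> g \<in> L (i - 1)" using \<pi>_shift[OF g(1), of "i - 1"] g(3) by simp
  ultimately show ?case using g \<pi>_carrier \<pi>_nonzero integral[of \<pi> g]
    by (intro bexI[of _ "\<pi> \<otimes> g"]) auto
qed

text \<open>Serves to bound levels from below: a product that equals 1 cannot lie in a very small
  \<open>L n\<close>.\<close>

lemma one_not_small: "\<exists>k\<ge>0. \<forall>n. \<one> \<in> L n \<longrightarrow> - k \<le> n"
proof -
  obtain m where m: "\<one> \<notin> L m" using L_separated[of \<one>] by auto
  have "m \<le> n" if "\<one> \<in> L n" for n using that m L_mono[of n m] by (meson linorder_le_cases subsetD)
  then show ?thesis by (intro exI[of _ "max 0 (- m)"]) (fastforce simp: max_def)
qed

end

section \<open>Neighbourhoods of the identity in the unipotent group\<close>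

context filtered_GL
begin

lemma unitri_mult:
  assumes v: "v \<in> Mat" "unitri v" and w: "w \<in> Mat" "unitri w"
  shows "unitri (v \<cdot> w)"
proof -
  note ve = mat_entry[OF v(1)] and we = mat_entry[OF w(1)]
  have v0: "\<And>i j. i < d \<Longrightarrow> j < i \<Longrightarrow> v (i, j) = \<zero>" and v1: "\<And>i. i < d \<Longrightarrow> v (i, i) = \<one>"
    using v(2) by (auto simp: unitri_def)
  have w0: "\<And>i j. i < d \<Longrightarrow> j < i \<Longrightarrow> w (i, j) = \<zero>" and w1: "\<And>i. i < d \<Longrightarrow> w (i, i) = \<one>"
    using w(2) by (auto simp: unitri_def)
  have e: "(v \<cdot> w) (i, j) = v (i, j) \<otimes> w (j, j)" if ij: "i < d" "j \<le> i" for i j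
  proof -
    have jd: "j < d" using ij by simp
    show ?thesis unfolding gmult_entry[OF ij(1) jd]
    proof (rule finsum_single)
      fix l assume l: "l \<in> {..<d}" "l \<noteq> j"
      show "v (i, l) \<otimes> w (l, j) = \<zero>"
      proof (cases "l < j")
        case True then show ?thesis using v0[of i l] ij l we jd by simp
      next
        case False then show ?thesis using w0[of l j] ij l ve by simp
      qed
    qed (use ij jd ve we in auto)
  qed
  show ?thesis unfolding unitri_def using e v0 v1 w0 w1 by auto
qed

lemma unitri_one: "unitri \<one>\<^bsub>GL d K\<^esub>"
  by (auto simp: unitri_def gone_entry)

lemma UU_mult: "v \<in> UU \<Longrightarrow> w \<in> UU \<Longrightarrow> v \<cdot> w \<in> UU"
  unfolding UU_def using unitri_mult GL_carrier_mat by (auto simp: GL.inv_mult_group)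

lemma UU_inv: "v \<in> UU \<Longrightarrow> ginv v \<in> UU"
  by (simp add: UU_def)

lemma UU_\<Gamma>: "v \<in> UU \<Longrightarrow> v \<in> \<Gamma>"
  by (simp add: UU_def)

lemma UU_one: "\<one>\<^bsub>GL d K\<^esub> \<in> UU"
  by (simp add: UU_def unitri_one)

text \<open>Only entries above the diagonal are bounded, so that negative m is meaningful and
  describes elements close to the identity.\<close>

definition NW :: "int \<Rightarrow> (nat \<times> nat \<Rightarrow> 'a) set" where
  "NW m = {w \<in> UU. \<forall>j<d. \<forall>i<j. w (i, j) \<in> L m \<and> ginv w (i, j) \<in> L m}"

lemma NW_mono: "m \<le> n \<Longrightarrow> NW m \<subseteq> NW n"
  unfolding NW_def using L_up by blast

lemma NW_inv: "w \<in> NW m \<Longrightarrow> ginv w \<in> NW m"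
  by (auto simp: NW_def UU_inv UU_\<Gamma>)

lemma NW_one: "\<one>\<^bsub>GL d K\<^esub> \<in> NW m"
  by (auto simp: NW_def UU_one gone_entry L_zero)

lemma NW_UU: "w \<in> NW m \<Longrightarrow> w \<in> UU"
  by (simp add: NW_def)

text \<open>In the sum for entry (i, j), the terms l = i and l = j have a factor 1, and the terms in
  between have level at most 2 m + c, hence at most m + c because m \<le> 0. A product of small
  elements thus loses only \<open>cc\<close> instead of adding the levels; this is what makes long
  products controllable.\<close>

lemma upper_mult_small:
  assumes v: "v \<in> Mat" "unitri v" and w: "w \<in> Mat" "unitri w" and m: "m \<le> 0" and ij: "i < j" "j < d"
    and L: "\<And>i j. i < j \<Longrightarrow> j < d \<Longrightarrow> v (i, j) \<in> L m" "\<And>i j. i < j \<Longrightarrow> j < d \<Longrightarrow> w (i, j) \<in> L m"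
  shows "(v \<cdot> w) (i, j) \<in> L (m + cc)"
proof -
  have id: "i < d" using ij by simp
  note ve = mat_entry[OF v(1)] and we = mat_entry[OF w(1)]
  have "v (i, l) \<otimes> w (l, j) \<in> L (m + c)" if l: "l < d" for l
  proof -
    consider "l < i" | "l = i" | "i < l" "l < j" | "l = j" | "j < l" by linarith
    then show ?thesis
    proof cases
      case 1 then have "v (i, l) = \<zero>" using v(2) id by (simp add: unitri_def)
      then show ?thesis using we l ij L_zero by simp
    next
      case 2 then have "v (i, l) = \<one>" using v(2) id by (simp add: unitri_def)
      moreover have "w (i, j) \<in> L (m + c)" using L(2)[OF ij] by (rule L_up) (use c_nonneg in simp)
      ultimately show ?thesis using 2 we id ij by simp
    next
      case 3
      have "v (i, l) \<otimes> w (l, j) \<in> L (m + m + c)" using L(1)[of i l] L(2)[of l j] 3 ij by (intro L_mult) auto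
      then show ?thesis by (rule L_up) (use m in simp)
    next
      case 4 then have "w (l, j) = \<one>" using w(2) ij by (simp add: unitri_def)
      moreover have "v (i, j) \<in> L (m + c)" using L(1)[OF ij] by (rule L_up) (use c_nonneg in simp)
      ultimately show ?thesis using 4 ve id ij by simp
    next
      case 5 then have "w (l, j) = \<zero>" using w(2) l by (simp add: unitri_def)
      then show ?thesis using ve l id L_zero by simp
    qed
  qed
  then have "(\<Oplus>l\<in>{..<d}. v (i, l) \<otimes> w (l, j)) \<in> L (m + c + c * int (card {..<d}))"
    by (intro finsum_L) auto
  then show ?thesis by (simp add: gmult_entry id ij cc_def add.assoc)
qed

lemma NW_mult_small:
  assumes "v \<in> NW m" "w \<in> NW m" "m \<le> 0"
  shows "v \<cdot> w \<in> NW (m + cc)"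
proof -
  have G: "v \<in> \<Gamma>" "w \<in> \<Gamma>" using assms NW_UU UU_\<Gamma> by auto
  then have M: "v \<in> Mat" "w \<in> Mat" "ginv v \<in> Mat" "ginv w \<in> Mat" using GL_carrier_mat by auto
  have "(v \<cdot> w) (i, j) \<in> L (m + cc)" "ginv (v \<cdot> w) (i, j) \<in> L (m + cc)" if "j < d" "i < j" for i j
    using that assms M G
    by (auto simp: NW_def UU_def GL.inv_mult_group intro!: upper_mult_small)
  then show ?thesis using UU_mult[OF NW_UU[OF assms(1)] NW_UU[OF assms(2)]] by (simp add: NW_def)
qed

lemma unitri_matL:
  assumes "w \<in> Mat" "unitri w" "\<And>i j. i < j \<Longrightarrow> j < d \<Longrightarrow> w (i, j) \<in> L m" "0 \<le> m"
  shows "w \<in> matL m"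
proof -
  have "w (i, j) \<in> L m" if "i < d" "j < d" for i j
  proof -
    consider "i < j" | "i = j" | "j < i" by linarith
    then show ?thesis
      by cases (use assms that L_one L_zero L_up in \<open>auto simp: unitri_def\<close>)
  qed
  then show ?thesis using assms by (simp add: matL_def)
qed

lemma NW_Bd: "w \<in> NW m \<Longrightarrow> 0 \<le> m \<Longrightarrow> w \<in> Bd m"
proof -
  assume w: "w \<in> NW m" and m: "0 \<le> m"
  have G: "w \<in> \<Gamma>" "ginv w \<in> \<Gamma>" using UU_\<Gamma>[OF NW_UU[OF w]] by auto
  have t: "unitri w" "unitri (ginv w)" using NW_UU[OF w] by (auto simp: UU_def)
  have "w \<in> matL m" by (rule unitri_matL[OF GL_carrier_mat[OF G(1)] t(1) _ m]) (use w in \<open>simp add: NW_def\<close>)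
  moreover have "ginv w \<in> matL m"
    by (rule unitri_matL[OF GL_carrier_mat[OF G(2)] t(2) _ m]) (use w in \<open>simp add: NW_def\<close>)
  ultimately show "w \<in> Bd m" using G by (simp add: Bd_def)
qed

lemma NW_mult:
  assumes "v \<in> NW m" "w \<in> NW n" "0 \<le> m" "0 \<le> n"
  shows "v \<cdot> w \<in> NW (m + n + cc)"
proof -
  have "v \<cdot> w \<in> Bd (m + n + cc)" using Bd_mult[OF NW_Bd[OF assms(1,3)] NW_Bd[OF assms(2,4)]] .
  then show ?thesis using UU_mult[OF NW_UU[OF assms(1)] NW_UU[OF assms(2)]]
    by (auto simp: NW_def Bd_def matL_def)
qed

text \<open>Pigeonhole on the entries: two elements of \<open>NW cc\<close> whose entries lie in the same small cells have
  a quotient in \<open>NW 0\<close>. The bound is independent of the scale because \<open>V\<close> below rescales the unipotent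
  group by an automorphism.\<close>

lemma separated_bound:
  "\<exists>M0. \<forall>Z. \<forall>w. (\<forall>z\<in>Z. w z \<in> NW cc) \<longrightarrow> (\<forall>z\<in>Z. \<forall>z'\<in>Z. z \<noteq> z' \<longrightarrow> ginv (w z) \<cdot> w z' \<notin> NW 0) \<longrightarrow>
      finite (Z :: 'z set) \<and> card Z \<le> M0"
proof -
  \<comment> \<open>Two entries in one cell differ by level - D + 2 c; multiplying by an entry of
    level \<open>cc\<close> gives - cc + c, and summing d such terms adds c * d, which ends exactly
    at level 0.\<close>
  define D where "D = 2 * cc + 2 * c"
  from L_cover[of cc "- D"] obtain F
    where F: "finite F \<and> F \<subseteq> carrier K \<and> (\<forall>x\<in>L cc. \<exists>y\<in>F. x \<ominus> y \<in> L (- D))" ..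
  then have "\<forall>x. \<exists>y. x \<in> L cc \<longrightarrow> y \<in> F \<and> x \<ominus> y \<in> L (- D)" by blast
  from choice[OF this] obtain cell where cell: "\<And>x. x \<in> L cc \<Longrightarrow> cell x \<in> F \<and> x \<ominus> cell x \<in> L (- D)" by blast
  let ?P = "{..<d} \<times> {..<d} \<rightarrow>\<^sub>E F"
  have fP: "finite ?P" using F by (intro finite_PiE) auto
  show ?thesis
  proof (rule exI[of _ "card ?P"], intro allI impI)
    fix Z :: "'z set" and w
    assume w: "\<forall>z\<in>Z. w z \<in> NW cc" and sep: "\<forall>z\<in>Z. \<forall>z'\<in>Z. z \<noteq> z' \<longrightarrow> ginv (w z) \<cdot> w z' \<notin> NW 0"
    have B: "w z \<in> Bd cc" "w z \<in> UU" if "z \<in> Z" for z using w that NW_Bd cc NW_UU by auto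
    define \<Phi> where "\<Phi> z = restrict (\<lambda>ij. cell (w z ij)) ({..<d} \<times> {..<d})" for z
    have "\<Phi> z \<in> ?P" if "z \<in> Z" for z
      unfolding \<Phi>_def using cell Bd_entry[OF B(1)[OF that]] by auto
    moreover have "inj_on \<Phi> Z"
    proof (rule inj_onI, rule ccontr)
      fix z z' assume z: "z \<in> Z" "z' \<in> Z" "\<Phi> z = \<Phi> z'" "z \<noteq> z'"
      have small: "(ginv (w y) \<cdot> w y') (i, j) \<in> L 0"
        if y: "y \<in> Z" "y' \<in> Z" "\<Phi> y = \<Phi> y'" and ij: "i < j" "j < d" for y y' i j
      proof -
        have id: "i < d" using ij by simp
        let ?v = "ginv (w y)"
        have G: "w y \<in> \<Gamma>" "w y' \<in> \<Gamma>" using B y Bd_\<Gamma> by auto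
        have e: "w y (k, l) \<in> carrier K" "w y' (k, l) \<in> carrier K" "?v (k, l) \<in> carrier K" if "k < d" "l < d" for k l
          using GL_entry G GL.inv_closed that by auto
        have df: "w y' (l, j) \<ominus> w y (l, j) \<in> L (- D + 2 * c)" if l: "l < d" for l
        proof -
          let ?a = "w y' (l, j)" and ?b = "w y (l, j)"
          have ab: "?a \<in> L cc" "?b \<in> L cc" using Bd_entry B y l ij by auto
          have "\<Phi> y (l, j) = \<Phi> y' (l, j)" using y(3) by simp
          then have cl: "cell ?b = cell ?a" unfolding \<Phi>_def using l ij by simp
          have k: "cell ?a \<in> carrier K" using cell[OF ab(1)] F by blast
          have p: "?a \<ominus> cell ?a \<in> L (- D + c)" using cell[OF ab(1)] L_up c_nonneg by (meson le_add_same_cancel1)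
          have q: "\<ominus> (?b \<ominus> cell ?a) \<in> L (- D + c)" using cell[OF ab(2)] cl by (intro L_minus) simp
          have "(?a \<ominus> cell ?a) \<oplus> \<ominus> (?b \<ominus> cell ?a) \<in> L (- D + c + c)" by (rule L_add[OF p q])
          moreover have "(?a \<ominus> cell ?a) \<oplus> \<ominus> (?b \<ominus> cell ?a) = ?a \<ominus> ?b"
          proof -
            have "cell ?a \<oplus> (\<ominus> ?b \<oplus> \<ominus> cell ?a) = \<ominus> ?b"
              using e[OF l ij(2)] k by (metis a_inv_closed a_lcomm r_neg r_zero)
            then show ?thesis using e[OF l ij(2)] k by (simp add: a_minus_def minus_add a_ac)
          qed
          ultimately show ?thesis by (simp add: algebra_simps)
        qed
        have t: "?v (i, l) \<otimes> (w y' (l, j) \<ominus> w y (l, j)) \<in> L (- cc + c)" if l: "l < d" for l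
        proof -
          have "?v (i, l) \<otimes> (w y' (l, j) \<ominus> w y (l, j)) \<in> L (cc + (- D + 2 * c) + c)"
            using ginv_entry[OF B(1)[OF y(1)] id l] df[OF l] by (rule L_mult)
          then show ?thesis unfolding D_def by (simp add: algebra_simps)
        qed
        \<comment> \<open>Splits w y' into w y plus a small difference: the product of the inverse
          of w y with w y contributes nothing off the diagonal.\<close>
        have "(?v \<cdot> w y') (i, j) = (\<Oplus>l\<in>{..<d}. ?v (i, l) \<otimes> w y (l, j) \<oplus> ?v (i, l) \<otimes> (w y' (l, j) \<ominus> w y (l, j)))"
          unfolding gmult_entry[OF id ij(2)]
        proof (rule finsum_cong'[OF refl])
          fix l assume l: "l \<in> {..<d}"
          show "?v (i, l) \<otimes> w y' (l, j) = ?v (i, l) \<otimes> w y (l, j) \<oplus> ?v (i, l) \<otimes> (w y' (l, j) \<ominus> w y (l, j))"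
            using e[of l j] e[of i l] l ij id by (simp add: r_distr[symmetric] a_minus_def a_ac r_neg r_neg1 r_neg2)
        qed (use e id ij in auto)
        also have "\<dots> = (\<Oplus>l\<in>{..<d}. ?v (i, l) \<otimes> w y (l, j)) \<oplus> (\<Oplus>l\<in>{..<d}. ?v (i, l) \<otimes> (w y' (l, j) \<ominus> w y (l, j)))"
          by (rule finsum_addf) (use e id ij in auto)
        also have "(\<Oplus>l\<in>{..<d}. ?v (i, l) \<otimes> w y (l, j)) = (?v \<cdot> w y) (i, j)" by (simp add: gmult_entry id ij)
        also have "\<dots> = \<zero>" using G id ij by (simp add: gone_entry)
        also have "\<zero> \<oplus> (\<Oplus>l\<in>{..<d}. ?v (i, l) \<otimes> (w y' (l, j) \<ominus> w y (l, j))) = (\<Oplus>l\<in>{..<d}. ?v (i, l) \<otimes> (w y' (l, j) \<ominus> w y (l, j)))"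
          by (rule l_zero, rule finsum_closed) (use e id ij in auto)
        also have "\<dots> \<in> L (- cc + c + c * int (card {..<d}))" by (rule finsum_L) (use t in auto)
        finally show ?thesis by (simp add: cc_def)
      qed
      have G: "w z \<in> \<Gamma>" "w z' \<in> \<Gamma>" using B z Bd_\<Gamma> by auto
      have "ginv (w z) \<cdot> w z' \<in> UU" using B z UU_inv UU_mult by simp
      moreover have "ginv (ginv (w z) \<cdot> w z') = ginv (w z') \<cdot> w z" using G by (simp add: GL.inv_mult_group)
      ultimately have "ginv (w z) \<cdot> w z' \<in> NW 0"
        unfolding NW_def using small[OF z(1,2,3)] small[OF z(2,1) z(3)[symmetric]] by simp
      then show False using sep z by blast
    qed
    ultimately show "finite Z \<and> card Z \<le> card ?P"
      using fP by (meson card_inj_on_le finite_imageD finite_subset image_subsetI)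
  qed
qed

text \<open>Each letter brings every diagonal entry one level closer to 0, multiplying it by \<pi>,
  its inverse or 1. An entry outside \<open>L (int m)\<close> has an inverse of level at most c - m,
  so raising that inverse by one level is harmless once m > c. The extra letter in
  \<open>Suc m\<close> is the remaining matrix of bounded level.\<close>

lemma diag_word:
  "\<exists>q\<ge>0. \<forall>m f. nz f \<longrightarrow> (\<forall>j<d. f j \<in> L (int m) \<and> inv (f j) \<in> L (int m)) \<longrightarrow>
     dg f \<in> set_power (GL d K) (Bd q) (Suc m)"
proof -
  obtain a where a: "\<pi> \<in> L a" using L_exhaust[OF \<pi>_carrier] by blast
  obtain b where b: "inv \<pi> \<in> L b" using L_exhaust[OF \<pi>_inv(1)] by blast
  \<comment> \<open>q bounds the letters \<pi> and its inverse, and also \<open>c + 1\<close>, the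
    level up to which a diagonal matrix counts as a single letter.\<close>
  define q where "q = Max {0, a, b, c + 1}"
  have q: "0 \<le> q" "a \<le> q" "b \<le> q" "c + 1 \<le> q" unfolding q_def by auto
  have BG: "Bd q \<subseteq> \<Gamma>" using Bd_\<Gamma> by blast
  have dgB: "dg f \<in> Bd k" if "nz f" "\<forall>j<d. f j \<in> L k \<and> inv (f j) \<in> L k" "0 \<le> k" for f k
    unfolding Bd_def matL_def using dg_GL[OF that(1)] GL_carrier_mat L_zero that GL_carrier_mat[OF dg_GL(1)[OF nz_inv[OF that(1)]]]
    by (auto simp: dg_entry)
  have "dg f \<in> set_power (GL d K) (Bd q) (Suc m)"
    if "nz f" "\<forall>j<d. f j \<in> L (int m) \<and> inv (f j) \<in> L (int m)" for m f
    using that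
  proof (induction m arbitrary: f)
    case 0
    then have "dg f \<in> Bd q" using dgB[of f 0] Bd_mono[of 0 q] q by auto
    then have "\<one>\<^bsub>GL d K\<^esub> \<cdot> dg f \<in> set_power (GL d K) (Bd q) (Suc 0)" by (intro GL.set_power_SucI) auto
    then show ?case using dg_GL[OF 0(1)] by simp
  next
    case (Suc m)
    show ?case
    proof (cases "int (Suc m) \<le> c + 1")
      case True
      have "dg f \<in> Bd (int (Suc m))" by (rule dgB) (use Suc.prems in auto)
      then have "dg f \<in> Bd q" using Bd_mono[of "int (Suc m)" q] True q by auto
      then have "\<one>\<^bsub>GL d K\<^esub> \<cdot> dg f \<in> set_power (GL d K) (Bd q) (Suc 0)" by (intro GL.set_power_SucI) auto
      then have "dg f \<in> set_power (GL d K) (Bd q) (Suc 0)" using dg_GL[OF Suc.prems(1)] by simp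
      then show ?thesis using GL.set_power_mono[OF BG Bd_one[OF q(1)], of "Suc 0" "Suc (Suc m)"] by auto
    next
      case False
      have "\<exists>g. g \<in> carrier K \<and> g \<noteq> \<zero> \<and> g \<in> L q \<and> inv g \<in> L q \<and> g \<otimes> f j \<in> L (int m) \<and> inv g \<otimes> inv (f j) \<in> L (int m)"
        if j: "j < d" for j
      proof -
        have fj: "f j \<in> carrier K" "f j \<noteq> \<zero>" "f j \<in> L (int m + 1)" "inv (f j) \<in> L (int m + 1)"
          using Suc.prems j unfolding nz_def by (auto simp: add.commute)
        have U: "f j \<in> Units K" using fj field_Units by simp
        have ifj: "inv (f j) \<in> carrier K" using U by simp
        have pq: "\<pi> \<in> L q" "inv \<pi> \<in> L q" using a b q L_up by auto
        consider "f j \<notin> L (int m)" | "inv (f j) \<notin> L (int m)" | "f j \<in> L (int m)" "inv (f j) \<in> L (int m)" by blast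
        then show ?thesis
        proof cases
          case 1
          have "inv (f j) \<in> L (- int m + c)" by (rule L_inv[OF fj(1) 1])
          then have "inv \<pi> \<otimes> inv (f j) \<in> L (- int m + c + 1)" using \<pi>_inv_shift[OF ifj] by blast
          then have "inv \<pi> \<otimes> inv (f j) \<in> L (int m)" by (rule L_up) (use False c_nonneg in simp)
          moreover have "\<pi> \<otimes> f j \<in> L (int m)" using \<pi>_shift[OF fj(1)] fj(3) by simp
          ultimately show ?thesis using \<pi>_carrier \<pi>_nonzero pq by blast
        next
          case 2
          have "inv (inv (f j)) \<in> L (- int m + c)" by (rule L_inv[OF ifj 2])
          then have "f j \<in> L (- int m + c)" using U by simp
          then have "inv \<pi> \<otimes> f j \<in> L (- int m + c + 1)" using \<pi>_inv_shift[OF fj(1)] by blast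
          then have "inv \<pi> \<otimes> f j \<in> L (int m)" by (rule L_up) (use False c_nonneg in simp)
          moreover have "inv (inv \<pi>) \<otimes> inv (f j) \<in> L (int m)" using \<pi>_shift[OF ifj] fj(4) \<pi>_Units by simp
          ultimately show ?thesis using \<pi>_inv pq \<pi>_Units by (intro exI[of _ "inv \<pi>"]) auto
        next
          case 3
          then show ?thesis using fj ifj L_one L_up[OF _ q(1)] by (intro exI[of _ \<one>]) auto
        qed
      qed
      then obtain g where g: "\<And>j. j < d \<Longrightarrow> g j \<in> carrier K \<and> g j \<noteq> \<zero> \<and> g j \<in> L q \<and> inv (g j) \<in> L q \<and>
          g j \<otimes> f j \<in> L (int m) \<and> inv (g j) \<otimes> inv (f j) \<in> L (int m)" by metis
      define h where "h = (\<lambda>j. g j \<otimes> f j)"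
      have gz: "nz g" using g by (simp add: nz_def)
      have hz: "nz h" unfolding nz_def h_def using g Suc.prems(1) integral unfolding nz_def by blast
      have hi: "inv (h j) = inv (g j) \<otimes> inv (f j)" if "j < d" for j
        unfolding h_def using g[OF that] Suc.prems(1) that by (intro inv_mult_nonzero) (auto simp: nz_def)
      have ih: "dg h \<in> set_power (GL d K) (Bd q) (Suc m)"
        by (rule Suc.IH[OF hz]) (use g hi in \<open>auto simp: h_def\<close>)
      let ?gi = "\<lambda>j. inv (g j)"
      have giz: "nz ?gi" by (rule nz_inv[OF gz])
      have gib: "dg ?gi \<in> Bd q"
      proof (rule dgB[OF giz _ q(1)], intro allI impI)
        fix j assume j: "j < d"
        have "g j \<in> Units K" using g[OF j] field_Units by simp
        then show "inv (g j) \<in> L q \<and> inv (inv (g j)) \<in> L q" using g[OF j] by simp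
      qed
      have "dg h \<cdot> dg ?gi = dg f"
      proof (rule mat_eqI[of _ d])
        show "dg h \<cdot> dg ?gi \<in> Mat" "dg f \<in> Mat"
          by (intro gmult_Mat dg_Mat nz_closed(2) hz giz Suc.prems(1))+
        fix i j assume ij: "i < d" "j < d"
        have "h i \<otimes> inv (g i) = f i"
        proof -
          have c1: "g i \<in> carrier K" "f i \<in> carrier K" "inv (g i) \<in> carrier K"
            using nz_closed gz giz Suc.prems(1) ij by auto
          have "h i \<otimes> inv (g i) = f i \<otimes> (g i \<otimes> inv (g i))" unfolding h_def using c1 m_assoc m_comm by metis
          then show ?thesis using nz_r_inv[OF gz ij(1)] c1 by simp
        qed
        then show "(dg h \<cdot> dg ?gi) (i, j) = dg f (i, j)"
          using dg_mult_left[OF nz_closed(2)[OF hz] dg_Mat[OF nz_closed(2)[OF giz]] ij] nz_closed(1)[OF hz] ij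
          by (cases "i = j") (simp_all add: dg_entry)
      qed
      then show ?thesis using GL.set_power_SucI[OF ih gib] by simp
    qed
  qed
  then show ?thesis using q(1) by blast
qed

end

text \<open>A choice of the decomposition \<open>x = U x \<cdot> dg (f x) \<cdot> \<kappa> x\<close>, of levels \<open>e x j\<close> of the diagonal
  entries, and of an element \<open>\<gamma> k\<close> of each level.\<close>

locale decomposed_GL = filtered_GL +
  fixes U :: "(nat \<times> nat \<Rightarrow> 'a) \<Rightarrow> nat \<times> nat \<Rightarrow> 'a"
    and f :: "(nat \<times> nat \<Rightarrow> 'a) \<Rightarrow> nat \<Rightarrow> 'a"
    and \<kappa> :: "(nat \<times> nat \<Rightarrow> 'a) \<Rightarrow> nat \<times> nat \<Rightarrow> 'a"
    and e :: "(nat \<times> nat \<Rightarrow> 'a) \<Rightarrow> nat \<Rightarrow> int"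
    and C0 :: int and k1 :: int and \<gamma> :: "int \<Rightarrow> 'a"
  assumes U_UU: "x \<in> \<Gamma> \<Longrightarrow> U x \<in> UU"
    and f_nz: "x \<in> \<Gamma> \<Longrightarrow> nz (f x)"
    and \<kappa>_Bd: "x \<in> \<Gamma> \<Longrightarrow> \<kappa> x \<in> Bd C0"
    and decomp: "x \<in> \<Gamma> \<Longrightarrow> x = U x \<cdot> dg (f x) \<cdot> \<kappa> x"
    and f_level: "x \<in> \<Gamma> \<Longrightarrow> j < d \<Longrightarrow> f x j \<in> L (e x j) \<and> inv (f x j) \<in> L (c + 1 - e x j)"
    and k1: "0 \<le> k1" "\<one> \<in> L n \<Longrightarrow> - k1 \<le> n"
    and C0: "0 \<le> C0"
    and \<gamma>: "\<gamma> k \<in> carrier K" "\<gamma> k \<noteq> \<zero>" "\<gamma> k \<in> L k" "inv (\<gamma> k) \<in> L (- k)"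
begin

lemma f_closed: "x \<in> \<Gamma> \<Longrightarrow> j < d \<Longrightarrow> f x j \<in> carrier K" "x \<in> \<Gamma> \<Longrightarrow> j < d \<Longrightarrow> inv (f x j) \<in> carrier K"
  using nz_closed(1)[OF f_nz] nz_closed(1)[OF nz_inv[OF f_nz]] by auto

lemma dg_\<Gamma>: "x \<in> \<Gamma> \<Longrightarrow> dg (f x) \<in> \<Gamma>"
  using dg_GL f_nz by blast

text \<open>Up to the bounded factors \<kappa>, the quotient of x and y is triangular. A bound on
  the quotient therefore bounds all entries of the triangular matrix on the left.\<close>

lemma triangular_part:
  assumes x: "x \<in> \<Gamma>" and y: "y \<in> \<Gamma>"
  shows "ginv (dg (f x)) \<cdot> (ginv (U x) \<cdot> U y) \<cdot> dg (f y) = \<kappa> x \<cdot> (ginv x \<cdot> y) \<cdot> ginv (\<kappa> y)"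
proof -
  note G = UU_\<Gamma>[OF U_UU[OF x]] UU_\<Gamma>[OF U_UU[OF y]] dg_\<Gamma>[OF x] dg_\<Gamma>[OF y]
    Bd_\<Gamma>[OF \<kappa>_Bd[OF x]] Bd_\<Gamma>[OF \<kappa>_Bd[OF y]]
  have 1: "y \<cdot> ginv (\<kappa> y) = U y \<cdot> dg (f y)"
    by (subst decomp[OF y]) (use G in \<open>simp add: GL.m_assoc\<close>)
  have 2: "\<kappa> x \<cdot> ginv x = ginv (dg (f x)) \<cdot> ginv (U x)"
  proof -
    have "ginv x = ginv (\<kappa> x) \<cdot> (ginv (dg (f x)) \<cdot> ginv (U x))"
      by (subst decomp[OF x]) (use G in \<open>simp add: GL.m_assoc GL.inv_mult_group\<close>)
    then have "\<kappa> x \<cdot> ginv x = (\<kappa> x \<cdot> ginv (\<kappa> x)) \<cdot> (ginv (dg (f x)) \<cdot> ginv (U x))"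
      using G GL.m_assoc GL.inv_closed GL.m_closed by metis
    then show ?thesis using G by simp
  qed
  have "\<kappa> x \<cdot> (ginv x \<cdot> y) \<cdot> ginv (\<kappa> y) = (\<kappa> x \<cdot> ginv x) \<cdot> (y \<cdot> ginv (\<kappa> y))"
    using G x y by (simp add: GL.m_assoc)
  then show ?thesis unfolding 1 2 using G by (simp add: GL.m_assoc)
qed

lemma diag_conj_entry:
  assumes h: "nz h" and g: "nz g" and w: "w \<in> \<Gamma>" and ij: "i < d" "j < d"
  shows "(ginv (dg h) \<cdot> w \<cdot> dg g) (i, j) = inv (h i) \<otimes> w (i, j) \<otimes> g j"
proof -
  have M: "dg (\<lambda>j. inv (h j)) \<cdot> w \<in> Mat"
    by (intro gmult_Mat dg_Mat nz_closed(2)[OF nz_inv[OF h]] GL_carrier_mat[OF w])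
  show ?thesis unfolding dg_GL(2)[OF h]
    by (simp add: dg_mult_right[OF nz_closed(2)[OF g] M ij]
        dg_mult_left[OF nz_closed(2)[OF nz_inv[OF h]] GL_carrier_mat[OF w] ij])
qed

text \<open>The constant collects the two factors \<kappa> of level \<open>C0\<close>, the quotient
  of level s and two products at \<open>cc\<close> each.\<close>

lemma step_aux:
  assumes x: "x \<in> \<Gamma>" and y: "y \<in> \<Gamma>" and s: "ginv x \<cdot> y \<in> Bd s"
    and i: "i < d" and j: "j < d"
  shows "inv (f x i) \<otimes> (ginv (U x) \<cdot> U y) (i, j) \<otimes> f y j \<in> L (2 * C0 + s + 2 * cc)"
proof -
  have w: "ginv (U x) \<cdot> U y \<in> \<Gamma>" using UU_\<Gamma>[OF U_UU[OF x]] UU_\<Gamma>[OF U_UU[OF y]] by simp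
  have "\<kappa> x \<cdot> (ginv x \<cdot> y) \<cdot> ginv (\<kappa> y) \<in> Bd (C0 + s + cc + C0 + cc)"
    by (intro Bd_mult Bd_inv \<kappa>_Bd x y s)
  then have "ginv (dg (f x)) \<cdot> (ginv (U x) \<cdot> U y) \<cdot> dg (f y) \<in> Bd (2 * C0 + s + 2 * cc)"
    unfolding triangular_part[OF x y] by (simp add: algebra_simps)
  from Bd_entry[OF this i j] show ?thesis
    by (simp add: diag_conj_entry[OF f_nz[OF x] f_nz[OF y] w i j])
qed

lemma U_quot_diag:
  assumes x: "x \<in> \<Gamma>" and y: "y \<in> \<Gamma>" and j: "j < d"
  shows "(ginv (U x) \<cdot> U y) (j, j) = \<one>"
proof -
  have "ginv (U x) \<cdot> U y \<in> UU" by (intro UU_mult UU_inv U_UU x y)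
  then show ?thesis using j by (simp add: UU_def unitri_def)
qed

text \<open>On the diagonal the unipotent part is 1, so \<open>step_aux\<close> bounds the ratio of
  the diagonal entries. Multiplying this ratio back by the two entries gives 1, which cannot have a
  level below - k1.\<close>

lemma step_level:
  assumes x: "x \<in> \<Gamma>" and y: "y \<in> \<Gamma>" and s: "ginv x \<cdot> y \<in> Bd s" and j: "j < d"
  shows "e y j \<le> e x j + (2 * C0 + s + 2 * cc + 3 * c + 1 + k1)"
proof -
  note cl = f_closed[OF x j] f_closed[OF y j]
  have "inv (f x j) \<otimes> f y j \<in> L (2 * C0 + s + 2 * cc)"
    using step_aux[OF x y s j j] U_quot_diag[OF x y j] cl by simp
  then have "f x j \<otimes> (inv (f x j) \<otimes> f y j) \<otimes> inv (f y j)
      \<in> L (e x j + (2 * C0 + s + 2 * cc) + c + (c + 1 - e y j) + c)"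
    using f_level[OF x j] f_level[OF y j] by (intro L_mult) auto
  moreover have "f x j \<otimes> (inv (f x j) \<otimes> f y j) \<otimes> inv (f y j) = (f x j \<otimes> inv (f x j)) \<otimes> (f y j \<otimes> inv (f y j))"
    using cl by (simp add: m_ac)
  ultimately have "\<one> \<in> L (e x j + (2 * C0 + s + 2 * cc) + c + (c + 1 - e y j) + c)"
    using nz_r_inv(1)[OF f_nz[OF x] j] nz_r_inv(1)[OF f_nz[OF y] j] by simp
  then have "- k1 \<le> e x j + (2 * C0 + s + 2 * cc) + c + (c + 1 - e y j) + c" by (rule k1(2))
  then show ?thesis by simp
qed

text \<open>At scale \<open>n\<close> the torus is cut into cubes of side \<open>P\<close>, a multiple of \<open>n\<close>; the cube indexed by \<open>k\<close>
  has its centre at level \<open>P * k\<close>. Conjugation by \<open>dg (\<alpha> P Q k)\<close> takes the unipotent part into the frame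
  of that centre and contracts it by \<open>Q\<close> per step away from the diagonal; for \<open>Q\<close> a large multiple
  of \<open>n\<close> this absorbs the distortion accumulated along \<open>n\<close> steps inside the cube.\<close>

definition \<alpha> :: "int \<Rightarrow> int \<Rightarrow> (nat \<Rightarrow> int) \<Rightarrow> nat \<Rightarrow> 'a" where
  "\<alpha> P Q k j = \<gamma> (P * k j - Q * int j)"

text \<open>The displacement from the unipotent part of x to that of y, in the frame of a. By
  \<open>V_mult\<close> and \<open>V_inv\<close> it is a cocycle, so
  \<open>V a x y \<in> NW m\<close> behaves like a bound on a distance.\<close>

definition V :: "(nat \<Rightarrow> 'a) \<Rightarrow> (nat \<times> nat \<Rightarrow> 'a) \<Rightarrow> (nat \<times> nat \<Rightarrow> 'a) \<Rightarrow> (nat \<times> nat \<Rightarrow> 'a)" where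
  "V a x y = ginv (dg a) \<cdot> (ginv (U x) \<cdot> U y) \<cdot> dg a"

lemma \<alpha>_nz: "nz (\<alpha> P Q k)"
  using \<gamma> by (simp add: nz_def \<alpha>_def)

lemma V_UU:
  assumes a: "nz a" and x: "x \<in> \<Gamma>" and y: "y \<in> \<Gamma>"
  shows "V a x y \<in> UU"
proof -
  have w: "ginv (U x) \<cdot> U y \<in> UU" by (intro UU_mult UU_inv U_UU x y)
  have key: "unitri (ginv (dg a) \<cdot> w \<cdot> dg a)" if w: "w \<in> \<Gamma>" "unitri w" for w
    unfolding unitri_def
  proof (intro allI impI conjI)
    fix i assume i: "i < d"
    show "(ginv (dg a) \<cdot> w \<cdot> dg a) (i, i) = \<one>"
      using diag_conj_entry[OF a a w(1) i i] w(2) i nz_r_inv(2)[OF a i] nz_closed(1)[OF nz_inv[OF a] i]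
      by (simp add: unitri_def)
    fix j assume j: "j < i"
    then have jd: "j < d" using i by simp
    show "(ginv (dg a) \<cdot> w \<cdot> dg a) (i, j) = \<zero>"
      using diag_conj_entry[OF a a w(1) i jd] w(2) i j nz_closed(1)[OF a jd] nz_closed(1)[OF nz_inv[OF a] i]
      by (simp add: unitri_def)
  qed
  have G: "dg a \<in> \<Gamma>" by (rule dg_GL(1)[OF a])
  have "ginv (V a x y) = ginv (dg a) \<cdot> ginv (ginv (U x) \<cdot> U y) \<cdot> dg a"
    unfolding V_def using G UU_\<Gamma>[OF w] by (simp add: GL.inv_mult_group GL.m_assoc)
  then show ?thesis
    using key[of "ginv (U x) \<cdot> U y"] key[of "ginv (ginv (U x) \<cdot> U y)"] w G
    by (simp add: UU_def V_def)
qed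

lemma V_mult:
  assumes a: "nz a" and x: "x \<in> \<Gamma>" and y: "y \<in> \<Gamma>" and z: "z \<in> \<Gamma>"
  shows "V a x y \<cdot> V a y z = V a x z"
proof -
  note G = dg_GL(1)[OF a] UU_\<Gamma>[OF U_UU[OF x]] UU_\<Gamma>[OF U_UU[OF y]] UU_\<Gamma>[OF U_UU[OF z]]
  have c: "p \<cdot> (ginv p \<cdot> q) = q" if "p \<in> \<Gamma>" "q \<in> \<Gamma>" for p q
    using that GL.m_assoc[of p "ginv p" q] by simp
  show ?thesis unfolding V_def using G by (simp add: GL.m_assoc c)
qed

lemma V_inv:
  assumes a: "nz a" and x: "x \<in> \<Gamma>" and y: "y \<in> \<Gamma>"
  shows "ginv (V a x y) = V a y x"
proof -
  note G = dg_GL(1)[OF a] UU_\<Gamma>[OF U_UU[OF x]] UU_\<Gamma>[OF U_UU[OF y]]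
  show ?thesis unfolding V_def using G by (simp add: GL.m_assoc GL.inv_mult_group)
qed

lemma V_refl: "nz a \<Longrightarrow> x \<in> \<Gamma> \<Longrightarrow> V a x x = \<one>\<^bsub>GL d K\<^esub>"
  unfolding V_def using dg_GL(1) UU_\<Gamma>[OF U_UU] by simp

text \<open>Twice as large as needed to cover the torus: a point within P of the centre may move by
  another P, the largest change of level in n steps, without leaving the cube.\<close>

definition X :: "int \<Rightarrow> (nat \<Rightarrow> int) \<Rightarrow> (nat \<times> nat \<Rightarrow> 'a) set" where
  "X P k = {x \<in> \<Gamma>. \<forall>j<d. \<bar>e x j - P * k j\<bar> \<le> 2 * P}"

text \<open>Passing from the diagonal parts of x and y to the centre of the cube costs at most 2 P
  on either side, and the step itself a constant. The tilt of the frame lowers entry (i, j) by Q (j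
  - i) \<ge> Q, which outweighs all of this.\<close>

lemma step_small:
  fixes s P Q t :: int
  defines "t \<equiv> 2 * C0 + s + 2 * cc + 3 * c + 1 + k1"
  assumes x: "x \<in> X P k" and y: "y \<in> X P k" and s: "ginv x \<cdot> y \<in> Bd s"
    and ij: "i < j" "j < d" and PQ: "0 \<le> Q" "Q \<ge> 4 * P + t + 2 * c + n"
  shows "V (\<alpha> P Q k) x y (i, j) \<in> L (- n)"
proof -
  have xy: "x \<in> \<Gamma>" "y \<in> \<Gamma>" using x y by (auto simp: X_def)
  have i: "i < d" using ij by simp
  let ?w = "(ginv (U x) \<cdot> U y) (i, j)" and ?a = "\<alpha> P Q k"
  have w: "ginv (U x) \<cdot> U y \<in> \<Gamma>" using UU_\<Gamma>[OF U_UU[OF xy(1)]] UU_\<Gamma>[OF U_UU[OF xy(2)]] by simp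
  have wc: "?w \<in> carrier K" using GL_entry[OF w i ij(2)] .
  note cl = f_closed[OF xy(1) i] f_closed[OF xy(2) ij(2)] nz_closed(1)[OF \<alpha>_nz[of P Q k] i]
    nz_closed(1)[OF \<alpha>_nz[of P Q k] ij(2)] nz_closed(1)[OF nz_inv[OF \<alpha>_nz[of P Q k]] i]
  have a: "?a j \<in> L (P * k j - Q * int j)" "inv (?a i) \<in> L (- (P * k i - Q * int i))"
    using \<gamma> by (simp_all only: \<alpha>_def)
  have "inv (?a i) \<otimes> f x i \<otimes> (inv (f x i) \<otimes> ?w \<otimes> f y j) \<otimes> (inv (f y j) \<otimes> ?a j)
     \<in> L ((- (P * k i - Q * int i) + e x i + c) + (2 * C0 + s + 2 * cc) + c + ((c + 1 - e y j) + (P * k j - Q * int j) + c) + c)"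
    using f_level[OF xy(1) i] f_level[OF xy(2) ij(2)] a step_aux[OF xy s i ij(2)]
    by (intro L_mult) auto
  moreover have "inv (?a i) \<otimes> f x i \<otimes> (inv (f x i) \<otimes> ?w \<otimes> f y j) \<otimes> (inv (f y j) \<otimes> ?a j)
     = (f x i \<otimes> inv (f x i)) \<otimes> (f y j \<otimes> inv (f y j)) \<otimes> (inv (?a i) \<otimes> ?w \<otimes> ?a j)"
    using cl wc by (simp add: m_ac)
  moreover have "\<dots> = V ?a x y (i, j)"
    using diag_conj_entry[OF \<alpha>_nz[of P Q k] \<alpha>_nz[of P Q k] w i ij(2)] nz_r_inv(1)[OF f_nz[OF xy(1)] i]
      nz_r_inv(1)[OF f_nz[OF xy(2)] ij(2)] cl wc by (simp add: V_def)
  ultimately have L: "V ?a x y (i, j)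
     \<in> L ((- (P * k i - Q * int i) + e x i + c) + (2 * C0 + s + 2 * cc) + c + ((c + 1 - e y j) + (P * k j - Q * int j) + c) + c)"
    by simp
  have 1: "e x i - P * k i \<le> 2 * P" "P * k j - e y j \<le> 2 * P" using x y i ij by (auto simp: X_def abs_le_iff)
  have "Q * 1 \<le> Q * (int j - int i)" using ij PQ by (intro mult_left_mono) auto
  then have "Q \<le> Q * int j - Q * int i" by (simp add: right_diff_distrib)
  then show ?thesis using 1 PQ(2) k1(1) c_nonneg unfolding t_def by (intro L_up[OF L]) linarith
qed

text \<open>The members of the cover are the sets \<open>{y \<in> X P k. V (\<alpha> P Q k) z y \<in> NW cc}\<close>, where \<open>z\<close> runs through
  a maximal subset of the enlarged cube \<open>X P k\<close> that is separated with respect to \<open>NW 0\<close>.\<close>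

theorem coarse_cover:
  "\<exists>M p q. 0 \<le> q \<and> (\<forall>n\<ge>1. \<exists>\<U>. (\<forall>A\<in>\<U>. A \<subseteq> \<Gamma>) \<and>
     (\<forall>x\<in>\<Gamma>. finite {A\<in>\<U>. x \<in> A} \<and> card {A\<in>\<U>. x \<in> A} \<le> M) \<and>
     (\<forall>x\<in>\<Gamma>. \<exists>A\<in>\<U>. \<forall>z\<in>set_power (GL d K) (Bd s) n. x \<cdot> z \<in> A) \<and>
     (\<forall>A\<in>\<U>. \<forall>x\<in>A. \<forall>y\<in>A. ginv x \<cdot> y \<in> set_power (GL d K) (Bd q) (p * n)))"
proof -
  \<comment> \<open>t bounds the change of a level in one step, by \<open>step_level\<close>; with R
    \<ge> t, n steps change a level by at most P = R * n.\<close>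
  define t where "t = 2 * C0 + s + 2 * cc + 3 * c + 1 + k1"
  define R where "R = max 1 t"
  \<comment> \<open>Makes Q = Q0 * n meet the hypothesis of \<open>step_small\<close> for the target
    level \<open>- (cc * int n)\<close>: the losses of n successive products are paid in
    advance.\<close>
  define Q0 where "Q0 = 4 * R + max 0 t + 2 * c + cc"
  have R: "1 \<le> R" "t \<le> R" unfolding R_def by auto
  have Q0: "0 \<le> Q0" unfolding Q0_def using R c_nonneg cc by simp
  from separated_bound[where 'z = "nat \<times> nat \<Rightarrow> 'a"]
  obtain M0 where "\<forall>Z :: (nat \<times> nat \<Rightarrow> 'a) set. \<forall>w. (\<forall>z\<in>Z. w z \<in> NW cc) \<longrightarrow>
     (\<forall>z\<in>Z. \<forall>z'\<in>Z. z \<noteq> z' \<longrightarrow> ginv (w z) \<cdot> w z' \<notin> NW 0) \<longrightarrow> finite Z \<and> card Z \<le> M0" ..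
  note M0 = this[THEN spec, THEN spec, THEN mp, THEN mp]
  from diag_word obtain q0 where q0': "q0 \<ge> 0 \<and> (\<forall>m f. nz f \<longrightarrow> (\<forall>j<d. f j \<in> L (int m) \<and> inv (f j) \<in> L (int m)) \<longrightarrow>
     dg f \<in> set_power (GL d K) (Bd q0) (Suc m))" ..
  note q0 = q0'[THEN conjunct1] q0'[THEN conjunct2, THEN spec, THEN spec, THEN mp, THEN mp]
  define q where "q = Max {q0, C0, 3 * cc}"
  have q: "q0 \<le> q" "C0 \<le> q" "3 * cc \<le> q" "0 \<le> q" unfolding q_def using q0(1) by (auto simp: max_def)
  \<comment> \<open>h * n bounds the levels of the diagonal matrix that leads from the diagonal part
    of a point to the tilted frame of its cube.\<close>
  define h where "h = nat (2 * R + Q0 * int d + 2 * c + 1)"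
  have h: "int h = 2 * R + Q0 * int d + 2 * c + 1" unfolding h_def using R Q0 c_nonneg by simp
  \<comment> \<open>The word for a quotient has 5 + 2 * h * n letters: two factors \<kappa>, one
    displacement, and two diagonal words of \<open>Suc (h * n)\<close> letters.\<close>
  define p where "p = 5 + 2 * h"
  show ?thesis
  \<comment> \<open>In each coordinate, at most five multiples of P are within 2 P of a given level;
    in each cube, at most M0 centres are close to a given point.\<close>
  proof (rule exI[of _ "5 ^ d * M0"], rule exI[of _ p], rule exI[of _ q], intro conjI allI impI)
    show "0 \<le> q" by (rule q)
    fix n :: nat assume n: "1 \<le> n"
    define P where "P = R * int n"
    define Q where "Q = Q0 * int n"
    have nn: "1 \<le> int n" using n by simp
    have P: "1 \<le> P" unfolding P_def using R(1) nn mult_mono[of 1 R 1 "int n"] by simp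
    have Q: "0 \<le> Q" unfolding Q_def using Q0 by simp
    have "max 0 t * 1 \<le> max 0 t * int n" "c * 1 \<le> c * int n" using mult_left_mono[OF nn, of "max 0 t"] mult_left_mono[OF nn c_nonneg] by simp_all
    then have Q2: "Q \<ge> 4 * P + t + 2 * c + cc * int n" unfolding Q_def Q0_def P_def
      by (simp add: algebra_simps max_def split: if_splits)
    let ?a = "\<alpha> P Q"
    have step: "V (?a k) x y \<in> NW (- (cc * int n))"
      if xy: "x \<in> X P k" "y \<in> X P k" and s: "ginv x \<cdot> y \<in> Bd s" for x y k
    proof -
      have G: "x \<in> \<Gamma>" "y \<in> \<Gamma>" using xy by (auto simp: X_def)
      have s': "ginv y \<cdot> x \<in> Bd s" using Bd_inv[OF s] G by (simp add: GL.inv_mult_group)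
      show ?thesis unfolding NW_def
        using V_UU[OF \<alpha>_nz G] V_inv[OF \<alpha>_nz G] step_small[OF xy s _ _ Q Q2[unfolded t_def]]
          step_small[OF xy(2,1) s' _ _ Q Q2[unfolded t_def]] by simp
    qed
    have BG: "Bd s \<subseteq> \<Gamma>" using Bd_\<Gamma> by blast
    \<comment> \<open>Each step lies in \<open>NW (- (cc * int n))\<close> and each product adds
      \<open>cc\<close>, so up to m = n the level stays nonpositive and \<open>NW_mult_small\<close>
      remains applicable. As x is within P of the centre, the whole path stays in the enlarged
      cube.\<close>
    have chain: "(\<forall>j<d. \<bar>e (x \<cdot> z) j - e x j\<bar> \<le> R * int m) \<and> V (?a k) x (x \<cdot> z) \<in> NW (- (cc * int n) + cc * int m)"
      if x: "x \<in> \<Gamma>" "\<forall>j<d. \<bar>e x j - P * k j\<bar> \<le> P" and z: "z \<in> set_power (GL d K) (Bd s) m" and m: "m \<le> n" for x k z m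
      using z m
    proof (induction m arbitrary: z)
      case 0
      then show ?case using x(1) V_refl[OF \<alpha>_nz x(1)] NW_one by simp
    next
      case (Suc m)
      obtain y b where yb: "y \<in> set_power (GL d K) (Bd s) m" "b \<in> Bd s" "z = y \<cdot> b"
        using GL.set_power_SucE[OF Suc.prems(1)] by blast
      have mn: "m \<le> n" "int m \<le> int n" using Suc.prems by auto
      note IH = Suc.IH[OF yb(1) mn(1)]
      have yG: "y \<in> \<Gamma>" using GL.set_power_closed[OF BG] yb(1) by blast
      have bG: "b \<in> \<Gamma>" using BG yb by blast
      have xyG: "x \<cdot> y \<in> \<Gamma>" "x \<cdot> z \<in> \<Gamma>" using x yG bG yb(3) by auto
      have xz: "x \<cdot> z = (x \<cdot> y) \<cdot> b" unfolding yb(3) using x yG bG by (simp add: GL.m_assoc)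
      have st: "ginv (x \<cdot> y) \<cdot> (x \<cdot> z) = b" unfolding xz using xyG(1) bG GL.m_assoc[of "ginv (x \<cdot> y)" "x \<cdot> y" b] by simp
      have st': "ginv (x \<cdot> z) \<cdot> (x \<cdot> y) \<in> Bd s"
      proof -
        have "ginv (ginv (x \<cdot> y) \<cdot> (x \<cdot> z)) = ginv (x \<cdot> z) \<cdot> (x \<cdot> y)" using xyG by (simp add: GL.inv_mult_group)
        then show ?thesis using Bd_inv[OF yb(2)] st by simp
      qed
      have Rm: "R * int m \<le> P" "R * int (Suc m) \<le> P" unfolding P_def using R Suc.prems by (auto intro!: mult_left_mono simp del: of_nat_Suc)
      have ee: "\<bar>e (x \<cdot> z) j - e x j\<bar> \<le> R * int (Suc m)" if j: "j < d" for j
      proof -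
        have "\<bar>e (x \<cdot> z) j - e (x \<cdot> y) j\<bar> \<le> t"
          using step_level[OF xyG(1,2) _ j, of s] step_level[OF xyG(2,1) st' j] st yb(2) unfolding t_def by simp
        moreover have "\<bar>e (x \<cdot> y) j - e x j\<bar> \<le> R * int m" using IH j by blast
        moreover have "R * int (Suc m) = R * int m + R" by (simp add: algebra_simps)
        ultimately show ?thesis using R(2) by linarith
      qed
      have "\<bar>e (x \<cdot> y) j - P * k j\<bar> \<le> 2 * P" if j: "j < d" for j
        using IH x(2) j Rm(1) by (smt (verit, best))
      then have X1: "x \<cdot> y \<in> X P k" using xyG by (simp add: X_def)
      have "\<bar>e (x \<cdot> z) j - P * k j\<bar> \<le> 2 * P" if j: "j < d" for j
        using ee[OF j] x(2) j Rm(2) by (smt (verit, best))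
      then have X2: "x \<cdot> z \<in> X P k" using xyG by (simp add: X_def)
      have V2: "V (?a k) (x \<cdot> y) (x \<cdot> z) \<in> NW (- (cc * int n))" by (rule step[OF X1 X2]) (use st yb(2) in simp)
      have lev: "- (cc * int n) \<le> - (cc * int n) + cc * int m" "- (cc * int n) + cc * int m \<le> 0"
        using cc mn by (auto simp: mult_left_mono)
      have "V (?a k) x (x \<cdot> y) \<cdot> V (?a k) (x \<cdot> y) (x \<cdot> z) \<in> NW (- (cc * int n) + cc * int m + cc)"
        by (rule NW_mult_small) (use IH V2 NW_mono[OF lev(1)] lev in auto)
      then have "V (?a k) x (x \<cdot> z) \<in> NW (- (cc * int n) + cc * int (Suc m))"
        using V_mult[OF \<alpha>_nz x(1) xyG] by (simp add: algebra_simps)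
      then show ?case using ee by blast
    qed
    have "\<exists>N\<subseteq>X P k. (\<forall>x\<in>N. \<forall>y\<in>N. x \<noteq> y \<longrightarrow> V (?a k) x y \<notin> NW 0) \<and> (\<forall>x\<in>X P k. \<exists>z\<in>N. V (?a k) z x \<in> NW 0)" for k
    proof -
      have XG: "X P k \<subseteq> \<Gamma>" by (auto simp: X_def)
      have r: "V (?a k) x x \<in> NW 0" if "x \<in> X P k" for x using V_refl[OF \<alpha>_nz] NW_one that XG by auto
      have sy: "V (?a k) y x \<in> NW 0" if "x \<in> X P k" "y \<in> X P k" "V (?a k) x y \<in> NW 0" for x y
      proof -
        have "x \<in> \<Gamma>" "y \<in> \<Gamma>" using that XG by auto
        then show ?thesis using NW_inv[OF that(3)] V_inv[OF \<alpha>_nz] by simp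
      qed
      show ?thesis by (rule maximal_separated[of "X P k" "\<lambda>x y. V (?a k) x y \<in> NW 0", OF r sy])
    qed
    then obtain N where N: "\<And>k. N k \<subseteq> X P k" "\<And>k x y. x \<in> N k \<Longrightarrow> y \<in> N k \<Longrightarrow> x \<noteq> y \<Longrightarrow> V (?a k) x y \<notin> NW 0"
      "\<And>k x. x \<in> X P k \<Longrightarrow> \<exists>z\<in>N k. V (?a k) z x \<in> NW 0" by metis
    have XG: "X P k \<subseteq> \<Gamma>" for k by (auto simp: X_def)
    define A where "A = (\<lambda>(k, z). {y \<in> X P k. V (?a k) z y \<in> NW cc})"
    define I where "I = (SIGMA k : {..<d} \<rightarrow>\<^sub>E (UNIV :: int set). N k)"
    define \<U> where "\<U> = A ` I"
    show "\<exists>\<U>. (\<forall>A\<in>\<U>. A \<subseteq> \<Gamma>) \<and>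
     (\<forall>x\<in>\<Gamma>. finite {A\<in>\<U>. x \<in> A} \<and> card {A\<in>\<U>. x \<in> A} \<le> 5 ^ d * M0) \<and>
     (\<forall>x\<in>\<Gamma>. \<exists>A\<in>\<U>. \<forall>z\<in>set_power (GL d K) (Bd s) n. x \<cdot> z \<in> A) \<and>
     (\<forall>A\<in>\<U>. \<forall>x\<in>A. \<forall>y\<in>A. ginv x \<cdot> y \<in> set_power (GL d K) (Bd q) (p * n))"
    proof (rule exI[of _ \<U>], intro conjI ballI)
      show "B \<subseteq> \<Gamma>" if "B \<in> \<U>" for B using that XG unfolding \<U>_def A_def by auto
    next
      fix x assume x: "x \<in> \<Gamma>"
      define S where "S = (\<Pi>\<^sub>E j\<in>{..<d}. {e x j div P - 2 .. e x j div P + 2})"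
      define Z where "Z = (\<lambda>k. {z \<in> N k. V (?a k) z x \<in> NW cc})"
      have fS: "finite S" unfolding S_def by (intro finite_PiE) auto
      have cS: "card S = 5 ^ d" unfolding S_def by (simp add: card_PiE)
      \<comment> \<open>Seen from x, the centres are points of \<open>NW cc\<close>; by the cocycle
        rule their quotients are the displacements between centres, which are outside
        \<open>NW 0\<close>.\<close>
      have Z: "finite (Z k) \<and> card (Z k) \<le> M0" for k
      proof (rule M0[of "Z k" "\<lambda>z. V (?a k) x z"]; intro ballI impI)
        fix z assume z: "z \<in> Z k"
        have zG: "z \<in> \<Gamma>" using z N(1) XG unfolding Z_def by blast
        show "V (?a k) x z \<in> NW cc"
          using NW_inv[of "V (?a k) z x" cc] V_inv[OF \<alpha>_nz zG x] z unfolding Z_def by simp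
        fix z' assume z': "z' \<in> Z k" "z \<noteq> z'"
        have zG': "z' \<in> \<Gamma>" using z' N(1) XG unfolding Z_def by blast
        show "ginv (V (?a k) x z) \<cdot> V (?a k) x z' \<notin> NW 0"
          using N(2)[of z k z'] z z' unfolding V_inv[OF \<alpha>_nz x zG] V_mult[OF \<alpha>_nz zG x zG'] Z_def by simp
      qed
      have "{B \<in> \<U>. x \<in> B} \<subseteq> A ` (SIGMA k : S. Z k)"
      proof
        fix B assume "B \<in> {B \<in> \<U>. x \<in> B}"
        then obtain k z where kz: "k \<in> {..<d} \<rightarrow>\<^sub>E UNIV" "z \<in> N k" "B = A (k, z)" "x \<in> A (k, z)"
          unfolding \<U>_def I_def by auto
        have xk: "\<And>j. j < d \<Longrightarrow> \<bar>e x j - P * k j\<bar> \<le> 2 * P" and Vz: "V (?a k) z x \<in> NW cc"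
          using kz(4) by (auto simp: A_def X_def)
        have "k j \<in> {e x j div P - 2 .. e x j div P + 2}" if j: "j < d" for j
        proof -
          define r where "r = e x j mod P"
          have r: "0 \<le> r" "r < P" "e x j = P * (e x j div P) + r" unfolding r_def using P by auto
          define u where "u = k j - e x j div P"
          have "P * k j = P * (e x j div P) + P * u" unfolding u_def by (simp add: algebra_simps)
          then have "\<bar>r - P * u\<bar> \<le> 2 * P" using xk[OF j] r(3) by linarith
          then have a: "P * u < P * 3" "P * (- u) < P * 3" using r(1,2) by linarith+
          have "0 < P" using P by simp
          then have "u < 3" "- u < 3" using mult_less_cancel_left_pos[of P u 3] mult_less_cancel_left_pos[of P "- u" 3] a by blast+
          then show ?thesis unfolding u_def by simp
        qed
        then have "k \<in> S" unfolding S_def using kz(1) by (auto simp: PiE_def)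
        then show "B \<in> A ` (SIGMA k : S. Z k)" using kz Vz unfolding Z_def by blast
      qed
      moreover have "finite (SIGMA k : S. Z k)" using fS Z by auto
      moreover have "card (SIGMA k : S. Z k) \<le> 5 ^ d * M0"
      proof -
        have "card (SIGMA k : S. Z k) = (\<Sum>k\<in>S. card (Z k))" using fS Z by (intro card_SigmaI) auto
        also have "\<dots> \<le> (\<Sum>k\<in>S. M0)" using Z by (intro sum_mono) auto
        finally show ?thesis using cS by simp
      qed
      ultimately show "finite {A \<in> \<U>. x \<in> A}" "card {A \<in> \<U>. x \<in> A} \<le> 5 ^ d * M0"
        by (meson card_image_le card_mono finite_imageI finite_subset le_trans)+
      define k where "k = restrict (\<lambda>j. e x j div P) {..<d}"
      have k: "\<forall>j<d. \<bar>e x j - P * k j\<bar> \<le> P"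
      proof (intro allI impI)
        fix j assume "j < d"
        then have "e x j - P * k j = e x j mod P" unfolding k_def by (simp add: minus_mult_div_eq_mod)
        then show "\<bar>e x j - P * k j\<bar> \<le> P" using P pos_mod_bound[of P "e x j"] pos_mod_sign[of P "e x j"] by linarith
      qed
      then have "x \<in> X P k" using x P unfolding X_def by force
      then obtain z where z: "z \<in> N k" "V (?a k) z x \<in> NW 0" using N(3) by blast
      have zG: "z \<in> \<Gamma>" using z N(1) XG by blast
      have kI: "(k, z) \<in> I" unfolding I_def using z by (simp add: k_def)
      \<comment> \<open>x is within \<open>NW 0\<close> of a centre, and n steps add a displacement
        in \<open>NW 0\<close>. Their product costs \<open>cc\<close>, which explains the level
        \<open>cc\<close> in the definition of the members.\<close>
      show "\<exists>A\<in>\<U>. \<forall>z\<in>set_power (GL d K) (Bd s) n. x \<cdot> z \<in> A"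
      proof (rule bexI[of _ "A (k, z)"], intro ballI)
        fix g assume g: "g \<in> set_power (GL d K) (Bd s) n"
        have gG: "x \<cdot> g \<in> \<Gamma>" using GL.set_power_closed[OF BG] g x by auto
        note c = chain[OF x k g order_refl]
        have "\<bar>e (x \<cdot> g) j - P * k j\<bar> \<le> 2 * P" if j: "j < d" for j
          using c k j unfolding P_def by (smt (verit, best))
        then have "x \<cdot> g \<in> X P k" using gG by (simp add: X_def)
        moreover have "V (?a k) z x \<cdot> V (?a k) x (x \<cdot> g) \<in> NW (0 + cc)"
          by (rule NW_mult_small) (use z c in auto)
        ultimately show "x \<cdot> g \<in> A (k, z)" using V_mult[OF \<alpha>_nz zG x gG] by (simp add: A_def)
      qed (use kI \<U>_def in blast)
    next
      fix B x y assume B: "B \<in> \<U>" "x \<in> B" "y \<in> B"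
      then obtain k z where kz: "k \<in> {..<d} \<rightarrow>\<^sub>E UNIV" "z \<in> N k" "x \<in> A (k, z)" "y \<in> A (k, z)"
        unfolding \<U>_def I_def by auto
      have XX: "x \<in> X P k" "y \<in> X P k" "V (?a k) z x \<in> NW cc" "V (?a k) z y \<in> NW cc"
        using kz(3,4) by (auto simp: A_def)
      have G: "x \<in> \<Gamma>" "y \<in> \<Gamma>" "z \<in> \<Gamma>" using XX kz(2) N(1) XG by blast+
      have "ginv (V (?a k) z x) \<cdot> V (?a k) z y \<in> NW (cc + cc + cc)"
        by (rule NW_mult[OF NW_inv]) (use XX cc in auto)
      then have w: "V (?a k) x y \<in> NW (3 * cc)"
        using V_inv[OF \<alpha>_nz G(3,1)] V_mult[OF \<alpha>_nz G(1,3,2)] by simp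
      have wB: "V (?a k) x y \<in> Bd q" using NW_Bd[OF w] cc Bd_mono[OF q(3)] by auto
      have lev: "dg (\<lambda>j. inv (f u j) \<otimes> ?a k j) \<in> set_power (GL d K) (Bd q) (Suc (h * n))"
         "nz (\<lambda>j. inv (f u j) \<otimes> ?a k j)"
         if u: "u \<in> X P k" for u
      proof -
        have uG: "u \<in> \<Gamma>" using u XG by blast
        let ?b = "\<lambda>j. inv (f u j) \<otimes> ?a k j"
        show nzb: "nz ?b" using f_nz[OF uG] nz_inv[OF f_nz[OF uG]] \<alpha>_nz[of P Q k] integral unfolding nz_def by (metis m_closed)
        have "?b j \<in> L (int (h * n)) \<and> inv (?b j) \<in> L (int (h * n))" if j: "j < d" for j
        proof -
          have ib: "inv (?b j) = f u j \<otimes> inv (?a k j)"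
          proof -
            have "f u j \<in> Units K" using field_Units f_nz[OF uG] j by (simp add: nz_def)
            then show ?thesis
              using inv_mult_nonzero[of "inv (f u j)" "?a k j"] nz_inv[OF f_nz[OF uG]] \<alpha>_nz[of P Q k] j
              by (simp add: nz_def)
          qed
          have a: "?a k j \<in> L (P * k j - Q * int j)" "inv (?a k j) \<in> L (- (P * k j - Q * int j))"
            using \<gamma> by (simp_all only: \<alpha>_def)
          have 1: "?b j \<in> L ((c + 1 - e u j) + (P * k j - Q * int j) + c)"
            using f_level[OF uG j] a by (intro L_mult) auto
          have 2: "inv (?b j) \<in> L (e u j + - (P * k j - Q * int j) + c)"
            unfolding ib using f_level[OF uG j] a by (intro L_mult) auto
          have 3: "\<bar>e u j - P * k j\<bar> \<le> 2 * P" using u j by (simp add: X_def)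
          have 4: "0 \<le> Q * int j" "Q * int j \<le> Q * int d" using Q j by (auto intro!: mult_left_mono)
          have 5: "2 * c + 1 \<le> (2 * c + 1) * int n" using nn c_nonneg mult_left_mono[of 1 "int n" "2 * c + 1"] by simp
          have 6: "int (h * n) = 2 * P + Q * int d + (2 * c + 1) * int n"
            unfolding P_def Q_def by (simp add: h algebra_simps)
          have 7: "e u j - P * k j \<le> 2 * P" "P * k j - e u j \<le> 2 * P" using 3 by (simp_all add: abs_le_iff)
          have "(c + 1 - e u j) + (P * k j - Q * int j) + c \<le> int (h * n)"
            unfolding 6 using 4 5 7 c_nonneg by linarith
          moreover have "e u j + - (P * k j - Q * int j) + c \<le> int (h * n)"
            unfolding 6 using 4 5 7 c_nonneg by linarith
          ultimately show ?thesis using L_up[OF 1] L_up[OF 2] by blast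
        qed
        then have "dg ?b \<in> set_power (GL d K) (Bd q0) (Suc (h * n))" by (intro q0(2)[OF nzb]) blast
        then show "dg ?b \<in> set_power (GL d K) (Bd q) (Suc (h * n))"
          using GL.set_power_subset[OF Bd_mono[OF q(1)]] by blast
      qed
      have BqG: "Bd q \<subseteq> \<Gamma>" using Bd_\<Gamma> by blast
      let ?S = "set_power (GL d K) (Bd q)"
      have one: "b \<in> ?S 1" if "b \<in> Bd q" for b
        using GL.set_power_SucI[of "\<one>\<^bsub>GL d K\<^esub>" "Bd q" 0 b] that Bd_\<Gamma>[OF that] by simp
      have inv_pow: "ginv g \<in> ?S m" if "g \<in> ?S m" for g m
        using that
      proof (induction m arbitrary: g)
        case 0 then show ?case by simp
      next
        case (Suc m)
        obtain v b where vb: "v \<in> ?S m" "b \<in> Bd q" "g = v \<cdot> b" using GL.set_power_SucE[OF Suc.prems] by blast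
        have vG: "v \<in> \<Gamma>" using GL.set_power_closed[OF BqG] vb(1) by blast
        have "ginv b \<cdot> ginv v \<in> ?S (1 + m)" by (intro GL.set_power_mult[OF BqG] one Bd_inv vb Suc.IH)
        then show ?case using vb Bd_\<Gamma>[OF vb(2)] vG by (simp add: GL.inv_mult_group)
      qed
      let ?b = "\<lambda>u j. inv (f u j) \<otimes> ?a k j"
      have dgb: "dg (?b u) = ginv (dg (f u)) \<cdot> dg (?a k)" if u: "u \<in> \<Gamma>" for u
      proof (rule mat_eqI[of _ d])
        note nzi = nz_inv[OF f_nz[OF u]]
        have cl: "\<forall>j<d. inv (f u j) \<otimes> ?a k j \<in> carrier K"
          using nz_closed(1)[OF nzi] nz_closed(1)[OF \<alpha>_nz[of P Q k]] by simp
        show "dg (?b u) \<in> Mat" by (rule dg_Mat[OF cl])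
        show "ginv (dg (f u)) \<cdot> dg (?a k) \<in> Mat"
          using dg_GL[OF \<alpha>_nz[of P Q k]] dg_\<Gamma>[OF u] by (intro GL_carrier_mat) simp
        fix i j assume ij: "i < d" "j < d"
        show "dg (?b u) (i, j) = (ginv (dg (f u)) \<cdot> dg (?a k)) (i, j)"
          unfolding dg_GL(2)[OF f_nz[OF u]]
            dg_mult_left[OF nz_closed(2)[OF nzi] dg_Mat[OF nz_closed(2)[OF \<alpha>_nz[of P Q k]]] ij]
          using ij nz_closed(1)[OF nzi] by (simp add: dg_entry)
      qed
      note GG = dg_GL(1)[OF \<alpha>_nz[of P Q k]] dg_\<Gamma>[OF G(1)] dg_\<Gamma>[OF G(2)] UU_\<Gamma>[OF U_UU[OF G(1)]]
        UU_\<Gamma>[OF U_UU[OF G(2)]] Bd_\<Gamma>[OF \<kappa>_Bd[OF G(1)]] Bd_\<Gamma>[OF \<kappa>_Bd[OF G(2)]]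
      have cn: "g \<cdot> (ginv g \<cdot> g') = g'" "ginv g \<cdot> (g \<cdot> g') = g'" if "g \<in> \<Gamma>" "g' \<in> \<Gamma>" for g g'
        using that GL.m_assoc[of g "ginv g" g'] GL.m_assoc[of "ginv g" g g'] by simp_all
      \<comment> \<open>The quotient as a word: from x down to its diagonal part, over to the frame
        of the cube, along the displacement there, and back to y in the same way.\<close>
      have eq: "ginv (\<kappa> x) \<cdot> dg (?b x) \<cdot> V (?a k) x y \<cdot> ginv (dg (?b y)) \<cdot> \<kappa> y = ginv x \<cdot> y"
      proof -
        have "ginv (dg (f x)) \<cdot> (ginv (U x) \<cdot> U y) \<cdot> dg (f y) = dg (?b x) \<cdot> V (?a k) x y \<cdot> ginv (dg (?b y))"
          unfolding dgb[OF G(1)] dgb[OF G(2)] V_def using GG by (simp add: GL.m_assoc GL.inv_mult_group cn)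
        then have "dg (?b x) \<cdot> V (?a k) x y \<cdot> ginv (dg (?b y)) = \<kappa> x \<cdot> (ginv x \<cdot> y) \<cdot> ginv (\<kappa> y)"
          using triangular_part[OF G(1,2)] by simp
        moreover have "dg (?b x) \<in> \<Gamma>" "dg (?b y) \<in> \<Gamma>" "V (?a k) x y \<in> \<Gamma>"
          using GG dgb G wB Bd_\<Gamma> by simp_all
        ultimately have "ginv (\<kappa> x) \<cdot> dg (?b x) \<cdot> V (?a k) x y \<cdot> ginv (dg (?b y)) \<cdot> \<kappa> y
            = ginv (\<kappa> x) \<cdot> (\<kappa> x \<cdot> (ginv x \<cdot> y) \<cdot> ginv (\<kappa> y)) \<cdot> \<kappa> y"
          using GG by (simp add: GL.m_assoc)
        then show ?thesis using GG G by (simp add: GL.m_assoc cn)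
      qed
      have "ginv (\<kappa> x) \<cdot> dg (?b x) \<cdot> V (?a k) x y \<cdot> ginv (dg (?b y)) \<cdot> \<kappa> y \<in> ?S (1 + Suc (h * n) + 1 + Suc (h * n) + 1)"
        by (intro GL.set_power_mult[OF BqG] one inv_pow lev XX wB Bd_inv)
           (use \<kappa>_Bd G Bd_mono[OF q(2)] in blast)+
      moreover have "1 + Suc (h * n) + 1 + Suc (h * n) + 1 \<le> p * n"
        using n unfolding p_def by (simp add: algebra_simps)
      ultimately show "ginv x \<cdot> y \<in> ?S (p * n)"
        unfolding eq using GL.set_power_mono[OF BqG Bd_one[OF q(4)]] by blast
    qed
  qed
qed

end

theorem (in filtered_GL) coarse_cover_GL:
  "\<exists>M p q. 0 \<le> q \<and> (\<forall>n\<ge>1. \<exists>\<U>. (\<forall>A\<in>\<U>. A \<subseteq> \<Gamma>) \<and>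
     (\<forall>x\<in>\<Gamma>. finite {A\<in>\<U>. x \<in> A} \<and> card {A\<in>\<U>. x \<in> A} \<le> M) \<and>
     (\<forall>x\<in>\<Gamma>. \<exists>A\<in>\<U>. \<forall>z\<in>set_power (GL d K) (Bd s) n. x \<cdot> z \<in> A) \<and>
     (\<forall>A\<in>\<U>. \<forall>x\<in>A. \<forall>y\<in>A. ginv x \<cdot> y \<in> set_power (GL d K) (Bd q) (p * n)))"
proof -
  obtain C where C: "\<forall>x\<in>\<Gamma>. \<exists>u f \<kappa>. u \<in> UU \<and> nz f \<and> \<kappa> \<in> Bd C \<and> x = u \<cdot> dg f \<cdot> \<kappa>"
    using triangular_decomposition by blast
  then obtain U f \<kappa> where D: "\<And>x. x \<in> \<Gamma> \<Longrightarrow> U x \<in> UU \<and> nz (f x) \<and> \<kappa> x \<in> Bd C \<and> x = U x \<cdot> dg (f x) \<cdot> \<kappa> x"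
    by metis
  have "\<exists>l. x \<in> \<Gamma> \<longrightarrow> j < d \<longrightarrow> f x j \<in> L l \<and> inv (f x j) \<in> L (c + 1 - l)" for x j
    using level_exists[of "f x j"] D[of x] unfolding nz_def by blast
  then obtain e where e: "\<And>x j. x \<in> \<Gamma> \<Longrightarrow> j < d \<Longrightarrow> f x j \<in> L (e x j) \<and> inv (f x j) \<in> L (c + 1 - e x j)"
    by metis
  obtain k1 where k1: "k1 \<ge> 0" "\<And>n. \<one> \<in> L n \<Longrightarrow> - k1 \<le> n" using one_not_small by blast
  obtain \<gamma> where \<gamma>: "\<And>k. \<gamma> k \<in> carrier K \<and> \<gamma> k \<noteq> \<zero> \<and> \<gamma> k \<in> L k \<and> inv (\<gamma> k) \<in> L (- k)"
    using element_of_level by metis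
  interpret D: decomposed_GL K L c \<pi> d U f \<kappa> e "max 0 C" k1 \<gamma>
  proof unfold_locales
    show "\<kappa> x \<in> Bd (max 0 C)" if "x \<in> \<Gamma>" for x using D[OF that] Bd_mono[of C "max 0 C"] by auto
    show "x = U x \<cdot> dg (f x) \<cdot> \<kappa> x" if "x \<in> \<Gamma>" for x using D[OF that] by blast
  qed (use D e k1 \<gamma> in auto)
  show ?thesis by (rule D.coarse_cover)
qed

section \<open>Groups with an admissible metric\<close>

lemma (in group) generate_set_power:
  assumes S: "S \<subseteq> carrier G" "\<And>s. s \<in> S \<Longrightarrow> inv s \<in> S" and g: "g \<in> generate G S"
  shows "\<exists>n. g \<in> set_power G S n"
  using g
proof (induction rule: generate.induct)
  case one then show ?case by (intro exI[of _ 0]) simp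
next
  case (incl h)
  have "\<one> \<otimes> h \<in> set_power G S (Suc 0)" by (intro set_power_SucI incl) simp
  then show ?case using l_one[of h] subsetD[OF S(1) incl] by metis
next
  case (inv h)
  have "\<one> \<otimes> inv h \<in> set_power G S (Suc 0)" by (intro set_power_SucI S(2) inv) simp
  then show ?case using l_one[of "inv h"] inv_closed[OF subsetD[OF S(1) inv]] by metis
next
  case (eng h1 h2)
  then show ?case using set_power_mult[OF S(1)] by blast
qed

locale admissible_group = group G for G (structure) +
  fixes T S and d :: "'a \<Rightarrow> 'a \<Rightarrow> real"
  assumes csg: "compact_symmetric_generating G T S"
    and adm: "admissible_metric G T S d"
begin

sublocale Metric_space "carrier G" d
  using adm by (simp add: admissible_metric_def)

lemma mtop: "mtopology = T"
  using adm by (simp add: admissible_metric_def)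

lemma top_T: "topspace T = carrier G"
  using mtop topspace_mtopology by simp

lemma compact_cball: "x \<in> carrier G \<Longrightarrow> compactin T (mcball x r)"
  using adm by (simp add: admissible_metric_def)

lemma left_inv: "g \<in> carrier G \<Longrightarrow> x \<in> carrier G \<Longrightarrow> y \<in> carrier G \<Longrightarrow> d (g \<otimes> x) (g \<otimes> y) = d x y"
  using adm by (simp add: admissible_metric_def)

lemma S_carrier: "S \<subseteq> carrier G"
  using csg compactin_subset_topspace[of T S] top_T by (simp add: compact_symmetric_generating_def)

lemma d_one: "x \<in> carrier G \<Longrightarrow> y \<in> carrier G \<Longrightarrow> d x y = d \<one> (inv x \<otimes> y)"
  using left_inv[of "inv x" x y] by simp

lemma d_one_inv: "x \<in> carrier G \<Longrightarrow> d \<one> (inv x) = d \<one> x"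
  using left_inv[of x \<one> "inv x"] by (simp add: commute)

lemma d_one_mult: "x \<in> carrier G \<Longrightarrow> y \<in> carrier G \<Longrightarrow> d \<one> (x \<otimes> y) \<le> d \<one> x + d \<one> y"
  using triangle[of \<one> x "x \<otimes> y"] left_inv[of x \<one> y] by simp

lemma d_right: "x \<in> carrier G \<Longrightarrow> s \<in> carrier G \<Longrightarrow> d x (x \<otimes> s) = d \<one> s"
  using left_inv[of x \<one> s] by simp

lemma compact_bounded:
  assumes "compactin T C"
  shows "\<exists>r>0. \<forall>x\<in>C. d \<one> x \<le> r"
proof -
  have "mbounded C" using compactin_imp_mbounded assms mtop by simp
  then obtain a B where C: "C \<subseteq> mcball a B" unfolding mbounded_def by blast
  have "d \<one> x \<le> d \<one> a + B" if "x \<in> C" for x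
  proof -
    have "x \<in> mcball a B" using C that by blast
    then show ?thesis using triangle[of \<one> a x] by auto
  qed
  then show ?thesis by (intro exI[of _ "max 1 (d \<one> a + B)"]) fastforce
qed

lemma S_bounded: "\<exists>r>0. \<forall>x\<in>S. d \<one> x \<le> r"
  using compact_bounded csg by (simp add: compact_symmetric_generating_def)

lemma word_exists: "g \<in> carrier G \<Longrightarrow> g \<in> set_power G S (word_length G S g)"
proof -
  assume g: "g \<in> carrier G"
  have "\<exists>n. g \<in> set_power G S n"
    by (rule generate_set_power[OF S_carrier]) (use csg g in \<open>auto simp: compact_symmetric_generating_def\<close>)
  then show ?thesis unfolding word_length_def by (rule LeastI_ex)
qed

text \<open>The additive constant of the quasi-isometry is absorbed into k because n \<ge> 1. The
  length is only bounded by k * n, since \<open>\<one>\<close> may be missing from S and words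
  cannot then be padded.\<close>

lemma ball_word: "\<exists>k::nat. \<forall>n\<ge>1. \<forall>x\<in>carrier G. \<forall>y\<in>carrier G. d x y \<le> real n \<longrightarrow>
    (\<exists>m\<le>k * n. inv x \<otimes> y \<in> set_power G S m)"
proof -
  obtain A B where AB: "1 \<le> A" "0 \<le> B"
    "\<And>x y. x \<in> carrier G \<Longrightarrow> y \<in> carrier G \<Longrightarrow> word_metric G S x y / A - B \<le> d x y"
    using adm unfolding admissible_metric_def quasi_isometric_metrics_def by metis
  define k where "k = nat \<lceil>A * (1 + B)\<rceil>"
  have k: "A * (1 + B) \<le> real k" unfolding k_def by linarith
  show ?thesis
  proof (rule exI[of _ k], intro allI ballI impI)
    fix n :: nat and x y assume n: "1 \<le> n" and xy: "x \<in> carrier G" "y \<in> carrier G" "d x y \<le> real n"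
    have "word_metric G S x y \<le> A * (real n + B)"
      using AB(3)[OF xy(1,2)] AB(1) xy(3) by (simp add: field_simps) (smt (verit) mult_left_mono)
    also have "\<dots> \<le> A * (real n * (1 + B))"
      using AB n mult_left_mono[of 1 "real n" B] by (intro mult_left_mono) (auto simp: algebra_simps)
    also have "\<dots> = (A * (1 + B)) * real n" by simp
    also have "\<dots> \<le> real k * real n" using k by (intro mult_right_mono) auto
    finally have "word_length G S (inv x \<otimes> y) \<le> k * n"
      unfolding word_metric_def by (metis of_nat_le_iff of_nat_mult)
    then show "\<exists>m\<le>k * n. inv x \<otimes> y \<in> set_power G S m" using word_exists xy by blast
  qed
qed

lemma set_power_dist:
  assumes B: "B \<subseteq> carrier G" "\<And>b. b \<in> B \<Longrightarrow> d \<one> b \<le> r"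
  shows "g \<in> set_power G B m \<Longrightarrow> d \<one> g \<le> r * real m"
proof (induction m arbitrary: g)
  case 0 then show ?case by simp
next
  case (Suc m)
  obtain y b where yb: "y \<in> set_power G B m" "b \<in> B" "g = y \<otimes> b" using set_power_SucE[OF Suc.prems] by blast
  have "d \<one> g \<le> d \<one> y + d \<one> b"
    unfolding yb(3) using set_power_closed[OF B(1)] yb B(1) by (intro d_one_mult) blast+
  then show ?case using Suc.IH[OF yb(1)] B(2)[OF yb(2)] by (simp add: algebra_simps)
qed

lemma mball_translate:
  assumes "g \<in> carrier G" "c \<in> carrier G" "y \<in> carrier G"
  shows "g \<otimes> y \<in> mball (g \<otimes> c) r \<longleftrightarrow> y \<in> mball c r"
  using assms left_inv[of g c y] by (simp add: in_mball)

lemma cball_cover: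
  assumes "r > 0"
  shows "\<exists>F. finite F \<and> F \<subseteq> carrier G \<and> mcball \<one> R \<subseteq> (\<Union>c\<in>F. mball c r)"
proof -
  have "openin T U" if "U \<in> (\<lambda>c. mball c r) ` carrier G" for U
    using that openin_mball mtop by auto
  moreover have "mcball \<one> R \<subseteq> \<Union> ((\<lambda>c. mball c r) ` carrier G)"
    using assms centre_in_mball_iff mcball_subset_mspace by fastforce
  ultimately obtain \<F> where F: "finite \<F>" "\<F> \<subseteq> (\<lambda>c. mball c r) ` carrier G" "mcball \<one> R \<subseteq> \<Union> \<F>"
    using compactinD[OF compact_cball[OF one_closed, of R], of "(\<lambda>c. mball c r) ` carrier G"] by metis
  obtain F where "finite F" "F \<subseteq> carrier G" "\<F> = (\<lambda>c. mball c r) ` F" using finite_subset_image[OF F(1,2)] by blast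
  then show ?thesis using F(3) by blast
qed

text \<open>One more letter moves a point by at most \<sigma>, and the ball of radius r + \<sigma>
  is covered by finitely many balls of radius r; left invariance makes their number the same
  everywhere, so each letter multiplies the count by \<open>card F0\<close>.\<close>

lemma word_ball_cover:
  assumes r: "r > 0"
  shows "\<exists>N. \<forall>m. \<forall>x\<in>carrier G. \<exists>F\<subseteq>carrier G. finite F \<and> card F \<le> N ^ m \<and>
    (\<forall>z\<in>set_power G S m. x \<otimes> z \<in> (\<Union>c\<in>F. mball c r))"
proof -
  obtain \<sigma> where \<sigma>: "\<sigma> > 0" "\<And>s. s \<in> S \<Longrightarrow> d \<one> s \<le> \<sigma>" using S_bounded by blast
  from cball_cover[OF r, of "r + \<sigma>"] obtain F0
    where "finite F0 \<and> F0 \<subseteq> carrier G \<and> mcball \<one> (r + \<sigma>) \<subseteq> (\<Union>c\<in>F0. mball c r)" ..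
  then have F0: "finite F0" "F0 \<subseteq> carrier G" "mcball \<one> (r + \<sigma>) \<subseteq> (\<Union>c\<in>F0. mball c r)" by simp_all
  show ?thesis
  proof (rule exI[of _ "card F0"], intro allI ballI)
    fix m x assume x: "x \<in> carrier G"
    show "\<exists>F\<subseteq>carrier G. finite F \<and> card F \<le> card F0 ^ m \<and>
      (\<forall>z\<in>set_power G S m. x \<otimes> z \<in> (\<Union>c\<in>F. mball c r))"
    proof (induction m)
      case 0
      show ?case using x r by (intro exI[of _ "{x}"]) auto
    next
      case (Suc m)
      then obtain F where F: "F \<subseteq> carrier G" "finite F" "card F \<le> card F0 ^ m"
        "\<forall>z\<in>set_power G S m. x \<otimes> z \<in> (\<Union>c\<in>F. mball c r)" by blast
      let ?F = "(\<lambda>(a, b). a \<otimes> b) ` (F \<times> F0)"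
      have "card ?F \<le> card (F \<times> F0)" using F F0 by (intro card_image_le) auto
      also have "\<dots> = card F * card F0" by (rule card_cartesian_product)
      also have "\<dots> \<le> card F0 ^ Suc m" using F(3) by simp
      finally have c: "card ?F \<le> card F0 ^ Suc m" .
      have "x \<otimes> z \<in> (\<Union>c\<in>?F. mball c r)" if z: "z \<in> set_power G S (Suc m)" for z
      proof -
        obtain y s where ys: "y \<in> set_power G S m" "s \<in> S" "z = y \<otimes> s" using set_power_SucE[OF z] by blast
        have yc: "y \<in> carrier G" "s \<in> carrier G" using ys set_power_closed[OF S_carrier] S_carrier by blast+
        obtain a where a: "a \<in> F" "x \<otimes> y \<in> mball a r" using F(4) ys(1) by blast
        have ac: "a \<in> carrier G" using a F(1) by blast
        have zc: "x \<otimes> z \<in> carrier G" using x ys(3) yc by simp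
        have "d a (x \<otimes> z) \<le> d a (x \<otimes> y) + d (x \<otimes> y) (x \<otimes> z)"
          using triangle ac x yc zc by simp
        also have "d (x \<otimes> y) (x \<otimes> z) = d \<one> s"
          using d_right[of "x \<otimes> y" s] x yc ys(3) by (simp add: m_assoc)
        finally have "d a (x \<otimes> z) \<le> r + \<sigma>" using a(2) \<sigma>(2)[OF ys(2)] by auto
        then have "inv a \<otimes> (x \<otimes> z) \<in> mcball \<one> (r + \<sigma>)" using d_one[OF ac zc] ac zc by simp
        then obtain b where b: "b \<in> F0" "inv a \<otimes> (x \<otimes> z) \<in> mball b r" using F0(3) by blast
        have "a \<otimes> (inv a \<otimes> (x \<otimes> z)) \<in> mball (a \<otimes> b) r"
          using mball_translate[of a b "inv a \<otimes> (x \<otimes> z)"] b F0(2) ac zc by auto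
        moreover have "a \<otimes> (inv a \<otimes> (x \<otimes> z)) = x \<otimes> z" using ac zc m_assoc[of a "inv a" "x \<otimes> z"] by simp
        ultimately show ?thesis using a(1) b(1) by force
      qed
      moreover have "?F \<subseteq> carrier G" using F(1) F0(2) by auto
      ultimately show ?case using c F(2) F0(1) by (intro exI[of _ ?F]) auto
    qed
  qed
qed

text \<open>Words of all lengths up to k * n are collected. Since N1 \<ge> 2, the geometric series
  of their bounds is at most twice its last term.\<close>

lemma ball_cover_exponential:
  assumes r: "r > 0"
  shows "\<exists>N\<ge>1. \<forall>n\<ge>1. \<forall>x\<in>carrier G. \<exists>F\<subseteq>carrier G. finite F \<and> card F \<le> N ^ n \<and>
    {y \<in> carrier G. d x y \<le> real n} \<subseteq> (\<Union>c\<in>F. mball c r)"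
proof -
  obtain N where N: "\<And>m x. x \<in> carrier G \<Longrightarrow> \<exists>F\<subseteq>carrier G. finite F \<and> card F \<le> N ^ m \<and>
    (\<forall>z\<in>set_power G S m. x \<otimes> z \<in> (\<Union>c\<in>F. mball c r))" using word_ball_cover[OF r] by blast
  obtain k where k: "\<And>n x y. 1 \<le> n \<Longrightarrow> x \<in> carrier G \<Longrightarrow> y \<in> carrier G \<Longrightarrow> d x y \<le> real n \<Longrightarrow>
    \<exists>m\<le>k * n. inv x \<otimes> y \<in> set_power G S m" using ball_word by blast
  define N1 where "N1 = max 2 N"
  define M where "M = 2 * N1 ^ k"
  show ?thesis
  proof (rule exI[of _ M], intro conjI allI ballI impI)
    have N1: "1 \<le> N1 ^ j" for j unfolding N1_def by simp
    then show "1 \<le> M" unfolding M_def using N1[of k] by linarith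
    fix n :: nat and x assume n: "1 \<le> n" and x: "x \<in> carrier G"
    obtain F where F: "\<And>m. F m \<subseteq> carrier G \<and> finite (F m) \<and> card (F m) \<le> N ^ m \<and>
      (\<forall>z\<in>set_power G S m. x \<otimes> z \<in> (\<Union>c\<in>F m. mball c r))" using N[OF x] by metis
    let ?F = "\<Union>m\<in>{..k * n}. F m"
    have "card ?F \<le> (\<Sum>m\<in>{..k * n}. card (F m))" by (rule card_UN_le) simp
    also have "\<dots> \<le> (\<Sum>m\<in>{..k * n}. N1 ^ m)"
    proof (rule sum_mono)
      fix m
      have "card (F m) \<le> N ^ m" using F by blast
      also have "\<dots> \<le> N1 ^ m" unfolding N1_def by (intro power_mono) auto
      finally show "card (F m) \<le> N1 ^ m" .
    qed
    also have "\<dots> \<le> 2 * N1 ^ (k * n)"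
    proof -
      have "(\<Sum>m\<le>j. N1 ^ m) \<le> 2 * N1 ^ j" for j
      proof (induction j)
        case (Suc j)
        have "2 \<le> N1" unfolding N1_def by simp
        then have "2 * N1 ^ j \<le> N1 ^ Suc j" by (simp add: mult_right_mono)
        then show ?case using Suc unfolding sum.atMost_Suc by linarith
      qed simp
      then show ?thesis .
    qed
    also have "\<dots> \<le> M ^ n"
    proof -
      have "2 * N1 ^ (k * n) \<le> 2 ^ n * (N1 ^ k) ^ n"
        using n self_le_power[of "2::nat" n] by (simp add: power_mult)
      then show ?thesis unfolding M_def by (simp add: power_mult_distrib)
    qed
    finally have "card ?F \<le> M ^ n" .
    moreover have "{y \<in> carrier G. d x y \<le> real n} \<subseteq> (\<Union>c\<in>?F. mball c r)"
    proof
      fix y assume y: "y \<in> {y \<in> carrier G. d x y \<le> real n}"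
      then obtain m where m: "m \<le> k * n" "inv x \<otimes> y \<in> set_power G S m" using k[OF n x] by blast
      have "x \<otimes> (inv x \<otimes> y) = y" using x y m_assoc[of x "inv x" y] by simp
      then have "y \<in> (\<Union>c\<in>F m. mball c r)" using F m(2) by metis
      then show "y \<in> (\<Union>c\<in>?F. mball c r)" using m(1) by blast
    qed
    ultimately show "\<exists>F\<subseteq>carrier G. finite F \<and> card F \<le> M ^ n \<and> {y \<in> carrier G. d x y \<le> real n} \<subseteq> (\<Union>c\<in>F. mball c r)"
      using F by (intro exI[of _ ?F]) auto
  qed
qed

end

text \<open>Finite asymptotic Assouad--Nagata dimension, in terms of covers with large Lebesgue number.\<close>

definition finite_asdim_AN :: "'a set \<Rightarrow> ('a \<Rightarrow> 'a \<Rightarrow> real) \<Rightarrow> bool" where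
  "finite_asdim_AN X d \<longleftrightarrow> (\<exists>(M :: nat) (C :: nat). \<forall>n\<ge>1. \<exists>\<U>.
     (\<forall>A\<in>\<U>. A \<subseteq> X) \<and> (\<forall>x\<in>X. finite {A\<in>\<U>. x \<in> A} \<and> card {A\<in>\<U>. x \<in> A} \<le> M) \<and>
     (\<forall>x\<in>X. \<exists>A\<in>\<U>. \<forall>y\<in>X. d x y \<le> real n \<longrightarrow> y \<in> A) \<and>
     (\<forall>A\<in>\<U>. \<forall>x\<in>A. \<forall>y\<in>A. d x y \<le> real (C * n)))"

section \<open>The general linear group of a product of local fields\<close>

lemma product_ring_simps:
  "carrier (product_ring I K) = (\<Pi>\<^sub>E i\<in>I. carrier (K i))"
  "x \<otimes>\<^bsub>product_ring I K\<^esub> y = (\<lambda>i\<in>I. x i \<otimes>\<^bsub>K i\<^esub> y i)"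
  "\<one>\<^bsub>product_ring I K\<^esub> = (\<lambda>i\<in>I. \<one>\<^bsub>K i\<^esub>)"
  "\<zero>\<^bsub>product_ring I K\<^esub> = (\<lambda>i\<in>I. \<zero>\<^bsub>K i\<^esub>)"
  "x \<oplus>\<^bsub>product_ring I K\<^esub> y = (\<lambda>i\<in>I. x i \<oplus>\<^bsub>K i\<^esub> y i)"
  by (simp_all add: product_ring_def)

lemma product_ring_app: "x \<in> (\<Pi>\<^sub>E i\<in>I. carrier (K i)) \<Longrightarrow> i \<in> I \<Longrightarrow> x i \<in> carrier (K i)"
  by (rule PiE_mem)

lemma product_ring_ring:
  assumes K: "\<And>i. i \<in> I \<Longrightarrow> ring (K i)"
  shows "ring (product_ring I K)"
proof (rule ringI)
  have m: "x i \<in> carrier (K i)" if "x \<in> (\<Pi>\<^sub>E i\<in>I. carrier (K i))" "i \<in> I" for x i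
    using that by (rule PiE_mem)
  show "abelian_group (product_ring I K)"
  proof (rule abelian_groupI; (unfold product_ring_simps)?)
    fix x assume x: "x \<in> (\<Pi>\<^sub>E i\<in>I. carrier (K i))"
    have xi: "x i \<in> carrier (K i)" if "i \<in> I" for i using x that by (rule PiE_mem)
    show "\<exists>y\<in>(\<Pi>\<^sub>E i\<in>I. carrier (K i)). (\<lambda>i\<in>I. y i \<oplus>\<^bsub>K i\<^esub> x i) = (\<lambda>i\<in>I. \<zero>\<^bsub>K i\<^esub>)"
      by (rule bexI[of _ "\<lambda>i\<in>I. \<ominus>\<^bsub>K i\<^esub> x i"])
         (use xi K in \<open>auto intro!: restrict_ext ring.ring_simprules(9) ring.ring_simprules(3)\<close>)
    show "(\<lambda>i\<in>I. (\<lambda>i\<in>I. \<zero>\<^bsub>K i\<^esub>) i \<oplus>\<^bsub>K i\<^esub> x i) = x"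
      by (rule extensionalityI[of _ I]) (use x K in \<open>auto simp: PiE_def ring.ring_simprules(8) Pi_iff\<close>)
  qed (use K in \<open>auto intro!: restrict_ext simp: m ring.ring_simprules(1,2,7,10,22)\<close>)
  show "monoid (product_ring I K)"
  proof (rule monoidI; (unfold product_ring_simps)?)
    fix x assume x: "x \<in> (\<Pi>\<^sub>E i\<in>I. carrier (K i))"
    show "(\<lambda>i\<in>I. (\<lambda>i\<in>I. \<one>\<^bsub>K i\<^esub>) i \<otimes>\<^bsub>K i\<^esub> x i) = x"
      by (rule extensionalityI[of _ I]) (use x K in \<open>auto simp: PiE_def ring.ring_simprules(12) Pi_iff\<close>)
    show "(\<lambda>i\<in>I. x i \<otimes>\<^bsub>K i\<^esub> (\<lambda>i\<in>I. \<one>\<^bsub>K i\<^esub>) i) = x"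
      by (rule extensionalityI[of _ I]) (use x K in \<open>auto simp: PiE_def monoid.r_one[OF ring.is_monoid] Pi_iff\<close>)
  qed (use K in \<open>auto intro!: restrict_ext simp: m ring.ring_simprules(5,6,11)\<close>)
  show "(x \<oplus>\<^bsub>product_ring I K\<^esub> y) \<otimes>\<^bsub>product_ring I K\<^esub> z =
      x \<otimes>\<^bsub>product_ring I K\<^esub> z \<oplus>\<^bsub>product_ring I K\<^esub> y \<otimes>\<^bsub>product_ring I K\<^esub> z"
    if "x \<in> carrier (product_ring I K)" "y \<in> carrier (product_ring I K)" "z \<in> carrier (product_ring I K)" for x y z
    using that K unfolding product_ring_simps by (auto intro!: restrict_ext simp: m ring.ring_simprules(13))
  show "z \<otimes>\<^bsub>product_ring I K\<^esub> (x \<oplus>\<^bsub>product_ring I K\<^esub> y) =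
      z \<otimes>\<^bsub>product_ring I K\<^esub> x \<oplus>\<^bsub>product_ring I K\<^esub> z \<otimes>\<^bsub>product_ring I K\<^esub> y"
    if "x \<in> carrier (product_ring I K)" "y \<in> carrier (product_ring I K)" "z \<in> carrier (product_ring I K)" for x y z
    using that K unfolding product_ring_simps by (auto intro!: restrict_ext simp: m ring.ring_simprules(23))
qed

lemma product_ring_finsum:
  assumes K: "\<And>i. i \<in> I \<Longrightarrow> ring (K i)" and i: "i \<in> I" and A: "finite A"
    and f: "\<And>l. l \<in> A \<Longrightarrow> f l \<in> carrier (product_ring I K)"
  shows "(\<Oplus>\<^bsub>product_ring I K\<^esub>l\<in>A. f l) i = (\<Oplus>\<^bsub>K i\<^esub>l\<in>A. f l i)"
  using A f
proof (induction A rule: finite_induct)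
  interpret R: ring "product_ring I K" by (rule product_ring_ring[OF K])
  interpret Ki: ring "K i" by (rule K[OF i])
  case empty then show ?case using i by (simp add: product_ring_simps)
next
  interpret R: ring "product_ring I K" by (rule product_ring_ring[OF K])
  interpret Ki: ring "K i" by (rule K[OF i])
  case (insert a A)
  have 1: "f \<in> A \<rightarrow> carrier (product_ring I K)" "f a \<in> carrier (product_ring I K)" using insert by auto
  have 2: "(\<lambda>l. f l i) \<in> A \<rightarrow> carrier (K i)" "f a i \<in> carrier (K i)"
    using 1 i by (auto simp: product_ring_simps Pi_iff PiE_mem)
  have "(\<Oplus>\<^bsub>product_ring I K\<^esub>l\<in>insert a A. f l) i = (f a \<oplus>\<^bsub>product_ring I K\<^esub> (\<Oplus>\<^bsub>product_ring I K\<^esub>l\<in>A. f l)) i"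
    using R.finsum_insert[OF insert(1,2) 1] by simp
  also have "\<dots> = f a i \<oplus>\<^bsub>K i\<^esub> (\<Oplus>\<^bsub>product_ring I K\<^esub>l\<in>A. f l) i" using i by (simp add: product_ring_simps(5))
  also have "\<dots> = f a i \<oplus>\<^bsub>K i\<^esub> (\<Oplus>\<^bsub>K i\<^esub>l\<in>A. f l i)" using insert by simp
  also have "\<dots> = (\<Oplus>\<^bsub>K i\<^esub>l\<in>insert a A. f l i)" using Ki.finsum_insert[OF insert(1,2) 2] by simp
  finally show ?case .
qed

section \<open>Matrices over a product ring, factor by factor\<close>

definition mat_proj :: "nat \<Rightarrow> 'i \<Rightarrow> (nat \<times> nat \<Rightarrow> 'i \<Rightarrow> 'a) \<Rightarrow> nat \<times> nat \<Rightarrow> 'a" where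
  "mat_proj d i x = restrict (\<lambda>kl. x kl i) ({..<d} \<times> {..<d})"

definition mat_lift :: "nat \<Rightarrow> 'i set \<Rightarrow> ('i \<Rightarrow> nat \<times> nat \<Rightarrow> 'a) \<Rightarrow> nat \<times> nat \<Rightarrow> 'i \<Rightarrow> 'a" where
  "mat_lift d I y = restrict (\<lambda>kl. \<lambda>i\<in>I. y i kl) ({..<d} \<times> {..<d})"

context
  fixes I :: "'i set" and K :: "'i \<Rightarrow> ('a, 'm) ring_scheme" and d :: nat
  assumes K: "\<And>i. i \<in> I \<Longrightarrow> ring (K i)"
begin

interpretation R: ring "product_ring I K" by (rule product_ring_ring[OF K])

lemma proj_mat:
  assumes i: "i \<in> I" and x: "x \<in> carrier (mat_monoid d (product_ring I K))"
  shows "mat_proj d i x \<in> carrier (mat_monoid d (K i))"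
  using R.mat_entry[OF x] i unfolding ring.mat_carrier[OF K[OF i]] mat_proj_def
  by (auto simp: product_ring_simps PiE_mem)

lemma lift_mat:
  assumes y: "\<And>i. i \<in> I \<Longrightarrow> y i \<in> carrier (mat_monoid d (K i))"
  shows "mat_lift d I y \<in> carrier (mat_monoid d (product_ring I K))"
  using ring.mat_entry[OF K y] unfolding R.mat_carrier mat_lift_def by (auto simp: product_ring_simps)

lemma proj_lift:
  assumes i: "i \<in> I" and y: "y i \<in> carrier (mat_monoid d (K i))"
  shows "mat_proj d i (mat_lift d I y) = y i"
  using y i unfolding ring.mat_carrier[OF K[OF i]] mat_proj_def mat_lift_def
  by (intro extensionalityI[of _ "{..<d} \<times> {..<d}"]) (auto simp: PiE_def)

lemma proj_eqI:
  assumes x: "x \<in> carrier (mat_monoid d (product_ring I K))" and y: "y \<in> carrier (mat_monoid d (product_ring I K))"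
    and e: "\<And>i. i \<in> I \<Longrightarrow> mat_proj d i x = mat_proj d i y"
  shows "x = y"
proof (rule R.mat_eqI[OF x y])
  fix k l assume kl: "k < d" "l < d"
  show "x (k, l) = y (k, l)"
  proof (rule extensionalityI[of _ I])
    show "x (k, l) \<in> extensional I" "y (k, l) \<in> extensional I"
      using R.mat_entry[OF x kl] R.mat_entry[OF y kl] by (auto simp: product_ring_simps PiE_def)
    fix i assume "i \<in> I"
    from fun_cong[OF e[OF this], of "(k, l)"] kl show "x (k, l) i = y (k, l) i" by (simp add: mat_proj_def)
  qed
qed

lemma proj_mult:
  assumes i: "i \<in> I" and x: "x \<in> carrier (mat_monoid d (product_ring I K))" and y: "y \<in> carrier (mat_monoid d (product_ring I K))"
  shows "mat_proj d i (x \<otimes>\<^bsub>mat_monoid d (product_ring I K)\<^esub> y) = mat_proj d i x \<otimes>\<^bsub>mat_monoid d (K i)\<^esub> mat_proj d i y"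
proof -
  interpret Ki: ring "K i" by (rule K[OF i])
  show ?thesis
  proof (rule Ki.mat_eqI)
    show "mat_proj d i (x \<otimes>\<^bsub>mat_monoid d (product_ring I K)\<^esub> y) \<in> carrier (mat_monoid d (K i))"
      by (intro proj_mat i R.mat_mult_closed x y)
    show "mat_proj d i x \<otimes>\<^bsub>mat_monoid d (K i)\<^esub> mat_proj d i y \<in> carrier (mat_monoid d (K i))"
      by (intro Ki.mat_mult_closed proj_mat i x y)
    fix k l assume kl: "k < d" "l < d"
    have "mat_proj d i (x \<otimes>\<^bsub>mat_monoid d (product_ring I K)\<^esub> y) (k, l)
        = (\<Oplus>\<^bsub>K i\<^esub>m\<in>{..<d}. (x (k, m) \<otimes>\<^bsub>product_ring I K\<^esub> y (m, l)) i)"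
    proof -
      have "(\<Oplus>\<^bsub>product_ring I K\<^esub>m\<in>{..<d}. x (k, m) \<otimes>\<^bsub>product_ring I K\<^esub> y (m, l)) i
          = (\<Oplus>\<^bsub>K i\<^esub>m\<in>{..<d}. (x (k, m) \<otimes>\<^bsub>product_ring I K\<^esub> y (m, l)) i)"
        by (rule product_ring_finsum[OF K i]) (use kl R.mat_entry[OF x] R.mat_entry[OF y] in auto)
      then show ?thesis using kl by (simp add: mat_proj_def R.mat_mult_entry)
    qed
    also have "\<dots> = (mat_proj d i x \<otimes>\<^bsub>mat_monoid d (K i)\<^esub> mat_proj d i y) (k, l)"
    proof -
      have e: "x (k, m) i \<in> carrier (K i)" "y (m, l) i \<in> carrier (K i)" if m: "m < d" for m
        using R.mat_entry[OF x kl(1) m] R.mat_entry[OF y m kl(2)] i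
        by (auto simp: product_ring_simps intro: product_ring_app[where K = K])
      show ?thesis unfolding Ki.mat_mult_entry[OF kl]
      by (rule Ki.finsum_cong')
         (use kl i e in \<open>auto simp: mat_proj_def product_ring_simps\<close>)
    qed
    finally show "mat_proj d i (x \<otimes>\<^bsub>mat_monoid d (product_ring I K)\<^esub> y) (k, l) =
      (mat_proj d i x \<otimes>\<^bsub>mat_monoid d (K i)\<^esub> mat_proj d i y) (k, l)" .
  qed
qed

lemma proj_one:
  assumes i: "i \<in> I"
  shows "mat_proj d i \<one>\<^bsub>mat_monoid d (product_ring I K)\<^esub> = \<one>\<^bsub>mat_monoid d (K i)\<^esub>"
proof -
  interpret Ki: ring "K i" by (rule K[OF i])
  show ?thesis
    by (rule Ki.mat_eqI[OF proj_mat[OF i R.mat_one_closed] Ki.mat_one_closed])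
       (use i in \<open>auto simp: mat_proj_def R.mat_one_entry Ki.mat_one_entry product_ring_simps\<close>)
qed

lemma proj_GL:
  assumes i: "i \<in> I" and x: "x \<in> carrier (GL d (product_ring I K))"
  shows "mat_proj d i x \<in> carrier (GL d (K i))"
    "mat_proj d i (inv\<^bsub>GL d (product_ring I K)\<^esub> x) = inv\<^bsub>GL d (K i)\<^esub> (mat_proj d i x)"
proof -
  interpret Ki: ring "K i" by (rule K[OF i])
  interpret H: group "GL d (product_ring I K)" by (rule R.GL_group)
  let ?y = "inv\<^bsub>GL d (product_ring I K)\<^esub> x"
  have xy: "x \<in> carrier (mat_monoid d (product_ring I K))" "?y \<in> carrier (mat_monoid d (product_ring I K))"
    using R.GL_carrier_mat x by auto
  have "x \<otimes>\<^bsub>mat_monoid d (product_ring I K)\<^esub> ?y = \<one>\<^bsub>mat_monoid d (product_ring I K)\<^esub>"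
    "?y \<otimes>\<^bsub>mat_monoid d (product_ring I K)\<^esub> x = \<one>\<^bsub>mat_monoid d (product_ring I K)\<^esub>"
    using H.r_inv[OF x] H.l_inv[OF x] by (simp_all add: R.GL_mult R.GL_one)
  then have "mat_proj d i x \<otimes>\<^bsub>mat_monoid d (K i)\<^esub> mat_proj d i ?y = \<one>\<^bsub>mat_monoid d (K i)\<^esub>"
    "mat_proj d i ?y \<otimes>\<^bsub>mat_monoid d (K i)\<^esub> mat_proj d i x = \<one>\<^bsub>mat_monoid d (K i)\<^esub>"
    using proj_mult[OF i xy] proj_mult[OF i xy(2,1)] proj_one[OF i] by simp_all
  from Ki.GL_I[OF proj_mat[OF i xy(1)] proj_mat[OF i xy(2)] this]
  show "mat_proj d i x \<in> carrier (GL d (K i))" "mat_proj d i ?y = inv\<^bsub>GL d (K i)\<^esub> (mat_proj d i x)" by simp_all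
qed

lemma proj_GL_mult:
  assumes "i \<in> I" "x \<in> carrier (GL d (product_ring I K))" "y \<in> carrier (GL d (product_ring I K))"
  shows "mat_proj d i (x \<otimes>\<^bsub>GL d (product_ring I K)\<^esub> y) = mat_proj d i x \<otimes>\<^bsub>GL d (K i)\<^esub> mat_proj d i y"
  using proj_mult[OF assms(1)] assms R.GL_carrier_mat by (simp add: R.GL_mult ring.GL_mult[OF K[OF assms(1)]])

lemma lift_GL:
  assumes y: "\<And>i. i \<in> I \<Longrightarrow> y i \<in> carrier (GL d (K i))"
  shows "mat_lift d I y \<in> carrier (GL d (product_ring I K))"
proof -
  let ?M = "mat_monoid d (product_ring I K)" and ?z = "\<lambda>i. inv\<^bsub>GL d (K i)\<^esub> (y i)"
  have yM: "y i \<in> carrier (mat_monoid d (K i))" if "i \<in> I" for i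
    using ring.GL_carrier_mat[OF K[OF that]] y[OF that] by blast
  have zM: "?z i \<in> carrier (mat_monoid d (K i))" if "i \<in> I" for i
    using ring.GL_carrier_mat[OF K[OF that]] group.inv_closed[OF ring.GL_group[OF K[OF that]] y[OF that]] by blast
  have M: "mat_lift d I y \<in> carrier ?M" "mat_lift d I ?z \<in> carrier ?M"
    using lift_mat[of y] lift_mat[of ?z] yM zM by auto
  have yz: "y i \<otimes>\<^bsub>mat_monoid d (K i)\<^esub> ?z i = \<one>\<^bsub>mat_monoid d (K i)\<^esub>" "?z i \<otimes>\<^bsub>mat_monoid d (K i)\<^esub> y i = \<one>\<^bsub>mat_monoid d (K i)\<^esub>"
    if "i \<in> I" for i
    using group.r_inv[OF ring.GL_group[OF K[OF that]] y[OF that]] group.l_inv[OF ring.GL_group[OF K[OF that]] y[OF that]]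
    by (simp_all add: ring.GL_mult[OF K[OF that]] ring.GL_one[OF K[OF that]])
  have "mat_lift d I y \<otimes>\<^bsub>?M\<^esub> mat_lift d I ?z = \<one>\<^bsub>?M\<^esub>"
    by (rule proj_eqI) (simp_all add: R.mat_mult_closed M R.mat_one_closed proj_mult proj_one proj_lift yM zM yz)
  moreover have "mat_lift d I ?z \<otimes>\<^bsub>?M\<^esub> mat_lift d I y = \<one>\<^bsub>?M\<^esub>"
    by (rule proj_eqI) (simp_all add: R.mat_mult_closed M R.mat_one_closed proj_mult proj_one proj_lift yM zM yz)
  ultimately show ?thesis using R.GL_I[OF M] by simp
qed

end

lemma (in topological_field) continuous_finsum:
  assumes A: "finite A" and f: "\<And>l. l \<in> A \<Longrightarrow> continuous_map Z T (f l)"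
  shows "continuous_map Z T (\<lambda>z. \<Oplus>l\<in>A. f l z)"
  using A f
proof (induction A rule: finite_induct)
  case empty then show ?case by (simp add: topspace_eq)
next
  case (insert a A)
  have c: "f l z \<in> carrier K" if "l \<in> insert a A" "z \<in> topspace Z" for l z
    using continuous_map_image_subset_topspace[OF insert.prems[OF that(1)]] that(2) topspace_eq by auto
  have "continuous_map Z (prod_topology T T) (\<lambda>z. (f a z, \<Oplus>l\<in>A. f l z))"
    using insert by (simp add: continuous_map_pairwise o_def)
  from continuous_map_compose[OF this continuous_add]
  have "continuous_map Z T (\<lambda>z. f a z \<oplus> (\<Oplus>l\<in>A. f l z))" by (simp add: o_def)
  then show ?case
    by (rule continuous_map_eq) (use insert c in \<open>auto simp: finsum_insert Pi_iff\<close>)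
qed

section \<open>Comparison of the metric with the bounded sets of the factors\<close>

locale product_GL = admissible_group "GL d (product_ring I K)" "GL_topology d (product_ring I K) (product_topology TK I)" SH dH
  for d :: nat and I :: "'i set" and K :: "'i \<Rightarrow> ('k, 'n) ring_scheme" and TK :: "'i \<Rightarrow> 'k topology" and SH dH +
  fixes L :: "'i \<Rightarrow> int \<Rightarrow> 'k set" and c :: "'i \<Rightarrow> int" and \<pi> :: "'i \<Rightarrow> 'k"
  assumes finite_I: "finite I"
    and local_fields: "i \<in> I \<Longrightarrow> local_field (K i) (TK i)"
    and filtered: "i \<in> I \<Longrightarrow> filtered_field (K i) (L i) (c i) (\<pi> i)"
    and compact_L: "i \<in> I \<Longrightarrow> compactin (TK i) (L i n)"
    and absorbed: "i \<in> I \<Longrightarrow> compactin (TK i) C \<Longrightarrow> \<exists>n. C \<subseteq> L i n"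
begin

abbreviation R where "R \<equiv> product_ring I K"
abbreviation H where "H \<equiv> GL d R"
abbreviation B where "B i \<equiv> filtered_GL.Bd (K i) (L i) d"
abbreviation proj where "proj \<equiv> mat_proj d"

lemma K_ring: "i \<in> I \<Longrightarrow> ring (K i)"
  using filtered by (simp add: filtered_field_def field_def domain_def cring_def)

lemma filt_GL: "i \<in> I \<Longrightarrow> filtered_GL (K i) (L i) (c i) (\<pi> i)"
  using filtered by (simp add: filtered_GL_def)

interpretation R: ring R by (rule product_ring_ring[OF K_ring])

lemma K_top: "i \<in> I \<Longrightarrow> topspace (TK i) = carrier (K i)"
  using local_fields topological_field.topspace_eq unfolding local_field_def by metis

lemma Mat_top: "topspace (product_topology (\<lambda>_. product_topology TK I) ({..<d} \<times> {..<d})) = carrier (mat_monoid d R)"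
proof -
  have "(\<Pi>\<^sub>E i\<in>I. topspace (TK i)) = (\<Pi>\<^sub>E i\<in>I. carrier (K i))" by (rule PiE_cong) (rule K_top)
  then show ?thesis by (simp add: R.mat_carrier product_ring_simps)
qed

lemma int_bound: "finite A \<Longrightarrow> \<exists>m::int. \<forall>a\<in>A. f a \<le> m"
  by (rule exI[of _ "Max (f ` A)"]) simp

text \<open>The closed ball is compact, so every entry in every factor ranges over a compact set and
  is absorbed by some level; finiteness gives a common one. Inverses are bounded too, because the
  ball about \<open>\<one>\<close> is symmetric.\<close>

lemma ball_in_B: "\<exists>n\<ge>0. \<forall>x\<in>carrier H. dH \<one>\<^bsub>H\<^esub> x \<le> r \<longrightarrow> (\<forall>i\<in>I. proj i x \<in> B i n)"
proof -
  let ?C = "mcball \<one>\<^bsub>H\<^esub> r" and ?ix = "{..<d} \<times> {..<d}"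
  let ?X = "product_topology (\<lambda>_. product_topology TK I) ?ix"
  have C: "compactin ?X ?C"
    using compact_cball[OF one_closed, of r] unfolding GL_topology_def compactin_subtopology by blast
  have "\<exists>n. i \<in> I \<longrightarrow> kl \<in> ?ix \<longrightarrow> (\<lambda>x. x kl i) ` ?C \<subseteq> L i n" for i kl
  proof (cases "i \<in> I \<and> kl \<in> ?ix")
    case True
    have "continuous_map ?X (TK i) ((\<lambda>y. y i) \<circ> (\<lambda>x. x kl))"
      using True by (intro continuous_map_compose[of _ "product_topology TK I"] continuous_map_product_projection) auto
    then have "compactin (TK i) (((\<lambda>y. y i) \<circ> (\<lambda>x. x kl)) ` ?C)" by (rule image_compactin[OF C])
    from absorbed[OF _ this] True show ?thesis by (simp add: o_def)
  qed simp
  then obtain n where n: "\<And>i kl. i \<in> I \<Longrightarrow> kl \<in> ?ix \<Longrightarrow> (\<lambda>x. x kl i) ` ?C \<subseteq> L i (n i kl)" by metis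
  obtain m where m: "\<And>i kl. i \<in> I \<Longrightarrow> kl \<in> ?ix \<Longrightarrow> n i kl \<le> m"
    using int_bound[of "I \<times> ?ix" "\<lambda>(i, kl). n i kl"] finite_I by auto
  define N where "N = max 0 m"
  have e: "x kl i \<in> L i N" if x: "x \<in> ?C" and i: "i \<in> I" "kl \<in> ?ix" for x i kl
  proof -
    have "x kl i \<in> L i (n i kl)" using n[OF i] x by blast
    moreover have "n i kl \<le> N" using m[OF i] by (simp add: N_def)
    ultimately show ?thesis using filtered_field.L_mono[OF filtered[OF i(1)]] by blast
  qed
  have "proj i x \<in> B i N" if x: "x \<in> carrier H" "dH \<one>\<^bsub>H\<^esub> x \<le> r" and i: "i \<in> I" for x i
  proof -
    interpret F: filtered_GL "K i" "L i" "c i" "\<pi> i" d by (rule filt_GL[OF i])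
    have xC: "x \<in> ?C" "inv\<^bsub>H\<^esub> x \<in> ?C" using x d_one_inv[OF x(1)] by auto
    note P = proj_GL[OF K_ring i x(1)]
    have "proj i x \<in> F.matL N" unfolding F.matL_def
      using F.GL_carrier_mat[OF P(1)] e[OF xC(1) i] by (auto simp: mat_proj_def)
    moreover have "proj i (inv\<^bsub>H\<^esub> x) \<in> F.matL N" unfolding F.matL_def
      using F.GL_carrier_mat[OF proj_GL(1)[OF K_ring i inv_closed[OF x(1)]]] e[OF xC(2) i] by (auto simp: mat_proj_def)
    ultimately show ?thesis unfolding F.Bd_def using P by simp
  qed
  then show ?thesis by (intro exI[of _ N]) (auto simp: N_def)
qed

text \<open>The bounded part of the group is compact: it is the projection of a closed set of pairs of
  mutually inverse matrices with entries in compact sets.\<close>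

lemma B_bounded: "\<exists>r>0. \<forall>x\<in>carrier H. (\<forall>i\<in>I. proj i x \<in> B i n) \<longrightarrow> dH \<one>\<^bsub>H\<^esub> x \<le> r"
proof -
  let ?ix = "{..<d} \<times> {..<d}" and ?M = "mat_monoid d R"
  let ?X = "product_topology (\<lambda>_. product_topology TK I) ?ix"
  define P where "P = (\<Pi>\<^sub>E kl\<in>?ix. \<Pi>\<^sub>E i\<in>I. L i n)"
  have cP: "compactin ?X P" unfolding P_def by (auto simp: compactin_PiE compact_L)
  let ?XX = "prod_topology ?X ?X"
  have cont: "continuous_map ?XX ?X (\<lambda>z. g z \<otimes>\<^bsub>?M\<^esub> h z)"
    if gh: "continuous_map ?XX ?X g" "continuous_map ?XX ?X h" for g h
  proof (rule continuous_map_componentwise[THEN iffD2], intro conjI ballI)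
    have gM: "g z \<in> carrier ?M" "h z \<in> carrier ?M" if "z \<in> topspace ?XX" for z
      using continuous_map_image_subset_topspace[OF gh(1)] continuous_map_image_subset_topspace[OF gh(2)] that Mat_top by blast+
    show "(\<lambda>z. g z \<otimes>\<^bsub>?M\<^esub> h z) ` topspace ?XX \<subseteq> extensional ?ix"
      using R.mat_mult_closed[OF gM] unfolding R.mat_carrier by (auto simp: PiE_def)
    fix kl assume kl: "kl \<in> ?ix"
    then obtain k l where kl': "kl = (k, l)" "k < d" "l < d" by auto
    show "continuous_map ?XX (product_topology TK I) (\<lambda>z. (g z \<otimes>\<^bsub>?M\<^esub> h z) kl)"
    proof (rule continuous_map_componentwise[THEN iffD2], intro conjI ballI)
      show "(\<lambda>z. (g z \<otimes>\<^bsub>?M\<^esub> h z) kl) ` topspace ?XX \<subseteq> extensional I"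
      proof
        fix w assume "w \<in> (\<lambda>z. (g z \<otimes>\<^bsub>?M\<^esub> h z) kl) ` topspace ?XX"
        then have "w \<in> carrier R" using R.mat_entry[OF R.mat_mult_closed[OF gM] kl'(2,3)] kl'(1) by blast
        then show "w \<in> extensional I" by (simp add: product_ring_simps PiE_def)
      qed
      fix i assume i: "i \<in> I"
      interpret Ti: local_field "K i" "TK i" by (rule local_fields[OF i])
      have proj: "continuous_map ?XX (TK i) (\<lambda>z. g z ab i)" "continuous_map ?XX (TK i) (\<lambda>z. h z ab i)" if ab: "ab \<in> ?ix" for ab
      proof -
        have "continuous_map ?X (TK i) ((\<lambda>y. y i) \<circ> (\<lambda>x. x ab))"
          using i ab by (intro continuous_map_compose[of _ "product_topology TK I"] continuous_map_product_projection) auto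
        from continuous_map_compose[OF gh(1) this] continuous_map_compose[OF gh(2) this]
        show "continuous_map ?XX (TK i) (\<lambda>z. g z ab i)" "continuous_map ?XX (TK i) (\<lambda>z. h z ab i)" by (simp_all add: o_def)
      qed
      have "continuous_map ?XX (TK i) (\<lambda>z. \<Oplus>\<^bsub>K i\<^esub>m\<in>{..<d}. g z (k, m) i \<otimes>\<^bsub>K i\<^esub> h z (m, l) i)"
      proof (rule Ti.continuous_finsum)
        fix m assume m: "m \<in> {..<d}"
        have "continuous_map ?XX (prod_topology (TK i) (TK i)) (\<lambda>z. (g z (k, m) i, h z (m, l) i))"
          using proj[of "(k, m)"] proj[of "(m, l)"] m kl' by (simp add: continuous_map_pairwise o_def)
        from continuous_map_compose[OF this Ti.continuous_mult]
        show "continuous_map ?XX (TK i) (\<lambda>z. g z (k, m) i \<otimes>\<^bsub>K i\<^esub> h z (m, l) i)" by (simp add: o_def)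
      qed simp
      then show "continuous_map ?XX (TK i) (\<lambda>z. (g z \<otimes>\<^bsub>?M\<^esub> h z) kl i)"
      proof (rule continuous_map_eq)
        fix z assume z: "z \<in> topspace ?XX"
        have e: "g z (k, m) \<in> carrier R" "h z (m, l) \<in> carrier R" if "m < d" for m
          using R.mat_entry[OF gM(1)[OF z] kl'(2) that] R.mat_entry[OF gM(2)[OF z] that kl'(3)] by auto
        have "(g z \<otimes>\<^bsub>?M\<^esub> h z) kl i = (\<Oplus>\<^bsub>K i\<^esub>m\<in>{..<d}. (g z (k, m) \<otimes>\<^bsub>R\<^esub> h z (m, l)) i)"
        proof -
          have "(\<Oplus>\<^bsub>R\<^esub>m\<in>{..<d}. g z (k, m) \<otimes>\<^bsub>R\<^esub> h z (m, l)) i = (\<Oplus>\<^bsub>K i\<^esub>m\<in>{..<d}. (g z (k, m) \<otimes>\<^bsub>R\<^esub> h z (m, l)) i)"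
            by (rule product_ring_finsum[OF K_ring i]) (use e in auto)
          then show ?thesis by (simp add: kl' R.mat_mult_entry)
        qed
        also have "\<dots> = (\<Oplus>\<^bsub>K i\<^esub>m\<in>{..<d}. g z (k, m) i \<otimes>\<^bsub>K i\<^esub> h z (m, l) i)"
          by (rule Ti.finsum_cong') (use e i in \<open>auto simp: product_ring_simps product_ring_app[where K = K] intro!: Ti.m_closed\<close>)
        finally show "(\<Oplus>\<^bsub>K i\<^esub>m\<in>{..<d}. g z (k, m) i \<otimes>\<^bsub>K i\<^esub> h z (m, l) i) = (g z \<otimes>\<^bsub>?M\<^esub> h z) kl i" by simp
      qed
    qed
  qed
  have one: "continuous_map ?XX ?X (\<lambda>z. \<one>\<^bsub>?M\<^esub>)" using R.mat_one_closed Mat_top by (simp only: continuous_map_const) simp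
  have haus: "Hausdorff_space ?X"
  proof -
    have "Hausdorff_space (TK i)" if "i \<in> I" for i using local_field.hausdorff[OF local_fields[OF that]] .
    then show ?thesis by (simp add: Hausdorff_space_product_topology)
  qed
  define D where "D = {z \<in> topspace ?XX. fst z \<otimes>\<^bsub>?M\<^esub> snd z = \<one>\<^bsub>?M\<^esub>} \<inter> {z \<in> topspace ?XX. snd z \<otimes>\<^bsub>?M\<^esub> fst z = \<one>\<^bsub>?M\<^esub>}"
  have "closedin ?XX D" unfolding D_def
    by (intro closedin_Int closedin_continuous_maps_eq[OF haus] cont one continuous_map_fst continuous_map_snd)
  moreover have "compactin ?XX (P \<times> P)" using cP by (simp add: compactin_Times)
  ultimately have "compactin ?XX (P \<times> P \<inter> D)" using closed_Int_compactin by (metis Int_commute)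
  then have cC: "compactin ?X (fst ` (P \<times> P \<inter> D))" by (rule image_compactin[OF _ continuous_map_fst])
  have "fst ` (P \<times> P \<inter> D) \<subseteq> carrier H"
  proof
    fix x assume "x \<in> fst ` (P \<times> P \<inter> D)"
    then obtain y where "(x, y) \<in> D" by auto
    then show "x \<in> carrier H" unfolding D_def using R.GL_I(1)[of x d y] Mat_top by simp
  qed
  with cC have "compactin (GL_topology d R (product_topology TK I)) (fst ` (P \<times> P \<inter> D))"
    by (simp add: GL_topology_def compactin_subtopology)
  then obtain r where r: "r > 0" "\<And>x. x \<in> fst ` (P \<times> P \<inter> D) \<Longrightarrow> dH \<one>\<^bsub>H\<^esub> x \<le> r" using compact_bounded by blast
  have "dH \<one>\<^bsub>H\<^esub> x \<le> r" if x: "x \<in> carrier H" "\<forall>i\<in>I. proj i x \<in> B i n" for x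
  proof (rule r(2))
    let ?y = "inv\<^bsub>H\<^esub> x"
    have M: "x \<in> carrier ?M" "?y \<in> carrier ?M" using R.GL_carrier_mat x by auto
    have Bi: "proj i x \<in> filtered_GL.matL (K i) (L i) d n" "proj i ?y \<in> filtered_GL.matL (K i) (L i) d n" if i: "i \<in> I" for i
      using x(2) i proj_GL(2)[OF K_ring i x(1)] filtered_GL.Bd_def[OF filt_GL[OF i], of d n] by auto
    have inP: "w \<in> P" if w: "w \<in> carrier ?M" "\<And>i. i \<in> I \<Longrightarrow> proj i w \<in> filtered_GL.matL (K i) (L i) d n" for w
    proof -
      have "w (k, l) \<in> (\<Pi>\<^sub>E i\<in>I. L i n)" if kl: "k < d" "l < d" for k l
      proof -
        have "w (k, l) \<in> extensional I" using R.mat_entry[OF w(1) kl] by (simp add: product_ring_simps PiE_def)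
        moreover have "w (k, l) i \<in> L i n" if i: "i \<in> I" for i
        proof -
          have "proj i w (k, l) \<in> L i n" using w(2)[OF i] kl filtered_GL.matL_def[OF filt_GL[OF i], of d n] by auto
          then show ?thesis using kl by (simp add: mat_proj_def)
        qed
        ultimately show ?thesis by (auto simp: PiE_def)
      qed
      then show ?thesis unfolding P_def using w(1) unfolding R.mat_carrier by (auto simp: PiE_def)
    qed
    have "(x, ?y) \<in> D" unfolding D_def using M Mat_top r_inv[OF x(1)] l_inv[OF x(1)] by (simp add: R.GL_mult R.GL_one)
    moreover have "x \<in> P" "?y \<in> P" using inP M Bi by auto
    ultimately show "x \<in> fst ` (P \<times> P \<inter> D)" by force
  qed
  then show ?thesis using r(1) by blast
qed

text \<open>The words in the factors have the same length, so their letters can be combined position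
  by position.\<close>

lemma lift_word:
  assumes "x \<in> carrier H" "\<And>i. i \<in> I \<Longrightarrow> proj i x \<in> set_power (GL d (K i)) (B i q) m"
  shows "x \<in> set_power H {h \<in> carrier H. \<forall>i\<in>I. proj i h \<in> B i q} m"
  using assms
proof (induction m arbitrary: x)
  case 0
  have "x = \<one>\<^bsub>H\<^esub>" unfolding R.GL_one
  proof (rule proj_eqI[OF K_ring])
    show "x \<in> carrier (mat_monoid d R)" using 0 R.GL_carrier_mat by blast
    show "\<one>\<^bsub>mat_monoid d R\<^esub> \<in> carrier (mat_monoid d R)" by (rule R.mat_one_closed)
    fix i assume i: "i \<in> I"
    then show "proj i x = proj i \<one>\<^bsub>mat_monoid d R\<^esub>"
      using 0(2)[OF i] proj_one[OF K_ring i] ring.GL_one[OF K_ring[OF i]] by simp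
  qed
  then show ?case by simp
next
  case (Suc m)
  have "\<exists>y s. i \<in> I \<longrightarrow> y \<in> set_power (GL d (K i)) (B i q) m \<and> s \<in> B i q \<and> proj i x = y \<otimes>\<^bsub>GL d (K i)\<^esub> s" for i
  proof (cases "i \<in> I")
    case True
    from group.set_power_SucE[OF ring.GL_group[OF K_ring[OF True]] Suc.prems(2)[OF True]] show ?thesis by metis
  qed simp
  then obtain y s where ys: "\<And>i. i \<in> I \<Longrightarrow> y i \<in> set_power (GL d (K i)) (B i q) m" "\<And>i. i \<in> I \<Longrightarrow> s i \<in> B i q"
    "\<And>i. i \<in> I \<Longrightarrow> proj i x = y i \<otimes>\<^bsub>GL d (K i)\<^esub> s i" by metis
  have sG: "s i \<in> carrier (GL d (K i))" if "i \<in> I" for i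
    using filtered_GL.Bd_\<Gamma>[OF filt_GL[OF that] ys(2)[OF that]] .
  have yG: "y i \<in> carrier (GL d (K i))" if "i \<in> I" for i
  proof -
    have "B i q \<subseteq> carrier (GL d (K i))" using filtered_GL.Bd_\<Gamma>[OF filt_GL[OF that]] by blast
    from group.set_power_closed[OF ring.GL_group[OF K_ring[OF that]] this] ys(1)[OF that] show ?thesis by blast
  qed
  let ?y = "mat_lift d I y" and ?s = "mat_lift d I s"
  have H: "?y \<in> carrier H" "?s \<in> carrier H"
    by (rule lift_GL[OF K_ring yG], assumption+, rule lift_GL[OF K_ring sG], assumption+)
  have p: "proj i ?y = y i" "proj i ?s = s i" if "i \<in> I" for i
    using proj_lift[OF K_ring that] ring.GL_carrier_mat[OF K_ring[OF that]] yG[OF that] sG[OF that] by auto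
  have "?y \<in> set_power H {h \<in> carrier H. \<forall>i\<in>I. proj i h \<in> B i q} m"
    by (rule Suc.IH) (use H p ys in auto)
  moreover have "?s \<in> {h \<in> carrier H. \<forall>i\<in>I. proj i h \<in> B i q}" using H p ys by auto
  ultimately have "?y \<otimes>\<^bsub>H\<^esub> ?s \<in> set_power H {h \<in> carrier H. \<forall>i\<in>I. proj i h \<in> B i q} (Suc m)" by (rule set_power_SucI)
  moreover have "x = ?y \<otimes>\<^bsub>H\<^esub> ?s"
  proof (rule proj_eqI[OF K_ring])
    show "x \<in> carrier (mat_monoid d R)" using Suc.prems R.GL_carrier_mat by blast
    show "?y \<otimes>\<^bsub>H\<^esub> ?s \<in> carrier (mat_monoid d R)" using H R.GL_carrier_mat by blast
    fix i assume i: "i \<in> I"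
    then show "proj i x = proj i (?y \<otimes>\<^bsub>H\<^esub> ?s)" using proj_GL_mult[OF K_ring i H] p ys by simp
  qed
  ultimately show ?case by simp
qed

lemma proj_word:
  assumes S: "S \<subseteq> carrier H" "\<And>s i. s \<in> S \<Longrightarrow> i \<in> I \<Longrightarrow> proj i s \<in> B i q" and i: "i \<in> I"
  shows "x \<in> set_power H S m \<Longrightarrow> proj i x \<in> set_power (GL d (K i)) (B i q) m"
proof (induction m arbitrary: x)
  case 0
  then show ?case using proj_one[OF K_ring i] ring.GL_one[OF K_ring[OF i]] by (simp add: R.GL_one)
next
  case (Suc m)
  obtain y s where ys: "y \<in> set_power H S m" "s \<in> S" "x = y \<otimes>\<^bsub>H\<^esub> s" using set_power_SucE[OF Suc.prems] by blast
  have G: "y \<in> carrier H" "s \<in> carrier H" using set_power_closed[OF S(1)] ys S(1) by blast+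
  have p: "proj i x = proj i y \<otimes>\<^bsub>GL d (K i)\<^esub> proj i s" using proj_GL_mult[OF K_ring i G] ys(3) by simp
  show ?case unfolding p
    by (rule group.set_power_SucI[OF ring.GL_group[OF K_ring[OF i]] Suc.IH[OF ys(1)] S(2)[OF ys(2) i]])
qed

text \<open>Products of members in the factors form the cover, so multiplicities multiply. Letters
  from \<open>SH\<close> project into \<open>B i s0\<close>, which turns a distance n into the word
  length used for the Lebesgue number; conversely, words in the sets \<open>B i q0\<close> lift to
  words whose letters have bounded distance from \<open>\<one>\<close>.\<close>

theorem finite_asdim: "finite_asdim_AN (carrier H) dH"
proof -
  obtain \<sigma> where \<sigma>: "\<And>s. s \<in> SH \<Longrightarrow> dH \<one>\<^bsub>H\<^esub> s \<le> \<sigma>" using S_bounded by blast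
  obtain s0 where s0: "0 \<le> s0" "\<And>x. x \<in> carrier H \<Longrightarrow> dH \<one>\<^bsub>H\<^esub> x \<le> \<sigma> \<Longrightarrow> (\<forall>i\<in>I. proj i x \<in> B i s0)"
    using ball_in_B[of \<sigma>] by blast
  have SB: "proj i s \<in> B i s0" if "s \<in> SH" "i \<in> I" for s i using s0(2)[of s] \<sigma>[OF that(1)] S_carrier that by blast
  obtain k where k: "\<And>n x y. 1 \<le> n \<Longrightarrow> x \<in> carrier H \<Longrightarrow> y \<in> carrier H \<Longrightarrow> dH x y \<le> real n \<Longrightarrow>
    \<exists>m\<le>k * n. inv\<^bsub>H\<^esub> x \<otimes>\<^bsub>H\<^esub> y \<in> set_power H SH m" using ball_word by blast
  \<comment> \<open>Positive even if k is 0, as the covers of the factors are available only at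
    scales at least 1.\<close>
  define k' where "k' = Suc k"
  define cov where "cov i M p q n \<U> \<longleftrightarrow> (\<forall>A\<in>\<U>. A \<subseteq> carrier (GL d (K i))) \<and>
     (\<forall>x\<in>carrier (GL d (K i)). finite {A\<in>\<U>. x \<in> A} \<and> card {A\<in>\<U>. x \<in> A} \<le> M) \<and>
     (\<forall>x\<in>carrier (GL d (K i)). \<exists>A\<in>\<U>. \<forall>z\<in>set_power (GL d (K i)) (B i s0) n. x \<otimes>\<^bsub>GL d (K i)\<^esub> z \<in> A) \<and>
     (\<forall>A\<in>\<U>. \<forall>x\<in>A. \<forall>y\<in>A. inv\<^bsub>GL d (K i)\<^esub> x \<otimes>\<^bsub>GL d (K i)\<^esub> y \<in> set_power (GL d (K i)) (B i q) (p * n))"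
    for i and M p :: nat and q and n :: nat and \<U>
  have "\<exists>M p q. i \<in> I \<longrightarrow> 0 \<le> q \<and> (\<forall>n\<ge>1. \<exists>\<U>. cov i M p q n \<U>)" for i
  proof (cases "i \<in> I")
    case True
    have "\<exists>M p q. 0 \<le> q \<and> (\<forall>n\<ge>1. \<exists>\<U>. cov i M p q n \<U>)"
      unfolding cov_def by (rule filtered_GL.coarse_cover_GL[OF filt_GL[OF True]])
    then show ?thesis by (simp only: True simp_thms)
  qed simp
  then obtain M p q where Mpq: "\<And>i. i \<in> I \<Longrightarrow> 0 \<le> q i" "\<And>i n. i \<in> I \<Longrightarrow> 1 \<le> n \<Longrightarrow> \<exists>\<U>. cov i (M i) (p i) (q i) n \<U>" by metis
  obtain q1 where q1: "\<And>i. i \<in> I \<Longrightarrow> q i \<le> q1" using int_bound[OF finite_I, of q] by blast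
  define q0 where "q0 = max 0 q1"
  \<comment> \<open>A common word length for all factors, as \<open>lift_word\<close> requires;
    shorter words are padded with the identity, which belongs to \<open>B i q0\<close>.\<close>
  define p0 where "p0 = (\<Sum>i\<in>I. p i)"
  have p0: "p i \<le> p0" if "i \<in> I" for i unfolding p0_def using finite_I that by (simp add: member_le_sum)
  have q0: "q i \<le> q0" "0 \<le> q0" if "i \<in> I" for i using q1[OF that] by (auto simp: q0_def)
  let ?BB = "{h \<in> carrier H. \<forall>i\<in>I. proj i h \<in> B i q0}"
  obtain r where r: "r > 0" "\<And>x. x \<in> ?BB \<Longrightarrow> dH \<one>\<^bsub>H\<^esub> x \<le> r" using B_bounded[of q0] by blast
  define C where "C = nat \<lceil>r * real (p0 * k')\<rceil>"
  have C: "r * real (p0 * k') \<le> real C" unfolding C_def by linarith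
  show ?thesis unfolding finite_asdim_AN_def
  proof (rule exI[of _ "\<Prod>i\<in>I. M i"], rule exI[of _ C], intro allI impI)
    fix n :: nat assume n: "1 \<le> n"
    then have kn: "1 \<le> k' * n" unfolding k'_def by simp
    have "\<exists>\<U>. i \<in> I \<longrightarrow> cov i (M i) (p i) (q i) (k' * n) \<U>" for i using Mpq(2)[OF _ kn, of i] by blast
    then obtain \<U> where U: "\<And>i. i \<in> I \<Longrightarrow> cov i (M i) (p i) (q i) (k' * n) (\<U> i)" by metis
    define S where "S = (\<lambda>A. {x \<in> carrier H. \<forall>i\<in>I. proj i x \<in> A i})"
    define \<V> where "\<V> = S ` (\<Pi>\<^sub>E i\<in>I. \<U> i)"
    show "\<exists>\<U>. (\<forall>A\<in>\<U>. A \<subseteq> carrier H) \<and> (\<forall>x\<in>carrier H. finite {A\<in>\<U>. x \<in> A} \<and> card {A\<in>\<U>. x \<in> A} \<le> (\<Prod>i\<in>I. M i)) \<and>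
     (\<forall>x\<in>carrier H. \<exists>A\<in>\<U>. \<forall>y\<in>carrier H. dH x y \<le> real n \<longrightarrow> y \<in> A) \<and>
     (\<forall>A\<in>\<U>. \<forall>x\<in>A. \<forall>y\<in>A. dH x y \<le> real (C * n))"
    proof (rule exI[of _ \<V>], intro conjI ballI)
      show "A \<subseteq> carrier H" if "A \<in> \<V>" for A using that unfolding \<V>_def S_def by blast
    next
      fix x assume x: "x \<in> carrier H"
      let ?P = "\<Pi>\<^sub>E i\<in>I. {A \<in> \<U> i. proj i x \<in> A}"
      have fin: "finite {A \<in> \<U> i. proj i x \<in> A} \<and> card {A \<in> \<U> i. proj i x \<in> A} \<le> M i" if i: "i \<in> I" for i
        using U[OF i, unfolded cov_def, THEN conjunct2, THEN conjunct1, THEN bspec, OF proj_GL(1)[OF K_ring i x]] .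
      have "{A \<in> \<V>. x \<in> A} \<subseteq> S ` ?P"
      proof
        fix A assume "A \<in> {A \<in> \<V>. x \<in> A}"
        then obtain f where f: "f \<in> (\<Pi>\<^sub>E i\<in>I. \<U> i)" "A = S f" "x \<in> S f" unfolding \<V>_def by blast
        then have "f \<in> ?P" unfolding S_def by (auto simp: PiE_def)
        then show "A \<in> S ` ?P" using f(2) by blast
      qed
      moreover have fP: "finite ?P" using finite_I fin by (intro finite_PiE) auto
      moreover have "card ?P \<le> (\<Prod>i\<in>I. M i)"
        unfolding card_PiE[OF finite_I] using fin by (intro prod_mono) auto
      ultimately show "finite {A \<in> \<V>. x \<in> A}" "card {A \<in> \<V>. x \<in> A} \<le> (\<Prod>i\<in>I. M i)"
        by (meson card_image_le card_mono finite_imageI finite_subset le_trans)+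
      have "\<exists>A. i \<in> I \<longrightarrow> A \<in> \<U> i \<and> (\<forall>z\<in>set_power (GL d (K i)) (B i s0) (k' * n). proj i x \<otimes>\<^bsub>GL d (K i)\<^esub> z \<in> A)" for i
      proof (cases "i \<in> I")
        case True
        from U[OF True, unfolded cov_def, THEN conjunct2, THEN conjunct2, THEN conjunct1, THEN bspec, OF proj_GL(1)[OF K_ring True x]]
        obtain A where "A \<in> \<U> i" "\<forall>z\<in>set_power (GL d (K i)) (B i s0) (k' * n). proj i x \<otimes>\<^bsub>GL d (K i)\<^esub> z \<in> A" ..
        then show ?thesis by (intro exI[of _ A] impI conjI)
      qed simp
      then obtain A where A: "\<And>i. i \<in> I \<Longrightarrow> A i \<in> \<U> i"
        "\<And>i z. i \<in> I \<Longrightarrow> z \<in> set_power (GL d (K i)) (B i s0) (k' * n) \<Longrightarrow> proj i x \<otimes>\<^bsub>GL d (K i)\<^esub> z \<in> A i" by metis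
      show "\<exists>A\<in>\<V>. \<forall>y\<in>carrier H. dH x y \<le> real n \<longrightarrow> y \<in> A"
      proof (rule bexI[of _ "S (restrict A I)"], intro ballI impI)
        show "S (restrict A I) \<in> \<V>" unfolding \<V>_def using A(1) by auto
        fix y assume y: "y \<in> carrier H" "dH x y \<le> real n"
        obtain m where m: "m \<le> k * n" "inv\<^bsub>H\<^esub> x \<otimes>\<^bsub>H\<^esub> y \<in> set_power H SH m" using k[OF n x y] by blast
        have xy: "x \<otimes>\<^bsub>H\<^esub> (inv\<^bsub>H\<^esub> x \<otimes>\<^bsub>H\<^esub> y) = y" using x y(1) m_assoc[of x "inv\<^bsub>H\<^esub> x" y] by simp
        have zH: "inv\<^bsub>H\<^esub> x \<otimes>\<^bsub>H\<^esub> y \<in> carrier H" using x y by simp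
        have "proj i y \<in> A i" if i: "i \<in> I" for i
        proof -
          interpret F: filtered_GL "K i" "L i" "c i" "\<pi> i" d by (rule filt_GL[OF i])
          have "proj i (inv\<^bsub>H\<^esub> x \<otimes>\<^bsub>H\<^esub> y) \<in> set_power (GL d (K i)) (B i s0) m"
            by (rule proj_word[OF S_carrier SB i m(2)])
          moreover have "set_power (GL d (K i)) (B i s0) m \<subseteq> set_power (GL d (K i)) (B i s0) (k' * n)"
            by (rule F.GL.set_power_mono) (use F.Bd_\<Gamma> F.Bd_one[OF s0(1)] m(1) in \<open>auto simp: k'_def\<close>)
          ultimately have "proj i x \<otimes>\<^bsub>GL d (K i)\<^esub> proj i (inv\<^bsub>H\<^esub> x \<otimes>\<^bsub>H\<^esub> y) \<in> A i" using A(2)[OF i] by blast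
          then show ?thesis using proj_GL_mult[OF K_ring i x zH] xy by simp
        qed
        then show "y \<in> S (restrict A I)" unfolding S_def using y(1) by auto
      qed
    next
      fix A x y assume A: "A \<in> \<V>" "x \<in> A" "y \<in> A"
      then obtain f where f: "f \<in> (\<Pi>\<^sub>E i\<in>I. \<U> i)" "x \<in> S f" "y \<in> S f" unfolding \<V>_def by blast
      have xy: "x \<in> carrier H" "y \<in> carrier H" using f unfolding S_def by auto
      have ixy: "inv\<^bsub>H\<^esub> x \<in> carrier H" "inv\<^bsub>H\<^esub> x \<otimes>\<^bsub>H\<^esub> y \<in> carrier H" using xy by auto
      have "proj i (inv\<^bsub>H\<^esub> x \<otimes>\<^bsub>H\<^esub> y) \<in> set_power (GL d (K i)) (B i q0) (p0 * (k' * n))" if i: "i \<in> I" for i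
      proof -
        interpret F: filtered_GL "K i" "L i" "c i" "\<pi> i" d by (rule filt_GL[OF i])
        have "f i \<in> \<U> i" "proj i x \<in> f i" "proj i y \<in> f i" using f i unfolding S_def by auto
        then have "inv\<^bsub>GL d (K i)\<^esub> (proj i x) \<otimes>\<^bsub>GL d (K i)\<^esub> proj i y \<in> set_power (GL d (K i)) (B i (q i)) (p i * (k' * n))"
          using U[OF i, unfolded cov_def, THEN conjunct2, THEN conjunct2, THEN conjunct2] by simp
        also have "set_power (GL d (K i)) (B i (q i)) (p i * (k' * n)) \<subseteq> set_power (GL d (K i)) (B i q0) (p i * (k' * n))"
          by (intro F.GL.set_power_subset F.Bd_mono q0 i)
        also have "\<dots> \<subseteq> set_power (GL d (K i)) (B i q0) (p0 * (k' * n))"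
          by (rule F.GL.set_power_mono) (use F.Bd_\<Gamma> F.Bd_one q0[OF i] p0[OF i] in auto)
        finally show ?thesis using proj_GL_mult[OF K_ring i ixy(1) xy(2)] proj_GL(2)[OF K_ring i xy(1)] by simp
      qed
      from lift_word[OF ixy(2) this]
      have w: "inv\<^bsub>H\<^esub> x \<otimes>\<^bsub>H\<^esub> y \<in> set_power H ?BB (p0 * (k' * n))" .
      have "dH \<one>\<^bsub>H\<^esub> (inv\<^bsub>H\<^esub> x \<otimes>\<^bsub>H\<^esub> y) \<le> r * real (p0 * (k' * n))"
        by (rule set_power_dist[OF _ _ w]) (use r in auto)
      also have "\<dots> = r * real (p0 * k') * real n" by simp
      also have "\<dots> \<le> real C * real n" using C by (intro mult_right_mono) auto
      finally show "dH x y \<le> real (C * n)" using d_one[OF xy] by simp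
    qed
  qed
qed

end

theorem GL_finite_asdim:
  assumes I: "finite I" and K: "\<And>i. i \<in> I \<Longrightarrow> local_field (K i) (TK i)"
    and S: "compact_symmetric_generating (GL d (product_ring I K)) (GL_topology d (product_ring I K) (product_topology TK I)) SH"
    and m: "admissible_metric (GL d (product_ring I K)) (GL_topology d (product_ring I K) (product_topology TK I)) SH dH"
  shows "admissible_group (GL d (product_ring I K)) (GL_topology d (product_ring I K) (product_topology TK I)) SH dH"
    "finite_asdim_AN (carrier (GL d (product_ring I K))) dH"
proof -
  have "ring (K i)" if "i \<in> I" for i
    using K[OF that] by (simp add: local_field_def topological_field_def field_def domain_def cring_def)
  then interpret R: ring "product_ring I K" by (rule product_ring_ring)
  show ag: "admissible_group (GL d (product_ring I K)) (GL_topology d (product_ring I K) (product_topology TK I)) SH dH"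
    using R.GL_group S m by (simp add: admissible_group_def admissible_group_axioms_def)
  have "\<exists>L c \<pi>. i \<in> I \<longrightarrow> filtered_field (K i) L c \<pi> \<and> (\<forall>n. compactin (TK i) (L n)) \<and>
      (\<forall>C. compactin (TK i) C \<longrightarrow> (\<exists>n. C \<subseteq> L n))" for i
  proof (cases "i \<in> I")
    case True
    from local_field.filtration_exists[OF K[OF True]] show ?thesis by metis
  qed simp
  then obtain L c \<pi> where F: "\<And>i. i \<in> I \<Longrightarrow> filtered_field (K i) (L i) (c i) (\<pi> i) \<and> (\<forall>n. compactin (TK i) (L i n)) \<and>
      (\<forall>C. compactin (TK i) C \<longrightarrow> (\<exists>n. C \<subseteq> L i n))" by metis
  interpret product_GL d I K TK SH dH L c \<pi>
    using ag I K F by (simp add: product_GL_def product_GL_axioms_def)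
  show "finite_asdim_AN (carrier (GL d (product_ring I K))) dH" by (rule finite_asdim)
qed

section \<open>Pulling back covers along regular embeddings\<close>

text \<open>Pigeonhole: a chain reaching farther would meet the annuli at distances 2 j w to (2 j +
  1) w for \<open>card F + 1\<close> values of j. Two of these points would share a ball, hence be
  closer than 2 \<rho> \<le> w, while points of different annuli are more than w apart.\<close>

lemma (in Metric_space) chain_bounded:
  assumes E: "E \<subseteq> M" and F: "finite F" "F \<subseteq> M" "E \<subseteq> (\<Union>c\<in>F. mball c \<rho>)"
    and w: "0 < w" "s \<le> w" "2 * \<rho> \<le> w" and x: "x \<in> E"
    and xy: "(x, y) \<in> {(a, b). a \<in> E \<and> b \<in> E \<and> d a b \<le> s}\<^sup>*"
  shows "d x y \<le> (2 * real (card F) + 2) * w"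
proof (rule ccontr)
  assume big: "\<not> ?thesis"
  \<comment> \<open>A step of size at most w cannot jump over an annulus of width w.\<close>
  have annulus: "\<exists>z\<in>E. real k * w \<le> d x z \<and> d x z < (real k + 1) * w" if "real k * w \<le> d x y" for k :: nat
    using xy that
  proof (induction rule: rtrancl_induct)
    case base
    have dx: "d x x = 0" using x E by auto
    then have "real k * w \<le> 0" using base by simp
    then have "k = 0" using w(1) by (simp add: mult_le_0_iff)
    then show ?case using x w(1) dx by (intro bexI[of _ x]) auto
  next
    case (step y z)
    then have yz: "y \<in> E" "z \<in> E" "d y z \<le> s" by auto
    show ?case
    proof (cases "real k * w \<le> d x y")
      case True then show ?thesis using step.IH by blast
    next
      case False
      have "d x z \<le> d x y + d y z" using x yz E by (intro triangle) auto
      also have "\<dots> < real k * w + w" using False yz(3) w(2) by simp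
      finally show ?thesis using step.prems yz(2) by (intro bexI[of _ z]) (auto simp: algebra_simps)
    qed
  qed
  let ?m = "card F"
  have "\<exists>z\<in>E. real (2 * j) * w \<le> d x z \<and> d x z < (real (2 * j) + 1) * w" if "j \<le> ?m" for j
  proof (rule annulus)
    have "real (2 * j) * w \<le> (2 * real ?m + 2) * w" using that w(1) by (intro mult_right_mono) auto
    then show "real (2 * j) * w \<le> d x y" using big by simp
  qed
  then obtain z where z: "\<And>j. j \<le> ?m \<Longrightarrow> z j \<in> E \<and> real (2 * j) * w \<le> d x (z j) \<and> d x (z j) < (real (2 * j) + 1) * w"
    by metis
  have "\<exists>c\<in>F. z j \<in> mball c \<rho>" if "j \<le> ?m" for j using z[OF that] F(3) by blast
  then obtain c where c: "\<And>j. j \<le> ?m \<Longrightarrow> c j \<in> F \<and> z j \<in> mball (c j) \<rho>" by metis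
  have "\<not> inj_on c {..?m}"
  proof
    assume "inj_on c {..?m}"
    then have "card {..?m} \<le> card F" using c F(1) by (intro card_inj_on_le[of c]) auto
    then show False by simp
  qed
  then obtain i j where ij: "i \<le> ?m" "j \<le> ?m" "i \<noteq> j" "c i = c j" unfolding inj_on_def by auto
  then obtain i j where ij: "i \<le> ?m" "j \<le> ?m" "i < j" "c i = c j" by (metis nat_neq_iff)
  have zM: "z i \<in> M" "z j \<in> M" "x \<in> M" "c i \<in> M" using z ij c F(2) E x by auto
  have "d (z i) (z j) \<le> d (z i) (c i) + d (c i) (z j)" using zM by (intro triangle)
  also have "\<dots> < \<rho> + \<rho>" using c[OF ij(1)] c[OF ij(2)] ij(4) by (auto simp: commute)
  finally have 1: "d (z i) (z j) < w" using w(3) by simp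
  have "d x (z j) \<le> d x (z i) + d (z i) (z j)" using zM by (intro triangle)
  then have "real (2 * j) * w < (real (2 * i) + 1) * w + w" using 1 z[OF ij(1)] z[OF ij(2)] by linarith
  then have "real (2 * j) * w < (real (2 * i) + 2) * w" by (simp add: algebra_simps)
  then have "real (2 * j) < real (2 * i) + 2" using w(1) by simp
  then show False using ij(3) by simp
qed

text \<open>The volume is controlled by \<open>C ^ n\<close>, whereas the bound \<open>R\<close> on the diameters may depend on \<open>n\<close>
  arbitrarily.\<close>

definition volume_cover :: "'a set \<Rightarrow> ('a \<Rightarrow> 'a \<Rightarrow> real) \<Rightarrow> real \<Rightarrow> nat \<Rightarrow> nat \<Rightarrow> nat \<Rightarrow> 'a set set \<Rightarrow> bool" where
  "volume_cover X d \<rho> M C n \<U> \<longleftrightarrow> (\<forall>A\<in>\<U>. A \<subseteq> X) \<and>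
     (\<forall>x\<in>X. finite {A\<in>\<U>. x \<in> A} \<and> card {A\<in>\<U>. x \<in> A} \<le> M) \<and>
     (\<forall>x\<in>X. \<exists>A\<in>\<U>. Metric_space.mball X d x (real n) \<subseteq> A) \<and>
     (\<forall>A\<in>\<U>. \<exists>F\<subseteq>X. finite F \<and> card F \<le> C ^ n \<and> A \<subseteq> (\<Union>c\<in>F. Metric_space.mball X d c \<rho>)) \<and>
     (\<exists>R. \<forall>A\<in>\<U>. \<forall>x\<in>A. \<forall>y\<in>A. d x y \<le> R)"

text \<open>Preimages of sets of bounded diameter have bounded volume, but their diameters are not bounded
  uniformly; those of their components with respect to chains of step \<open>n\<close> are.\<close>

lemma regular_pullback_cover:
  fixes dX :: "'a \<Rightarrow> 'a \<Rightarrow> real"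
  assumes X: "Metric_space X dX" and H: "admissible_group H T S dH"
    and AN: "finite_asdim_AN (carrier H) dH" and f: "regular_embedding X dX (carrier H) dH f"
  shows "\<exists>\<rho> M C. 0 < \<rho> \<and> 1 \<le> C \<and> (\<forall>n\<ge>1. \<exists>\<U>. volume_cover X dX \<rho> M C n \<U>)"
proof -
  interpret X: Metric_space X dX by (rule X)
  interpret H: admissible_group H T S dH by (rule H)
  have fX: "\<And>x. x \<in> X \<Longrightarrow> f x \<in> carrier H" using f unfolding regular_embedding_def by blast
  obtain r \<rho> L Nr where r: "r > 0" "\<rho> > 0" "L > 0"
    and lip: "\<forall>x\<in>X. \<forall>x'\<in>X. dH (f x) (f x') \<le> L * dX x x' + L"
    and reg: "\<forall>y\<in>carrier H. \<exists>F\<subseteq>X. finite F \<and> card F \<le> (Nr :: nat) \<and>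
      {x \<in> X. f x \<in> H.mball y r} \<subseteq> (\<Union>c\<in>F. X.mball c \<rho>)"
    using f unfolding regular_embedding_def by (elim exE conjE) (rule that)
  obtain MC where "\<exists>C :: nat. \<forall>n\<ge>1. \<exists>\<U>.
     (\<forall>A\<in>\<U>. A \<subseteq> carrier H) \<and> (\<forall>x\<in>carrier H. finite {A\<in>\<U>. x \<in> A} \<and> card {A\<in>\<U>. x \<in> A} \<le> MC) \<and>
     (\<forall>x\<in>carrier H. \<exists>A\<in>\<U>. \<forall>y\<in>carrier H. dH x y \<le> real n \<longrightarrow> y \<in> A) \<and>
     (\<forall>A\<in>\<U>. \<forall>x\<in>A. \<forall>y\<in>A. dH x y \<le> real (C * n))"
    using AN unfolding finite_asdim_AN_def ..
  then obtain C where "\<forall>n\<ge>1. \<exists>\<U>.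
     (\<forall>A\<in>\<U>. A \<subseteq> carrier H) \<and> (\<forall>x\<in>carrier H. finite {A\<in>\<U>. x \<in> A} \<and> card {A\<in>\<U>. x \<in> A} \<le> MC) \<and>
     (\<forall>x\<in>carrier H. \<exists>A\<in>\<U>. \<forall>y\<in>carrier H. dH x y \<le> real n \<longrightarrow> y \<in> A) \<and>
     (\<forall>A\<in>\<U>. \<forall>x\<in>A. \<forall>y\<in>A. dH x y \<le> real (C * n))" ..
  note AN' = this[THEN spec, THEN mp]
  from H.ball_cover_exponential[OF r(1)] obtain N0 where N0': "N0 \<ge> 1 \<and> (\<forall>n\<ge>1. \<forall>x\<in>carrier H. \<exists>F\<subseteq>carrier H. finite F \<and>
    card F \<le> N0 ^ n \<and> {y \<in> carrier H. dH x y \<le> real n} \<subseteq> (\<Union>c\<in>F. H.mball c r))" ..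
  note N0 = N0'[THEN conjunct1] N0'[THEN conjunct2, THEN spec, THEN mp, THEN bspec]
  \<comment> \<open>Points at distance below n have images at distance at most L * n + L \<le> 2 * L
    * n, so the cover of H is taken at scale l * n.\<close>
  define l where "l = nat \<lceil>2 * L\<rceil>"
  have l: "2 * L \<le> real l" unfolding l_def by linarith
  then have l1: "1 \<le> l" using r(3) by (cases l) auto
  define N1 where "N1 = max 1 Nr"
  \<comment> \<open>A member of the cover of H lies in a ball of radius (C + 1) * l * n, hence in
    \<open>N0 ^ ((C + 1) * (l * n))\<close> balls of radius r, and the preimage of each needs at
    most \<open>Nr\<close> balls. The factor \<open>N1\<close> is enlarged to \<open>N1 ^ n\<close>;
    the summand 1 keeps the radius positive when C is 0.\<close>
  define D where "D = N1 * N0 ^ ((C + 1) * l)"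
  show ?thesis
  proof (rule exI[of _ \<rho>], rule exI[of _ MC], rule exI[of _ D], intro conjI allI impI)
    show "0 < \<rho>" by (rule r(2))
    show "1 \<le> D" unfolding D_def N1_def using N0(1) by simp
    fix n :: nat assume n: "1 \<le> n"
    have nl: "1 \<le> l * n" using l1 n by simp
    obtain \<V> where V: "\<forall>A\<in>\<V>. A \<subseteq> carrier H"
       "\<forall>x\<in>carrier H. finite {A\<in>\<V>. x \<in> A} \<and> card {A\<in>\<V>. x \<in> A} \<le> MC"
       "\<forall>x\<in>carrier H. \<exists>A\<in>\<V>. \<forall>y\<in>carrier H. dH x y \<le> real (l * n) \<longrightarrow> y \<in> A"
       "\<forall>A\<in>\<V>. \<forall>x\<in>A. \<forall>y\<in>A. dH x y \<le> real (C * (l * n))" using AN'[OF nl] by (elim exE conjE) (rule that)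
    define P where "P = (\<lambda>V. {x \<in> X. f x \<in> V})"
    define Rel where "Rel = (\<lambda>V. {(a, b). a \<in> P V \<and> b \<in> P V \<and> dX a b \<le> real n})"
    define comp where "comp = (\<lambda>V x. {y. (x, y) \<in> (Rel V)\<^sup>*})"
    define \<U> where "\<U> = {comp V x | V x. V \<in> \<V> \<and> x \<in> P V}"
    have symR: "sym ((Rel V)\<^sup>*)" for V
      by (rule sym_rtrancl) (auto simp: sym_def Rel_def X.commute)
    have compP: "comp V x \<subseteq> P V" if "x \<in> P V" for V x
    proof
      fix y assume "y \<in> comp V x"
      then have "(x, y) \<in> (Rel V)\<^sup>*" unfolding comp_def by simp
      then show "y \<in> P V" by (induction rule: rtrancl_induct) (use that in \<open>auto simp: Rel_def\<close>)
    qed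
    have comp_eq: "comp V x = comp V y" if "y \<in> comp V x" for V x y
    proof -
      have xy: "(x, y) \<in> (Rel V)\<^sup>*" using that unfolding comp_def by simp
      then have yx: "(y, x) \<in> (Rel V)\<^sup>*" using symR[of V] by (meson symD)
      show ?thesis unfolding comp_def using rtrancl_trans[OF xy] rtrancl_trans[OF yx] by blast
    qed
    have cover: "\<exists>F\<subseteq>X. finite F \<and> card F \<le> D ^ n \<and> P V \<subseteq> (\<Union>c\<in>F. X.mball c \<rho>)" if V1: "V \<in> \<V>" "x \<in> P V" for V x
    proof -
      have fx: "f x \<in> V" "f x \<in> carrier H" using V1(2) fX unfolding P_def by auto
      have n2: "1 \<le> (C + 1) * (l * n)" using mult_le_mono[of 1 "C + 1" 1 "l * n"] nl by linarith
      from N0(2)[OF n2 fx(2)] obtain F where F: "F \<subseteq> carrier H" "finite F" "card F \<le> N0 ^ ((C + 1) * (l * n))"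
        "{y \<in> carrier H. dH (f x) y \<le> real ((C + 1) * (l * n))} \<subseteq> (\<Union>c\<in>F. H.mball c r)" by (elim exE conjE) (rule that)
      have "\<forall>c. \<exists>E. c \<in> F \<longrightarrow> E \<subseteq> X \<and> finite E \<and> card E \<le> Nr \<and> {x \<in> X. f x \<in> H.mball c r} \<subseteq> (\<Union>c\<in>E. X.mball c \<rho>)"
        using reg F(1) by (metis subsetD)
      from choice[OF this] obtain E where E: "\<And>c. c \<in> F \<Longrightarrow> E c \<subseteq> X \<and> finite (E c) \<and> card (E c) \<le> Nr \<and>
          {x \<in> X. f x \<in> H.mball c r} \<subseteq> (\<Union>c\<in>E c. X.mball c \<rho>)" by blast
      have "card (\<Union>c\<in>F. E c) \<le> (\<Sum>c\<in>F. card (E c))" by (rule card_UN_le[OF F(2)])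
      also have "\<dots> \<le> (\<Sum>c\<in>F. Nr)" using E by (intro sum_mono) auto
      also have "\<dots> = card F * Nr" by simp
      also have "\<dots> \<le> N0 ^ ((C + 1) * (l * n)) * N1" unfolding N1_def using F(3) by (intro mult_mono) auto
      also have "\<dots> \<le> N0 ^ ((C + 1) * (l * n)) * N1 ^ n"
        using n by (intro mult_left_mono self_le_power) (auto simp: N1_def)
      also have "\<dots> = D ^ n" unfolding D_def by (simp add: power_mult_distrib power_mult[symmetric] algebra_simps)
      finally have c: "card (\<Union>c\<in>F. E c) \<le> D ^ n" .
      have "P V \<subseteq> (\<Union>c\<in>(\<Union>c\<in>F. E c). X.mball c \<rho>)"
      proof
        fix y assume y: "y \<in> P V"
        then have fy: "f y \<in> V" "f y \<in> carrier H" "y \<in> X" using fX unfolding P_def by auto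
        have "dH (f x) (f y) \<le> real (C * (l * n))" using V(4) V1(1) fx(1) fy(1) by blast
        also have "\<dots> \<le> real ((C + 1) * (l * n))" by (intro of_nat_mono mult_right_mono) auto
        finally obtain c where cF: "c \<in> F" "f y \<in> H.mball c r" using F(4) fy(2) by blast
        then have "y \<in> (\<Union>c\<in>E c. X.mball c \<rho>)" using E[OF cF(1)] fy(3) by blast
        then show "y \<in> (\<Union>c\<in>(\<Union>c\<in>F. E c). X.mball c \<rho>)" using cF(1) by blast
      qed
      moreover have "(\<Union>c\<in>F. E c) \<subseteq> X" "finite (\<Union>c\<in>F. E c)" using E F(2) by auto
      ultimately show ?thesis using c by (intro exI[of _ "\<Union>c\<in>F. E c"]) simp
    qed
    define w where "w = real n + 2 * \<rho>"
    show "\<exists>\<U>. volume_cover X dX \<rho> MC D n \<U>" unfolding volume_cover_def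
    proof (rule exI[of _ \<U>], intro conjI ballI)
      show "A \<subseteq> X" if "A \<in> \<U>" for A using that compP unfolding \<U>_def P_def by blast
    next
      fix x assume x: "x \<in> X"
      \<comment> \<open>A point lies in only one component of each preimage, so passing to
        components does not raise the multiplicity.\<close>
      have "{A \<in> \<U>. x \<in> A} \<subseteq> (\<lambda>V. comp V x) ` {V \<in> \<V>. f x \<in> V}"
      proof
        fix A assume "A \<in> {A \<in> \<U>. x \<in> A}"
        then obtain V y where Vy: "V \<in> \<V>" "y \<in> P V" "A = comp V y" "x \<in> comp V y" unfolding \<U>_def by blast
        have "f x \<in> V" using compP[OF Vy(2)] Vy(4) unfolding P_def by blast
        then show "A \<in> (\<lambda>V. comp V x) ` {V \<in> \<V>. f x \<in> V}" using Vy comp_eq[OF Vy(4)] by blast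
      qed
      moreover have "finite {V \<in> \<V>. f x \<in> V}" "card {V \<in> \<V>. f x \<in> V} \<le> MC" using V(2) fX[OF x] by auto
      ultimately show "finite {A \<in> \<U>. x \<in> A}" "card {A \<in> \<U>. x \<in> A} \<le> MC"
        by (meson card_image_le card_mono finite_imageI finite_subset le_trans)+
      obtain V where V1: "V \<in> \<V>" "\<And>y. y \<in> carrier H \<Longrightarrow> dH (f x) y \<le> real (l * n) \<Longrightarrow> y \<in> V"
        using V(3) fX[OF x] by blast
      have inV: "f y \<in> V" if y: "y \<in> X" "dX x y < real n" for y
      proof (rule V1(2)[OF fX[OF y(1)]])
        have "dH (f x) (f y) \<le> L * dX x y + L" using lip x y(1) by blast
        also have "\<dots> \<le> L * real n + L * real n" using y(2) n r(3) by (intro add_mono mult_left_mono) auto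
        also have "\<dots> = 2 * L * real n" by simp
        also have "\<dots> \<le> real l * real n" using l by (intro mult_right_mono) auto
        finally show "dH (f x) (f y) \<le> real (l * n)" by simp
      qed
      have xP: "x \<in> P V" unfolding P_def using x inV[OF x] n by simp
      have "X.mball x (real n) \<subseteq> comp V x"
      proof
        fix y assume "y \<in> X.mball x (real n)"
        then have y: "y \<in> X" "dX x y < real n" by auto
        then have "(x, y) \<in> Rel V" using xP inV[OF y] unfolding Rel_def P_def by auto
        then show "y \<in> comp V x" unfolding comp_def by blast
      qed
      then show "\<exists>A\<in>\<U>. X.mball x (real n) \<subseteq> A" unfolding \<U>_def using V1(1) xP by blast
    next
      fix A assume "A \<in> \<U>"
      then obtain V x where Vx: "V \<in> \<V>" "x \<in> P V" "A = comp V x" unfolding \<U>_def by blast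
      from cover[OF Vx(1,2)] obtain F where "F \<subseteq> X" "finite F" "card F \<le> D ^ n" "P V \<subseteq> (\<Union>c\<in>F. X.mball c \<rho>)" by (elim exE conjE) (rule that)
      then show "\<exists>F\<subseteq>X. finite F \<and> card F \<le> D ^ n \<and> A \<subseteq> (\<Union>c\<in>F. X.mball c \<rho>)"
        using compP[OF Vx(2)] Vx(3) by (metis order_trans)
    next
      show "\<exists>R. \<forall>A\<in>\<U>. \<forall>x\<in>A. \<forall>y\<in>A. dX x y \<le> R"
      proof (rule exI[of _ "(2 * real (D ^ n) + 2) * w"], intro ballI)
        fix A y z assume "A \<in> \<U>" "y \<in> A" "z \<in> A"
        then obtain V x where Vx: "V \<in> \<V>" "x \<in> P V" "y \<in> comp V x" "z \<in> comp V x" unfolding \<U>_def by blast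
        have yP: "y \<in> P V" using compP[OF Vx(2)] Vx(3) by blast
        have yz: "(y, z) \<in> (Rel V)\<^sup>*" using Vx(4) comp_eq[OF Vx(3)] unfolding comp_def by blast
        from cover[OF Vx(1,2)] obtain F where F: "F \<subseteq> X" "finite F" "card F \<le> D ^ n" "P V \<subseteq> (\<Union>c\<in>F. X.mball c \<rho>)" by (elim exE conjE) (rule that)
        have "dX y z \<le> (2 * real (card F) + 2) * w"
          by (rule X.chain_bounded[OF _ F(2,1,4) _ _ _ yP yz[unfolded Rel_def]])
             (use n r(2) in \<open>auto simp: w_def P_def\<close>)
        also have "\<dots> \<le> (2 * real (D ^ n) + 2) * w"
          using of_nat_mono[OF F(3), where 'a = real] n r(2) unfolding w_def by (intro mult_right_mono) auto
        finally show "dX y z \<le> (2 * real (D ^ n) + 2) * w" .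
      qed
    qed
  qed
qed

section \<open>Mass transport in an amenable unimodular group\<close>

locale haar_group = admissible_group G T S d for G (structure) and T S d +
  fixes \<mu> :: "'a measure"
  assumes top_group: "topological_group G T"
    and haar: "left_haar_measure G T \<mu>"
    and unimod: "unimodular G T"
begin

lemma cont_inv: "continuous_map T T (\<lambda>x. inv x)"
  using top_group by (simp add: topological_group_def topological_group_axioms_def)

lemma cont_mult2:
  assumes "continuous_map Z T f" "continuous_map Z T g"
  shows "continuous_map Z T (\<lambda>z. f z \<otimes> g z)"
proof -
  have "continuous_map Z (prod_topology T T) (\<lambda>z. (f z, g z))"
    using assms by (simp add: continuous_map_pairwise o_def)
  moreover have "continuous_map (prod_topology T T) T (\<lambda>(x, y). x \<otimes> y)"
    using top_group by (simp add: topological_group_def topological_group_axioms_def)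
  ultimately show ?thesis using continuous_map_compose by (fastforce simp: o_def)
qed

lemma space_\<mu>: "space \<mu> = carrier G"
  using haar top_T by (simp add: left_haar_measure_def)

lemma open_sets: "openin T U \<Longrightarrow> U \<in> sets \<mu>"
  using haar by (auto simp: left_haar_measure_def)

lemma open_ball: "openin T (mball x r)"
  using openin_mball mtop by simp

lemma sets_ball: "mball x r \<in> sets \<mu>"
  by (rule open_sets[OF open_ball])

lemma emeasure_left: "g \<in> carrier G \<Longrightarrow> A \<in> sets \<mu> \<Longrightarrow> emeasure \<mu> (g <# A) = emeasure \<mu> A"
  using haar by (simp add: left_haar_measure_def)

lemma emeasure_right: "g \<in> carrier G \<Longrightarrow> A \<in> sets \<mu> \<Longrightarrow> emeasure \<mu> (A #> g) = emeasure \<mu> A"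
  using haar unimod by (simp add: unimodular_def)

lemma emeasure_bounded:
  assumes "A \<subseteq> mcball x r" "x \<in> carrier G"
  shows "emeasure \<mu> A < \<infinity>"
proof -
  have c: "compactin T (mcball x r)" by (rule compact_cball[OF assms(2)])
  then have "emeasure \<mu> (mcball x r) < \<infinity>" using haar by (simp add: left_haar_measure_def)
  moreover have "mcball x r \<in> sets \<mu>"
  proof -
    have "carrier G - mcball x r \<in> sets \<mu>"
      by (rule open_sets) (use closedin_mcball mtop top_T in \<open>simp add: closedin_def\<close>)
    then have "space \<mu> - (space \<mu> - mcball x r) \<in> sets \<mu>" unfolding space_\<mu> by (metis space_\<mu> sets.compl_sets)
    then show ?thesis unfolding space_\<mu> using mcball_subset_mspace by (simp add: double_diff)
  qed
  ultimately show ?thesis using emeasure_mono[OF assms(1)] by (metis le_less_trans)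
qed

lemma ball_translate: "x \<in> carrier G \<Longrightarrow> x <# mball \<one> r = mball x r"
proof (intro equalityI subsetI)
  fix y assume x: "x \<in> carrier G" and "y \<in> x <# mball \<one> r"
  then obtain b where b: "b \<in> mball \<one> r" "y = x \<otimes> b" unfolding l_coset_def by blast
  then show "y \<in> mball x r" using mball_translate[of x \<one> b r] x by auto
next
  fix y assume x: "x \<in> carrier G" and y: "y \<in> mball x r"
  have "inv x \<otimes> y \<in> mball \<one> r" using mball_translate[of "inv x" x y r] x y by simp
  moreover have "x \<otimes> (inv x \<otimes> y) = y" using x y m_assoc[of x "inv x" y] by simp
  ultimately show "y \<in> x <# mball \<one> r" unfolding l_coset_def by force
qed

lemma emeasure_ball: "x \<in> carrier G \<Longrightarrow> emeasure \<mu> (mball x r) = emeasure \<mu> (mball \<one> r)"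
  using emeasure_left[OF _ sets_ball[of \<one> r], of x] ball_translate by simp

lemma emeasure_ball_finite: "x \<in> carrier G \<Longrightarrow> emeasure \<mu> (mball x r) < \<infinity>"
  by (rule emeasure_bounded[OF mball_subset_mcball])

text \<open>Otherwise all balls of radius r would be null sets, and countably many of them cover the
  group.\<close>

lemma emeasure_ball_pos:
  assumes r: "r > 0"
  shows "emeasure \<mu> (mball \<one> r) > 0"
proof (rule ccontr)
  assume "\<not> ?thesis"
  then have z: "emeasure \<mu> (mball x r) = 0" if "x \<in> carrier G" for x using emeasure_ball[OF that] by simp
  have "\<exists>F. finite F \<and> F \<subseteq> carrier G \<and> mcball \<one> (real n) \<subseteq> (\<Union>c\<in>F. mball c r)" for n by (rule cball_cover[OF r])
  then obtain F where F: "\<And>n. finite (F n) \<and> F n \<subseteq> carrier G \<and> mcball \<one> (real n) \<subseteq> (\<Union>c\<in>F n. mball c r)" by metis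
  let ?N = "\<Union>n. \<Union>c\<in>F n. mball c r"
  have "(\<Union>c\<in>F n. mball c r) \<in> null_sets \<mu>" for n
  proof (rule null_sets_UN')
    show "countable (F n)" using F by (simp add: countable_finite)
    show "mball c r \<in> null_sets \<mu>" if "c \<in> F n" for c
      by (rule null_setsI[OF z sets_ball]) (use F that in blast)
  qed
  then have "?N \<in> null_sets \<mu>" by (rule null_sets_UN)
  moreover have "carrier G \<subseteq> ?N"
  proof
    fix x assume x: "x \<in> carrier G"
    obtain n where "d \<one> x \<le> real n" using real_arch_simple by blast
    then have "x \<in> mcball \<one> (real n)" using x by simp
    then have "x \<in> (\<Union>c\<in>F n. mball c r)" using F[of n] by (meson subsetD)
    then show "x \<in> ?N" by blast
  qed
  ultimately have "emeasure \<mu> (space \<mu>) = 0" unfolding space_\<mu> using emeasure_mono[of "carrier G" ?N \<mu>]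
    by (metis le_zero_eq null_setsD1 null_setsD2)
  then show False using haar by (simp add: left_haar_measure_def)
qed

lemma openin_inv_image:
  assumes "openin T U"
  shows "openin T ((\<lambda>x. inv x) ` U)"
proof -
  have U: "U \<subseteq> carrier G" using openin_subset[OF assms] top_T by simp
  have "(\<lambda>x. inv x) ` U = {x \<in> topspace T. inv x \<in> U}"
    using U by (auto simp: top_T) (metis image_eqI inv_inv)
  then show ?thesis using openin_continuous_map_preimage[OF cont_inv assms] by simp
qed

text \<open>Inversion turns xB into B x^(-1), because the ball B about \<open>\<one>\<close> is
  symmetric; right invariance does the rest.\<close>

lemma emeasure_inv_ball:
  assumes x: "x \<in> carrier G"
  shows "emeasure \<mu> ((\<lambda>x. inv x) ` mball x r) = emeasure \<mu> (mball \<one> r)"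
proof -
  have "(\<lambda>x. inv x) ` mball x r = mball \<one> r #> inv x"
  proof (intro equalityI subsetI)
    fix y assume "y \<in> (\<lambda>x. inv x) ` mball x r"
    then obtain z where z: "z \<in> mball x r" "y = inv z" by blast
    then have zc: "z \<in> carrier G" "d x z < r" by auto
    have "inv (inv x \<otimes> z) \<in> mball \<one> r" using d_one_inv[of "inv x \<otimes> z"] d_one[OF x zc(1)] zc x by simp
    moreover have "inv (inv x \<otimes> z) \<otimes> inv x = inv z" using x zc by (simp add: inv_mult_group m_assoc)
    ultimately show "y \<in> mball \<one> r #> inv x" unfolding r_coset_def z(2) by force
  next
    fix y assume "y \<in> mball \<one> r #> inv x"
    then obtain b where b: "b \<in> mball \<one> r" "y = b \<otimes> inv x" unfolding r_coset_def by blast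
    have bc: "b \<in> carrier G" "d \<one> b < r" using b(1) by auto
    have "x \<otimes> inv b \<in> mball x r" using d_right[OF x, of "inv b"] d_one_inv[OF bc(1)] bc x by simp
    moreover have "y = inv (x \<otimes> inv b)" unfolding b(2) using x bc by (simp add: inv_mult_group)
    ultimately show "y \<in> (\<lambda>x. inv x) ` mball x r" by blast
  qed
  then show ?thesis using emeasure_right[OF inv_closed[OF x] sets_ball[of \<one> r]] by simp
qed

text \<open>The points whose distance to the complement of \<open>A\<close> exceeds \<open>a\<close>.\<close>

definition depth :: "'a set \<Rightarrow> real \<Rightarrow> 'a set" where
  "depth A a = {g \<in> carrier G. \<exists>r>a. mball g r \<subseteq> A}"

text \<open>Depth is 1-Lipschitz; every unit shift of depth further on comes from this.\<close>

lemma depth_move: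
  assumes g: "g \<in> depth A (a + s)" and h: "h \<in> carrier G" "d g h \<le> s"
  shows "h \<in> depth A a"
proof -
  obtain r where r: "r > a + s" "mball g r \<subseteq> A" "g \<in> carrier G" using g unfolding depth_def by blast
  have "mball h (r - s) \<subseteq> mball g r" by (rule mball_subset) (use h r(3) in \<open>auto simp: commute\<close>)
  then show ?thesis unfolding depth_def using r h by (intro CollectI conjI exI[of _ "r - s"]) auto
qed

lemma openin_depth: "openin T (depth A a)"
proof -
  have "\<exists>\<epsilon>>0. mball g \<epsilon> \<subseteq> depth A a" if g: "g \<in> depth A a" for g
  proof -
    obtain r where r: "r > a" "mball g r \<subseteq> A" "g \<in> carrier G" using g unfolding depth_def by blast
    define \<epsilon> where "\<epsilon> = (r - a) / 2"
    have "g \<in> depth A (a + \<epsilon>)" unfolding depth_def using r by (auto simp: \<epsilon>_def intro!: exI[of _ r] simp: field_simps)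
    then have "mball g \<epsilon> \<subseteq> depth A a" using depth_move by auto
    then show ?thesis using r(1) by (intro exI[of _ \<epsilon>]) (simp add: \<epsilon>_def)
  qed
  moreover have "depth A a \<subseteq> carrier G" unfolding depth_def by blast
  ultimately show ?thesis unfolding mtop[symmetric] openin_mtopology by blast
qed

lemma depth_carrier: "depth A a \<subseteq> carrier G"
  unfolding depth_def by blast

lemma depth_subset: "0 \<le> a \<Longrightarrow> depth A a \<subseteq> A"
  unfolding depth_def using centre_in_mball_iff by (smt (verit, best) mem_Collect_eq subset_iff)

lemma depth_mono: "a \<le> b \<Longrightarrow> depth A b \<subseteq> depth A a"
  unfolding depth_def by force

lemma sets_depth: "depth A a \<in> sets \<mu>"
  by (rule open_sets[OF openin_depth])

lemma sets_inv_depth: "(\<lambda>x. inv x) ` depth A a \<in> sets \<mu>"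
  by (rule open_sets[OF openin_inv_image[OF openin_depth]])

lemma separated_finite:
  assumes N: "N \<subseteq> mcball x R" "x \<in> carrier G" and sep: "\<And>y z. y \<in> N \<Longrightarrow> z \<in> N \<Longrightarrow> y \<noteq> z \<Longrightarrow> \<not> d y z < 2"
  shows "finite N"
proof -
  from cball_cover[OF zero_less_one, of R] obtain F
    where F: "finite F" "F \<subseteq> carrier G" "mcball \<one> R \<subseteq> (\<Union>c\<in>F. mball c 1)" by (elim exE conjE) (rule that)
  have "\<exists>c\<in>F. inv x \<otimes> y \<in> mball c 1" if y: "y \<in> N" for y
  proof -
    have y': "y \<in> carrier G" "d x y \<le> R" using N(1) y by auto
    then have "inv x \<otimes> y \<in> mcball \<one> R" using d_one[OF N(2) y'(1)] N(2) by simp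
    then show ?thesis using F(3) by blast
  qed
  then obtain c where c: "\<And>y. y \<in> N \<Longrightarrow> c y \<in> F \<and> inv x \<otimes> y \<in> mball (c y) 1" by metis
  have "inj_on c N"
  proof (rule inj_onI, rule ccontr)
    fix y z assume yz: "y \<in> N" "z \<in> N" "c y = c z" "y \<noteq> z"
    have G: "y \<in> carrier G" "z \<in> carrier G" using N(1) yz by auto
    have "d (inv x \<otimes> y) (inv x \<otimes> z) \<le> d (inv x \<otimes> y) (c y) + d (c y) (inv x \<otimes> z)"
      using c[OF yz(1)] G N(2) by (intro triangle) auto
    also have "\<dots> < 1 + 1" using c[OF yz(1)] c[OF yz(2)] yz(3) by (intro add_strict_mono) (auto simp: commute)
    finally have "d y z < 2" using left_inv[of "inv x" y z] G N(2) by simp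
    then show False using sep yz by blast
  qed
  then show ?thesis using c F(1) by (meson finite_imageD finite_subset image_subsetI)
qed

text \<open>A coarse substitute for the invariance of \<open>\<mu>\<close> under inversion, which would require the uniqueness
  of the Haar measure: balls and their inverses have the same measure.\<close>

lemma emeasure_depth_le_inverse:
  assumes b: "\<And>x y. x \<in> A \<Longrightarrow> y \<in> A \<Longrightarrow> d x y \<le> R" and a: "0 \<le> a"
  shows "emeasure \<mu> (depth A (a + 1)) * emeasure \<mu> (mball \<one> 1)
    \<le> emeasure \<mu> (mball \<one> 2) * emeasure \<mu> ((\<lambda>x. inv x) ` depth A a)"
proof -
  let ?E = "depth A (a + 1)"
  have EA: "?E \<subseteq> A" using a by (intro depth_subset) simp
  \<comment> \<open>Unit balls about the 2-separated set N are disjoint and stay in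
    \<open>depth A a\<close>, and so do their inverses in its inverse; balls of radius 2 about N
    cover \<open>depth A (a + 1)\<close>. Eliminating \<open>card N\<close> leaves the two ball
    volumes.\<close>
  have "\<exists>N\<subseteq>?E. (\<forall>x\<in>N. \<forall>y\<in>N. x \<noteq> y \<longrightarrow> \<not> d x y < 2) \<and> (\<forall>x\<in>?E. \<exists>z\<in>N. d z x < 2)"
    by (rule maximal_separated) (use depth_carrier commute in \<open>auto simp: subset_iff\<close>)
  then obtain N where N': "N \<subseteq> ?E \<and> (\<forall>x\<in>N. \<forall>y\<in>N. x \<noteq> y \<longrightarrow> \<not> d x y < 2) \<and> (\<forall>x\<in>?E. \<exists>z\<in>N. d z x < 2)" ..
  note N = N'[THEN conjunct1] N'[THEN conjunct2, THEN conjunct1, THEN bspec, THEN bspec, THEN mp]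
    N'[THEN conjunct2, THEN conjunct2, THEN bspec]
  have NG: "N \<subseteq> carrier G" using N(1) depth_carrier by blast
  have fin: "finite N"
  proof (cases "N = {}")
    case False
    then obtain x where x: "x \<in> N" by blast
    have "N \<subseteq> mcball x R"
    proof
      fix y assume "y \<in> N"
      then have "y \<in> A" "x \<in> A" "y \<in> carrier G" "x \<in> carrier G" using N(1) EA NG x by blast+
      then show "y \<in> mcball x R" using b by simp
    qed
    then show ?thesis using separated_finite[of N x R] N(2) x NG by blast
  qed simp
  have disj: "disjoint_family_on (\<lambda>z. (\<lambda>x. inv x) ` mball z 1) N"
  proof (unfold disjoint_family_on_def, intro ballI impI)
    fix y z assume yz: "y \<in> N" "z \<in> N" "y \<noteq> z"
    have "disjnt (mball y 1) (mball z 1)" by (rule disjoint_mball) (use N(2)[OF yz] in simp)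
    then show "(\<lambda>x. inv x) ` mball y 1 \<inter> (\<lambda>x. inv x) ` mball z 1 = {}"
      by (auto simp: disjnt_iff)
  qed
  have "of_nat (card N) * emeasure \<mu> (mball \<one> 1) = (\<Sum>z\<in>N. emeasure \<mu> (mball \<one> 1))" by (rule sum_constant[symmetric])
  also have "\<dots> = (\<Sum>z\<in>N. emeasure \<mu> ((\<lambda>x. inv x) ` mball z 1))"
    by (rule sum.cong[OF refl emeasure_inv_ball[symmetric]]) (use NG in blast)
  also have "\<dots> = emeasure \<mu> (\<Union>z\<in>N. (\<lambda>x. inv x) ` mball z 1)"
    by (rule sum_emeasure[OF _ disj fin]) (use open_sets openin_inv_image open_ball in blast)
  also have "\<dots> \<le> emeasure \<mu> ((\<lambda>x. inv x) ` depth A a)"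
  proof (rule emeasure_mono[OF _ sets_inv_depth])
    have "mball z 1 \<subseteq> depth A a" if "z \<in> N" for z using depth_move[of z A a 1] N(1) that by auto
    then show "(\<Union>z\<in>N. (\<lambda>x. inv x) ` mball z 1) \<subseteq> (\<lambda>x. inv x) ` depth A a" by blast
  qed
  finally have 1: "of_nat (card N) * emeasure \<mu> (mball \<one> 1) \<le> emeasure \<mu> ((\<lambda>x. inv x) ` depth A a)" .
  have "?E \<subseteq> (\<Union>z\<in>N. mball z 2)"
  proof
    fix x assume x: "x \<in> ?E"
    then obtain z where z: "z \<in> N" "d z x < 2" using N(3) by blast
    then have "x \<in> mball z 2" using x NG depth_carrier[of A "a + 1"] by auto
    then show "x \<in> (\<Union>z\<in>N. mball z 2)" using z(1) by blast
  qed
  moreover have "(\<Union>z\<in>N. mball z 2) \<in> sets \<mu>" by (rule sets.finite_UN[OF fin sets_ball])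
  ultimately have "emeasure \<mu> ?E \<le> emeasure \<mu> (\<Union>z\<in>N. mball z 2)" by (rule emeasure_mono)
  also have "\<dots> \<le> (\<Sum>z\<in>N. emeasure \<mu> (mball z 2))"
    by (rule emeasure_subadditive_finite[OF fin]) (use sets_ball in blast)
  also have "\<dots> = (\<Sum>z\<in>N. emeasure \<mu> (mball \<one> 2))"
    by (rule sum.cong[OF refl emeasure_ball]) (use NG in blast)
  also have "\<dots> = of_nat (card N) * emeasure \<mu> (mball \<one> 2)" by (rule sum_constant)
  finally have "emeasure \<mu> ?E * emeasure \<mu> (mball \<one> 1) \<le> of_nat (card N) * emeasure \<mu> (mball \<one> 2) * emeasure \<mu> (mball \<one> 1)"
    by (rule mult_right_mono) simp
  also have "\<dots> = emeasure \<mu> (mball \<one> 2) * (of_nat (card N) * emeasure \<mu> (mball \<one> 1))" by (simp add: mult_ac)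
  also have "\<dots> \<le> emeasure \<mu> (mball \<one> 2) * emeasure \<mu> ((\<lambda>x. inv x) ` depth A a)" by (rule mult_left_mono[OF 1]) simp
  finally show ?thesis .
qed

text \<open>The two functions \<open>s \<mapsto> g \<otimes> s\<close> and \<open>s \<mapsto> h \<otimes> inv s\<close> must be nearly constant on the pieces simultaneously.\<close>

lemma fine_partition:
  obtains n :: nat and c Q where "\<And>k. k < n \<Longrightarrow> c k \<in> carrier G" "\<And>k. k < n \<Longrightarrow> Q k \<in> sets \<mu>"
    "disjoint_family_on Q {..<n}" "mball \<one> R \<subseteq> (\<Union>k<n. Q k)" "\<And>k. k < n \<Longrightarrow> Q k \<subseteq> mball \<one> R"
    "\<And>k s. k < n \<Longrightarrow> s \<in> Q k \<Longrightarrow> d s (c k) < 1 \<and> d (inv s) (inv (c k)) < 1"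
proof -
  define V where "V = (\<lambda>c. mball c 1 \<inter> {s \<in> topspace T. inv s \<in> mball (inv c) 1})"
  have oV: "openin T (V c)" for c
    unfolding V_def by (intro openin_Int open_ball openin_continuous_map_preimage[OF cont_inv])
  have "mcball \<one> R \<subseteq> \<Union> (V ` carrier G)"
  proof
    fix x assume "x \<in> mcball \<one> R"
    then have "x \<in> carrier G" by simp
    then show "x \<in> \<Union> (V ` carrier G)" unfolding V_def top_T by fastforce
  qed
  moreover have "openin T U" if "U \<in> V ` carrier G" for U using that oV by blast
  ultimately obtain \<F> where F: "finite \<F>" "\<F> \<subseteq> V ` carrier G" "mcball \<one> R \<subseteq> \<Union> \<F>"
    using compactinD[OF compact_cball[OF one_closed, of R], of "V ` carrier G"] by metis
  obtain F where F': "finite F" "F \<subseteq> carrier G" "\<F> = V ` F" using finite_subset_image[OF F(1,2)] by blast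
  obtain c where c: "bij_betw c {0..<card F} F" using ex_bij_betw_nat_finite[OF F'(1)] by blast
  have cF: "c ` {..<card F} = F" using c by (simp add: bij_betw_def lessThan_atLeast0)
  define Q where "Q = (\<lambda>k. (mball \<one> R \<inter> V (c k)) - (\<Union>l<k. V (c l)))"
  show ?thesis
  proof (rule that[of "card F" c Q])
    show "c k \<in> carrier G" if "k < card F" for k using cF F'(2) that by blast
    show "Q k \<in> sets \<mu>" for k
      unfolding Q_def using open_sets[OF oV] sets_ball by (intro sets.Diff sets.Int sets.finite_UN) auto
    show "disjoint_family_on Q {..<card F}"
    proof (unfold disjoint_family_on_def, intro ballI impI)
      fix i j :: nat assume "i \<noteq> j"
      then consider "i < j" | "j < i" by linarith
      then show "Q i \<inter> Q j = {}" by cases (auto simp: Q_def)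
    qed
    show "mball \<one> R \<subseteq> (\<Union>k<card F. Q k)"
    proof
      fix x assume x: "x \<in> mball \<one> R"
      have "x \<in> \<Union> \<F>" using subsetD[OF F(3), of x] x by simp
      then have "x \<in> \<Union> (V ` (c ` {..<card F}))" unfolding F'(3) cF .
      then obtain k where k: "k < card F" "x \<in> V (c k)" by auto
      define l where "l = (LEAST l. x \<in> V (c l))"
      have "x \<in> V (c l)" unfolding l_def by (rule LeastI[of _ k]) (rule k)
      moreover have "l \<le> k" unfolding l_def by (rule Least_le) (rule k)
      moreover have "x \<notin> V (c j)" if "j < l" for j using that not_less_Least unfolding l_def by blast
      ultimately have "x \<in> Q l" "l < card F" using x k unfolding Q_def by auto
      then show "x \<in> (\<Union>k<card F. Q k)" by blast
    qed
    show "Q k \<subseteq> mball \<one> R" for k unfolding Q_def by blast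
    show "d s (c k) < 1 \<and> d (inv s) (inv (c k)) < 1" if "s \<in> Q k" for k s
      using that unfolding Q_def V_def by (auto simp: commute)
  qed
qed

lemma lsc_Linfty:
  assumes "\<And>a. openin T {x \<in> carrier G. a < f x}" and "\<And>x. x \<in> carrier G \<Longrightarrow> \<bar>f x\<bar> \<le> C"
  shows "f \<in> Linfty \<mu>"
proof -
  have "f \<in> borel_measurable \<mu>"
    unfolding borel_measurable_iff_greater space_\<mu> using open_sets assms(1) by blast
  moreover have "AE x in \<mu>. \<bar>f x\<bar> \<le> C" by (rule AE_I2) (use assms(2) space_\<mu> in simp)
  ultimately show ?thesis unfolding Linfty_def by blast
qed

lemma Linfty_sum:
  assumes "finite F" "\<And>k. k \<in> F \<Longrightarrow> f k \<in> Linfty \<mu>"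
  shows "(\<lambda>x. \<Sum>k\<in>F. w k * f k x) \<in> Linfty \<mu>"
  using assms
proof (induction F rule: finite_induct)
  case empty
  have "AE x in \<mu>. \<bar>0\<bar> \<le> (0::real)" by simp
  then show ?case unfolding Linfty_def by auto
next
  case (insert a F)
  obtain C1 where C1: "f a \<in> borel_measurable \<mu>" "AE x in \<mu>. \<bar>f a x\<bar> \<le> C1" using insert unfolding Linfty_def by blast
  obtain C2 where C2: "(\<lambda>x. \<Sum>k\<in>F. w k * f k x) \<in> borel_measurable \<mu>" "AE x in \<mu>. \<bar>\<Sum>k\<in>F. w k * f k x\<bar> \<le> C2"
    using insert unfolding Linfty_def by blast
  have "AE x in \<mu>. \<bar>w a * f a x + (\<Sum>k\<in>F. w k * f k x)\<bar> \<le> \<bar>w a\<bar> * C1 + C2"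
    using C1(2) C2(2)
  proof eventually_elim
    case (elim x)
    have "\<bar>w a * f a x\<bar> \<le> \<bar>w a\<bar> * C1" using elim(1) by (simp add: abs_mult mult_left_mono)
    then show ?case using elim(2) by linarith
  qed
  moreover have "(\<lambda>x. w a * f a x + (\<Sum>k\<in>F. w k * f k x)) \<in> borel_measurable \<mu>"
    using C1(1) C2(1) by (intro borel_measurable_add borel_measurable_times borel_measurable_const)
  ultimately have "(\<lambda>x. w a * f a x + (\<Sum>k\<in>F. w k * f k x)) \<in> Linfty \<mu>" unfolding Linfty_def by blast
  then show ?case using insert(1,2) by simp
qed

text \<open>Let \<open>F g h\<close> be the mass sent from \<open>g\<close> to \<open>h\<close> if, for each \<open>A\<close>, a point of \<open>depth A 1\<close> spreads at most
  a unit mass evenly over \<open>depth A (a + 1)\<close>. Every point sends at most \<open>M\<close>. If all the ratios were larger than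
  \<open>M + 1\<close>, every point would receive more than \<open>M + 1\<close>. The invariant mean of the outgoing mass equals that of the
  incoming mass; it is only applied to the finitely many translates given by a fine partition, and a
  right-invariant mean is obtained from the left-invariant one by inversion.\<close>

theorem mass_transport:
  assumes am: "amenable G \<mu>"
    and sub: "\<And>A. A \<in> \<U> \<Longrightarrow> A \<subseteq> carrier G"
    and mult: "\<And>x. x \<in> carrier G \<Longrightarrow> finite {A \<in> \<U>. x \<in> A} \<and> card {A \<in> \<U>. x \<in> A} \<le> M"
    and leb: "\<And>x. x \<in> carrier G \<Longrightarrow> \<exists>A\<in>\<U>. x \<in> depth A (a + 1)"
    and bound: "\<And>A x y. A \<in> \<U> \<Longrightarrow> x \<in> A \<Longrightarrow> y \<in> A \<Longrightarrow> d x y \<le> R"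
    and a: "0 \<le> a"
  shows "\<exists>A\<in>\<U>. depth A (a + 1) \<noteq> {} \<and>
    measure \<mu> ((\<lambda>x. inv x) ` depth A 2) \<le> (real M + 1) * measure \<mu> (depth A a)"
proof (rule ccontr)
  assume contra: "\<not> ?thesis"
  \<comment> \<open>For these A the set \<open>depth A a\<close> contains a unit ball, so
    \<open>m A\<close> is at least b. This keeps the kernel F bounded; other members have nobody to
    send mass to.\<close>
  define J where "J = {A \<in> \<U>. depth A (a + 1) \<noteq> {}}"
  define m where "m = (\<lambda>A. measure \<mu> (depth A a))"
  have fmeas: "emeasure \<mu> B < \<infinity>" if "A \<in> \<U>" "B \<subseteq> A" for A B
  proof (cases "A = {}")
    case False
    then obtain x where x: "x \<in> A" by blast
    have "B \<subseteq> mcball x R"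
    proof
      fix y assume "y \<in> B"
      then have "y \<in> A" "y \<in> carrier G" "x \<in> carrier G" using that sub[OF that(1)] x by blast+
      then show "y \<in> mcball x R" using bound[OF that(1) x] by simp
    qed
    then show ?thesis using emeasure_bounded x sub[OF that(1)] by blast
  qed (use that in simp)
  have big: "(real M + 1) * m A < measure \<mu> ((\<lambda>x. inv x) ` depth A 2)" if "A \<in> J" for A
    using contra that unfolding J_def m_def by force
  define b where "b = measure \<mu> (mball \<one> 1)"
  have bpos: "0 < b" unfolding b_def using emeasure_ball_pos[of 1] emeasure_ball_finite[OF one_closed, of 1]
    by (simp add: measure_def enn2real_positive_iff)
  have mb: "b \<le> m A" if A: "A \<in> J" for A
  proof -
    obtain x where x: "x \<in> depth A (a + 1)" using A unfolding J_def by blast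
    have xG: "x \<in> carrier G" using x depth_carrier by blast
    have "mball x 1 \<subseteq> depth A a" using depth_move[OF x] by auto
    moreover have "emeasure \<mu> (depth A a) < \<infinity>" using fmeas[of A "depth A a"] A depth_subset[OF a] unfolding J_def by blast
    ultimately have "measure \<mu> (mball x 1) \<le> m A" unfolding m_def
      by (intro measure_mono_fmeasurable sets_ball fmeasurableI sets_depth)
    then show ?thesis unfolding b_def using emeasure_ball[OF xG, of 1] by (simp add: measure_def)
  qed
  have mpos: "0 < m A" if "A \<in> J" for A using mb[OF that] bpos by simp
  define I where "I = (\<lambda>g h. {A \<in> J. g \<in> depth A 1 \<and> h \<in> depth A (a + 1)})"
  define F where "F = (\<lambda>g h. \<Sum>A\<in>I g h. 1 / m A)"
  have Jfin: "finite {A \<in> J. g \<in> depth A 1}" "card {A \<in> J. g \<in> depth A 1} \<le> M" if g: "g \<in> carrier G" for g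
  proof -
    have "{A \<in> J. g \<in> depth A 1} \<subseteq> {A \<in> \<U>. g \<in> A}" unfolding J_def using depth_subset[of 1] by auto
    then show "finite {A \<in> J. g \<in> depth A 1}" "card {A \<in> J. g \<in> depth A 1} \<le> M"
      using mult[OF g] by (meson card_mono finite_subset le_trans)+
  qed
  have Ifin: "finite (I g h)" "card (I g h) \<le> M" if g: "g \<in> carrier G" for g h
  proof -
    have "I g h \<subseteq> {A \<in> J. g \<in> depth A 1}" unfolding I_def by blast
    then show "finite (I g h)" "card (I g h) \<le> M"
      using Jfin[OF g] by (meson card_mono finite_subset le_trans)+
  qed
  have F0: "0 \<le> F g h" for g h unfolding F_def using mb bpos I_def by (intro sum_nonneg) force
  have Fb: "F g h \<le> real M / b" if g: "g \<in> carrier G" for g h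
  proof -
    have "F g h \<le> (\<Sum>A\<in>I g h. 1 / b)" unfolding F_def
      using mb bpos mpos by (intro sum_mono divide_left_mono) (auto simp: I_def)
    also have "\<dots> = real (card (I g h)) * (1 / b)" by simp
    also have "\<dots> \<le> real M * (1 / b)" using Ifin[OF g, of h] bpos by (intro mult_right_mono) auto
    finally show ?thesis by simp
  qed
  \<comment> \<open>Both depth conditions are open, so a member counted at x is counted at all
    nearby points and F can only increase there. Lower semicontinuity provides the measurability
    needed for the mean.\<close>
  have lsc: "openin T {x \<in> carrier G. t < F (\<phi> x) (\<psi> x)}"
    if \<phi>: "continuous_map T T \<phi>" and \<psi>: "continuous_map T T \<psi>" for \<phi> \<psi> t
  proof (subst openin_subopen, intro ballI)
    fix x assume x: "x \<in> {x \<in> carrier G. t < F (\<phi> x) (\<psi> x)}"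
    have \<phi>G: "\<phi> y \<in> carrier G" if "y \<in> carrier G" for y
      using continuous_map_image_subset_topspace[OF \<phi>] that top_T by auto
    let ?A = "I (\<phi> x) (\<psi> x)"
    define W where "W = topspace T \<inter> (\<Inter>A\<in>?A. {y \<in> topspace T. \<phi> y \<in> depth A 1} \<inter> {y \<in> topspace T. \<psi> y \<in> depth A (a + 1)})"
    have fA: "finite ?A" using Ifin \<phi>G x by blast
    have "openin T W" unfolding W_def
    proof (cases "?A = {}")
      case False
      show "openin T (topspace T \<inter> (\<Inter>A\<in>?A. {y \<in> topspace T. \<phi> y \<in> depth A 1} \<inter> {y \<in> topspace T. \<psi> y \<in> depth A (a + 1)}))"
        using fA False by (intro openin_Int openin_topspace openin_Inter openin_continuous_map_preimage[OF \<phi>]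
            openin_continuous_map_preimage[OF \<psi>] openin_depth finite_imageI)
           (auto intro!: openin_Int openin_continuous_map_preimage[OF \<phi>] openin_continuous_map_preimage[OF \<psi>] openin_depth)
    qed auto
    moreover have "x \<in> W" unfolding W_def using x by (auto simp: top_T I_def)
    moreover have "W \<subseteq> {x \<in> carrier G. t < F (\<phi> x) (\<psi> x)}"
    proof
      fix y assume y: "y \<in> W"
      then have yG: "y \<in> carrier G" unfolding W_def top_T by blast
      have "?A \<subseteq> I (\<phi> y) (\<psi> y)" using y unfolding W_def I_def by blast
      then have "F (\<phi> x) (\<psi> x) \<le> F (\<phi> y) (\<psi> y)" unfolding F_def
        using Ifin(1)[OF \<phi>G[OF yG]] mpos by (intro sum_mono2) (auto simp: I_def less_imp_le)
      then show "y \<in> {x \<in> carrier G. t < F (\<phi> x) (\<psi> x)}" using x yG by simp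
    qed
    ultimately show "\<exists>W. openin T W \<and> x \<in> W \<and> W \<subseteq> {x \<in> carrier G. t < F (\<phi> x) (\<psi> x)}" by blast
  qed
  \<comment> \<open>Points of one member are at distance at most R, so g^(-1) h lies in this ball
    for a sender g and a receiver h. The sums over k below are Riemann sums for integrals over the
    ball.\<close>
  obtain n :: nat and c Q where P: "\<And>k. k < n \<Longrightarrow> c k \<in> carrier G" "\<And>k. k < n \<Longrightarrow> Q k \<in> sets \<mu>"
    "disjoint_family_on Q {..<n}" "mball \<one> (R + 1) \<subseteq> (\<Union>k<n. Q k)" "\<And>k. k < n \<Longrightarrow> Q k \<subseteq> mball \<one> (R + 1)"
    "\<And>k s. k < n \<Longrightarrow> s \<in> Q k \<Longrightarrow> d s (c k) < 1 \<and> d (inv s) (inv (c k)) < 1"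
    by (rule fine_partition[of "R + 1"]) (rule that)
  define w where "w = (\<lambda>k. measure \<mu> (Q k))"
  have Qfin: "emeasure \<mu> (Q k) < \<infinity>" if "k < n" for k
    using emeasure_bounded[of "Q k" \<one> "R + 1"] P(5)[OF that] mball_subset_mcball by (metis one_closed subset_trans)
  have Qf: "Q k \<in> fmeasurable \<mu>" if "k < n" for k using P(2) Qfin that by (intro fmeasurableI)
  have sum_w: "(\<Sum>k\<in>K. w k) = measure \<mu> (\<Union>k\<in>K. Q k)" if "K \<subseteq> {..<n}" for K
    unfolding w_def using that P(3)
    by (intro measure_finite_Union[symmetric])
       (use Qfin P(2) that in \<open>auto intro: finite_subset disjoint_family_on_mono simp: less_top[symmetric]\<close>)
  have UQf: "(\<Union>k\<in>K. Q k) \<in> fmeasurable \<mu>" if "K \<subseteq> {..<n}" for K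
    using that Qf by (intro fmeasurable.finite_UN) (auto intro: finite_subset)
  \<comment> \<open>Each A contributes at most 1: if the node g c_k is in
    \<open>depth A (a + 1)\<close>, the whole piece g Q_k is in \<open>depth A a\<close>, as its
    points are less than 1 from the node, and these pieces are disjoint.\<close>
  have out: "(\<Sum>k<n. w k * F g (g \<otimes> c k)) \<le> real M" if g: "g \<in> carrier G" for g
  proof -
    let ?J = "{A \<in> J. g \<in> depth A 1}"
    let ?K = "\<lambda>A. {k \<in> {..<n}. g \<otimes> c k \<in> depth A (a + 1)}"
    have "F g h = (\<Sum>A\<in>?J. if h \<in> depth A (a + 1) then 1 / m A else 0)" for h
      unfolding F_def I_def using Jfin[OF g] by (subst sum.inter_filter[symmetric]) (auto intro!: sum.cong)
    then have "(\<Sum>k<n. w k * F g (g \<otimes> c k)) = (\<Sum>k<n. \<Sum>A\<in>?J. w k * (if g \<otimes> c k \<in> depth A (a + 1) then 1 / m A else 0))"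
      by (simp add: sum_distrib_left)
    also have "\<dots> = (\<Sum>A\<in>?J. \<Sum>k<n. w k * (if g \<otimes> c k \<in> depth A (a + 1) then 1 / m A else 0))" by (rule sum.swap)
    also have "\<dots> \<le> (\<Sum>A\<in>?J. 1)"
    proof (rule sum_mono)
      fix A assume A: "A \<in> ?J"
      have AU: "A \<in> \<U>" using A unfolding J_def by blast
      have mA: "0 < m A" using mb bpos A by fastforce
      have "(\<Sum>k<n. w k * (if g \<otimes> c k \<in> depth A (a + 1) then 1 / m A else 0)) = (\<Sum>k\<in>?K A. w k * (1 / m A))"
        by (subst sum.inter_filter) (auto intro!: sum.cong)
      also have "\<dots> = (\<Sum>k\<in>?K A. w k) * (1 / m A)" by (rule sum_distrib_right[symmetric])
      finally have eq: "(\<Sum>k<n. w k * (if g \<otimes> c k \<in> depth A (a + 1) then 1 / m A else 0)) = (\<Sum>k\<in>?K A. w k) * (1 / m A)" .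
      have "(\<Sum>k\<in>?K A. w k) = measure \<mu> (\<Union>k\<in>?K A. Q k)" by (rule sum_w) auto
      also have "\<dots> = measure \<mu> (g <# (\<Union>k\<in>?K A. Q k))"
      proof -
        have "(\<Union>k\<in>?K A. Q k) \<in> sets \<mu>" using P(2) by auto
        from emeasure_left[OF g this] show ?thesis by (simp add: measure_def)
      qed
      also have "\<dots> \<le> m A" unfolding m_def
      proof -
        have "g <# (\<Union>k\<in>?K A. Q k) \<subseteq> depth A a"
        proof
          fix y assume "y \<in> g <# (\<Union>k\<in>?K A. Q k)"
          then obtain k s where ks: "k < n" "g \<otimes> c k \<in> depth A (a + 1)" "s \<in> Q k" "y = g \<otimes> s"
            unfolding l_coset_def by blast
          have sG: "s \<in> carrier G" using P(5)[OF ks(1)] ks(3) by auto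
          have "d (g \<otimes> c k) y \<le> 1" using left_inv[OF g P(1)[OF ks(1)] sG] P(6)[OF ks(1,3)] ks(4) by (simp add: commute)
          then show "y \<in> depth A a" using depth_move[OF ks(2), of y] ks(4) g sG by simp
        qed
        moreover have "depth A a \<in> fmeasurable \<mu>" using fmeas[OF AU depth_subset[OF a]] sets_depth by (intro fmeasurableI)
        ultimately show "measure \<mu> (g <# (\<Union>k\<in>?K A. Q k)) \<le> measure \<mu> (depth A a)"
          by (cases "g <# (\<Union>k\<in>?K A. Q k) \<in> sets \<mu>") (auto simp: measure_notin_sets intro: measure_mono_fmeasurable)
      qed
      finally have "(\<Sum>k\<in>?K A. w k) * (1 / m A) \<le> m A * (1 / m A)" using mA by (intro mult_right_mono) auto
      then show "(\<Sum>k<n. w k * (if g \<otimes> c k \<in> depth A (a + 1) then 1 / m A else 0)) \<le> 1"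
        unfolding eq using mA by simp
    qed
    also have "\<dots> \<le> real M" using Jfin[OF g] by simp
    finally show ?thesis .
  qed
  \<comment> \<open>Choose A with h in \<open>depth A (a + 1)\<close>. A sender g in
    \<open>depth A 2\<close> corresponds to s = g^(-1) h; for s in piece k, the node h c_k^(-1) is
    still in \<open>depth A 1\<close>. The active pieces thus cover a right translate of the inverse
    of \<open>depth A 2\<close>, which is large by assumption.\<close>
  have inn: "real M + 1 \<le> (\<Sum>k<n. w k * F (h \<otimes> inv (c k)) h)" if h: "h \<in> carrier G" for h
  proof -
    obtain A where A: "A \<in> \<U>" "h \<in> depth A (a + 1)" using leb[OF h] by blast
    have AJ: "A \<in> J" unfolding J_def using A by blast
    have mA: "0 < m A" using mb[OF AJ] bpos by simp
    have hA: "h \<in> A" using A(2) depth_subset[of "a + 1" A] a by auto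
    let ?T = "((\<lambda>x. inv x) ` depth A 2) #> h"
    let ?K = "{k \<in> {..<n}. h \<otimes> inv (c k) \<in> depth A 1}"
    have "?T \<subseteq> (\<Union>k\<in>?K. Q k)"
    proof
      fix s assume "s \<in> ?T"
      then obtain g where g: "g \<in> depth A 2" "s = inv g \<otimes> h" unfolding r_coset_def by blast
      have gG: "g \<in> carrier G" using g depth_carrier by blast
      have gA: "g \<in> A" using g(1) depth_subset[of 2 A] by auto
      have sG: "s \<in> carrier G" using g gG h by simp
      have "d \<one> s = d g h" unfolding g(2) using d_one[OF gG h] by simp
      also have "\<dots> \<le> R" using bound[OF A(1) gA hA] .
      finally have "s \<in> mball \<one> (R + 1)" using sG by simp
      then obtain k where k: "k < n" "s \<in> Q k" using P(4) by blast
      have hs: "h \<otimes> inv s = g" unfolding g(2) using gG h m_assoc[of h "inv h" g] by (simp add: inv_mult_group)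
      have "d g (h \<otimes> inv (c k)) \<le> 1"
        using left_inv[OF h, of "inv s" "inv (c k)"] P(6)[OF k] P(1)[OF k(1)] sG hs by simp
      then have "h \<otimes> inv (c k) \<in> depth A 1" using depth_move[of g A 1 1] g(1) h P(1)[OF k(1)] by simp
      then show "s \<in> (\<Union>k\<in>?K. Q k)" using k by blast
    qed
    then have "measure \<mu> ?T \<le> measure \<mu> (\<Union>k\<in>?K. Q k)"
    proof (rule measure_mono_fmeasurable)
      show "(\<Union>k\<in>?K. Q k) \<in> fmeasurable \<mu>" by (rule UQf) auto
      have cr: "continuous_map T T (\<lambda>x. x \<otimes> inv h)" using h by (intro cont_mult2) (auto simp: top_T)
      have "?T = {x \<in> topspace T. x \<otimes> inv h \<in> (\<lambda>x. inv x) ` depth A 2}"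
      proof (intro equalityI subsetI)
        fix x assume "x \<in> ?T"
        then obtain y where y: "y \<in> (\<lambda>x. inv x) ` depth A 2" "x = y \<otimes> h" unfolding r_coset_def by blast
        have "y \<in> carrier G" using y(1) depth_carrier by auto
        then show "x \<in> {x \<in> topspace T. x \<otimes> inv h \<in> (\<lambda>x. inv x) ` depth A 2}" using y h by (simp add: top_T m_assoc)
      next
        fix x assume x: "x \<in> {x \<in> topspace T. x \<otimes> inv h \<in> (\<lambda>x. inv x) ` depth A 2}"
        then have "x = (x \<otimes> inv h) \<otimes> h" using h by (simp add: top_T m_assoc)
        then show "x \<in> ?T" unfolding r_coset_def using x by blast
      qed
      then have "openin T ?T" using openin_continuous_map_preimage[OF cr openin_inv_image[OF openin_depth]] by simp
      then show "?T \<in> sets \<mu>" by (rule open_sets)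
    qed
    moreover have "measure \<mu> ?T = measure \<mu> ((\<lambda>x. inv x) ` depth A 2)"
      using emeasure_right[OF h sets_inv_depth] by (simp add: measure_def)
    ultimately have 1: "(real M + 1) * m A \<le> (\<Sum>k\<in>?K. w k)" using big[OF AJ] sum_w[of ?K] by fastforce
    have "real M + 1 = (real M + 1) * m A * (1 / m A)" using mA by simp
    also have "\<dots> \<le> (\<Sum>k\<in>?K. w k) * (1 / m A)" using 1 mA by (intro mult_right_mono) auto
    also have "\<dots> = (\<Sum>k\<in>?K. w k * (1 / m A))" by (rule sum_distrib_right)
    also have "\<dots> \<le> (\<Sum>k\<in>?K. w k * F (h \<otimes> inv (c k)) h)"
    proof (intro sum_mono mult_left_mono)
      fix k assume k: "k \<in> ?K"
      have G: "h \<otimes> inv (c k) \<in> carrier G" using h P(1) k by simp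
      have "A \<in> I (h \<otimes> inv (c k)) h" unfolding I_def using AJ A(2) k by blast
      then have "(\<Sum>A\<in>{A}. 1 / m A) \<le> F (h \<otimes> inv (c k)) h" unfolding F_def
        using Ifin(1)[OF G] mpos by (intro sum_mono2) (auto simp: I_def less_imp_le)
      then show "1 / m A \<le> F (h \<otimes> inv (c k)) h" by simp
    qed (simp add: w_def)
    also have "\<dots> \<le> (\<Sum>k<n. w k * F (h \<otimes> inv (c k)) h)"
      by (rule sum_mono2) (use F0 in \<open>auto simp: w_def\<close>)
    finally show ?thesis .
  qed
  obtain \<Lambda> where am1: "\<Lambda> (\<lambda>_. 1) = (1::real)"
    and am2: "\<forall>f\<in>Linfty \<mu>. \<forall>h\<in>Linfty \<mu>. \<Lambda> (\<lambda>x. f x + h x) = \<Lambda> f + \<Lambda> h"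
    and am3: "\<forall>c. \<forall>f\<in>Linfty \<mu>. \<Lambda> (\<lambda>x. c * f x) = c * \<Lambda> f"
    and am5: "\<forall>f\<in>Linfty \<mu>. (AE x in \<mu>. 0 \<le> f x) \<longrightarrow> 0 \<le> \<Lambda> f"
    and am6: "\<forall>g\<in>carrier G. \<forall>f\<in>Linfty \<mu>. \<Lambda> (\<lambda>x. f (g \<otimes> x)) = \<Lambda> f"
    using am unfolding amenable_def by (elim exE conjE) (rule that)
  have one: "(\<lambda>_. C) \<in> Linfty \<mu>" for C :: real unfolding Linfty_def by auto
  have \<Lambda>_const: "\<Lambda> (\<lambda>_. C) = C" for C using am3[THEN spec, of C, THEN bspec, OF one[of 1]] am1 by simp
  have \<Lambda>_sum: "\<Lambda> (\<lambda>x. \<Sum>k\<in>K. v k * f k x) = (\<Sum>k\<in>K. v k * \<Lambda> (f k))"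
    if "finite K" "\<And>k. k \<in> K \<Longrightarrow> f k \<in> Linfty \<mu>" for K :: "nat set" and v f
    using that
  proof (induction K rule: finite_induct)
    case empty then show ?case using \<Lambda>_const by simp
  next
    case (insert k K)
    have 1: "(\<lambda>x. v k * f k x) \<in> Linfty \<mu>" using Linfty_sum[of "{k}" f v] insert.prems by simp
    have 2: "(\<lambda>x. \<Sum>k\<in>K. v k * f k x) \<in> Linfty \<mu>" by (rule Linfty_sum) (use insert in auto)
    have "\<Lambda> (\<lambda>x. v k * f k x + (\<Sum>k\<in>K. v k * f k x)) = \<Lambda> (\<lambda>x. v k * f k x) + \<Lambda> (\<lambda>x. \<Sum>k\<in>K. v k * f k x)"
      by (rule am2[THEN bspec, THEN bspec, OF 1 2])
    also have "\<dots> = v k * \<Lambda> (f k) + (\<Sum>k\<in>K. v k * \<Lambda> (f k))" using am3[THEN spec, of "v k", THEN bspec, of "f k"] insert by simp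
    finally show ?case using insert by simp
  qed
  have \<Lambda>_mono: "\<Lambda> f \<le> \<Lambda> h" if "f \<in> Linfty \<mu>" "h \<in> Linfty \<mu>" "\<And>x. x \<in> carrier G \<Longrightarrow> f x \<le> h x" for f h
  proof -
    have m: "(\<lambda>x. (-1) * f x) \<in> Linfty \<mu>" using Linfty_sum[of "{0::nat}" "\<lambda>_. f" "\<lambda>_. -1"] that(1) by simp
    have s: "(\<lambda>x. h x + (-1) * f x) \<in> Linfty \<mu>"
      using Linfty_sum[of "{0, 1::nat}" "\<lambda>k. if k = 0 then h else f" "\<lambda>k. if k = 0 then 1 else -1"] that(1,2) by simp
    have "AE x in \<mu>. 0 \<le> h x + (-1) * f x" by (rule AE_I2) (use that(3) space_\<mu> in auto)
    then have "0 \<le> \<Lambda> (\<lambda>x. h x + (-1) * f x)" by (rule am5[THEN bspec, THEN mp, OF s])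
    also have "\<dots> = \<Lambda> h + \<Lambda> (\<lambda>x. (-1) * f x)" by (rule am2[THEN bspec, THEN bspec, OF that(2) m])
    also have "\<Lambda> (\<lambda>x. (-1) * f x) = (-1) * \<Lambda> f" by (rule am3[THEN spec, THEN bspec, OF that(1)])
    finally show ?thesis by simp
  qed
  \<comment> \<open>At x this is the mass sent by x^(-1) to x^(-1) c_k; after left translation by
    c_k it is the mass received by x^(-1) from x^(-1) c_k^(-1). Left invariance of the mean equates
    the two for every k.\<close>
  define f where "f = (\<lambda>k x. F (inv x) (inv x \<otimes> c k))"
  have G2: "inv (c k \<otimes> x) = inv x \<otimes> inv (c k)" "inv x \<otimes> inv (c k) \<otimes> c k = inv x"
    if "k < n" "x \<in> carrier G" for k x using P(1)[OF that(1)] that(2) by (simp_all add: inv_mult_group m_assoc)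
  have fL: "f k \<in> Linfty \<mu>" if k: "k < n" for k
  proof (rule lsc_Linfty[of _ "real M / b"])
    have "continuous_map T T (\<lambda>x. inv x \<otimes> c k)"
      using P(1)[OF k] by (intro cont_mult2 cont_inv) (simp add: top_T)
    then show "openin T {x \<in> carrier G. t < f k x}" for t unfolding f_def by (rule lsc[OF cont_inv])
    show "\<bar>f k x\<bar> \<le> real M / b" if "x \<in> carrier G" for x unfolding f_def using F0 Fb that by simp
  qed
  have fL': "(\<lambda>x. f k (c k \<otimes> x)) \<in> Linfty \<mu>" if k: "k < n" for k
  proof (rule lsc_Linfty[of _ "real M / b"])
    have c1: "continuous_map T T (\<lambda>x. c k \<otimes> x)" using P(1)[OF k] by (intro cont_mult2) (auto simp: top_T)
    have c2: "continuous_map T T (\<lambda>x. inv (c k \<otimes> x))" using continuous_map_compose[OF c1 cont_inv] by (simp add: o_def)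
    have "continuous_map T T (\<lambda>x. inv (c k \<otimes> x) \<otimes> c k)"
      using P(1)[OF k] by (intro cont_mult2 c2) (simp add: top_T)
    then show "openin T {x \<in> carrier G. t < f k (c k \<otimes> x)}" for t unfolding f_def by (rule lsc[OF c2])
    show "\<bar>f k (c k \<otimes> x)\<bar> \<le> real M / b" if "x \<in> carrier G" for x unfolding f_def using F0 Fb that P(1)[OF k] by simp
  qed
  have "(\<Sum>k<n. w k * \<Lambda> (f k)) = \<Lambda> (\<lambda>x. \<Sum>k<n. w k * f k x)" by (rule \<Lambda>_sum[symmetric]) (use fL in auto)
  also have "\<dots> \<le> \<Lambda> (\<lambda>_. real M)"
    by (rule \<Lambda>_mono[OF Linfty_sum one]) (use fL out in \<open>auto simp: f_def\<close>)
  finally have 1: "(\<Sum>k<n. w k * \<Lambda> (f k)) \<le> real M" using \<Lambda>_const by simp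
  have "real M + 1 = \<Lambda> (\<lambda>_. real M + 1)" using \<Lambda>_const by simp
  also have "\<dots> \<le> \<Lambda> (\<lambda>x. \<Sum>k<n. w k * f k (c k \<otimes> x))"
  proof (rule \<Lambda>_mono[OF one Linfty_sum])
    fix x assume x: "x \<in> carrier G"
    have "(\<Sum>k<n. w k * f k (c k \<otimes> x)) = (\<Sum>k<n. w k * F (inv x \<otimes> inv (c k)) (inv x))"
      by (rule sum.cong) (use G2 x in \<open>auto simp: f_def\<close>)
    then show "real M + 1 \<le> (\<Sum>k<n. w k * f k (c k \<otimes> x))" using inn[OF inv_closed[OF x]] by simp
  qed (use fL' in auto)
  also have "\<dots> = (\<Sum>k<n. w k * \<Lambda> (\<lambda>x. f k (c k \<otimes> x)))" by (rule \<Lambda>_sum) (use fL' in auto)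
  also have "\<dots> = (\<Sum>k<n. w k * \<Lambda> (f k))"
  proof (rule sum.cong[OF refl])
    fix k assume "k \<in> {..<n}"
    then show "w k * \<Lambda> (\<lambda>x. f k (c k \<otimes> x)) = w k * \<Lambda> (f k)"
      using am6[THEN bspec, THEN bspec, OF P(1) fL, of k k] by simp
  qed
  finally show False using 1 by simp
qed

end

section \<open>Test functions and the isoperimetric profile\<close>

context haar_group
begin

definition plateau :: "'a set \<Rightarrow> real \<Rightarrow> 'a \<Rightarrow> real" where
  "plateau A N g = Sup {r. r = 0 \<or> 0 \<le> r \<and> r \<le> N \<and> mball g (r + 3) \<subseteq> A}"

context
  fixes A :: "'a set" and N :: real
  assumes N: "0 \<le> N"
begin

lemma plateau_bdd: "bdd_above {r. r = 0 \<or> 0 \<le> r \<and> r \<le> N \<and> mball g (r + 3) \<subseteq> A}"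
  by (rule bdd_aboveI[of _ N]) (use N in auto)

lemma plateau_upper: "0 \<le> r \<Longrightarrow> r \<le> N \<Longrightarrow> mball g (r + 3) \<subseteq> A \<Longrightarrow> r \<le> plateau A N g"
  unfolding plateau_def by (rule cSup_upper[OF _ plateau_bdd]) simp

lemma plateau_nonneg: "0 \<le> plateau A N g"
  unfolding plateau_def by (rule cSup_upper[OF _ plateau_bdd]) simp

lemma plateau_le: "plateau A N g \<le> N"
  unfolding plateau_def by (rule cSup_least) (use N in auto)

lemma plateau_lipschitz1:
  assumes g: "g \<in> carrier G" "h \<in> carrier G"
  shows "plateau A N g \<le> plateau A N h + d g h"
  unfolding plateau_def[of A N g]
proof (rule cSup_least)
  fix r assume "r \<in> {r. r = 0 \<or> 0 \<le> r \<and> r \<le> N \<and> mball g (r + 3) \<subseteq> A}"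
  then consider "r = 0" | "0 \<le> r" "r \<le> N" "mball g (r + 3) \<subseteq> A" by blast
  then show "r \<le> plateau A N h + d g h"
  proof cases
    case 1 then show ?thesis using plateau_nonneg[of h] nonneg[of g h] by simp
  next
    case 2
    show ?thesis
    proof (cases "r \<le> d g h")
      case True then show ?thesis using plateau_nonneg[of h] by simp
    next
      case False
      have "mball h (r - d g h + 3) \<subseteq> mball g (r + 3)" by (rule mball_subset) (use g in \<open>auto simp: commute\<close>)
      moreover have "r - d g h \<le> N" using 2(2) nonneg[of g h] by linarith
      ultimately have "r - d g h \<le> plateau A N h" using False 2(3) by (intro plateau_upper) auto
      then show ?thesis by simp
    qed
  qed
qed auto

lemma plateau_lipschitz: "g \<in> carrier G \<Longrightarrow> h \<in> carrier G \<Longrightarrow> \<bar>plateau A N g - plateau A N h\<bar> \<le> d g h"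
  using plateau_lipschitz1[of g h] plateau_lipschitz1[of h g] by (simp add: commute abs_le_iff)

lemma plateau_support:
  assumes g: "g \<in> carrier G" "g \<notin> depth A 3"
  shows "plateau A N g = 0"
proof -
  have "{r. r = 0 \<or> 0 \<le> r \<and> r \<le> N \<and> mball g (r + 3) \<subseteq> A} = {0}"
  proof -
    have "r = 0" if "0 \<le> r" "mball g (r + 3) \<subseteq> A" for r
    proof (rule ccontr)
      assume "r \<noteq> 0"
      then have "g \<in> depth A 3" unfolding depth_def using that g(1) by (intro CollectI conjI exI[of _ "r + 3"]) auto
      then show False using g(2) by simp
    qed
    then show ?thesis by auto
  qed
  then show ?thesis unfolding plateau_def by simp
qed

lemma plateau_top:
  assumes "g \<in> depth A (N + 3)"
  shows "plateau A N g = N"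
proof -
  obtain r where r: "r > N + 3" "mball g r \<subseteq> A" using assms unfolding depth_def by blast
  have "mball g (N + 3) \<subseteq> A" using r mball_subset_concentric[of "N + 3" r g] by simp
  then have "N \<le> plateau A N g" using N by (intro plateau_upper) auto
  then show ?thesis using plateau_le[of g] by simp
qed

lemma plateau_measurable: "plateau A N \<in> borel_measurable \<mu>"
proof -
  have "openin T {x \<in> carrier G. a < plateau A N x}" for a
    unfolding mtop[symmetric] openin_mtopology
  proof (intro conjI allI impI)
    fix x assume x: "x \<in> {x \<in> carrier G. a < plateau A N x}"
    have "y \<in> {x \<in> carrier G. a < plateau A N x}" if "y \<in> mball x (plateau A N x - a)" for y
      using that plateau_lipschitz1[of x y] x by auto
    then show "\<exists>r>0. mball x r \<subseteq> {x \<in> carrier G. a < plateau A N x}"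
      using x by (intro exI[of _ "plateau A N x - a"]) auto
  qed blast
  then show ?thesis unfolding borel_measurable_iff_greater space_\<mu> using open_sets by blast
qed

end

lemma ennreal_ratio:
  assumes "0 < x" "0 < b" "b * x \<le> a" "g \<le> ennreal x"
  shows "ennreal b \<le> ennreal a / g"
proof (cases "g = 0")
  case True
  have "0 < a" using assms mult_pos_pos[of b x] by linarith
  then show ?thesis using True by (simp add: ennreal_divide_eq_top_iff)
next
  case False
  have gt: "g < \<infinity>" by (rule le_less_trans[OF assms(4)]) simp
  obtain y where y: "g = ennreal y" "0 \<le> y" using gt by (cases g) auto
  have y0: "0 < y" using False y by (simp add: order_less_le)
  have "y \<le> x" using assms(1,4) y by simp
  then have "b * y \<le> a" using assms(2,3) mult_left_mono[of y x b] by linarith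
  then have "b \<le> a / y" using y0 by (simp add: field_simps)
  moreover have "0 \<le> a" using assms mult_pos_pos[of b x] by linarith
  ultimately show ?thesis unfolding y(1) using y0 by (simp add: divide_ennreal ennreal_leI)
qed

text \<open>The function equals N on \<open>depth A (N + 3)\<close>, which bounds its norm from
  below. By left invariance of d, right translation by t moves points by at most \<rho>, so the
  difference is at most \<rho>; it lives on \<open>depth A 3\<close> and a right translate of it, of
  equal measure by unimodularity.\<close>

lemma plateau_ratio:
  assumes N: "0 < N" and p: "1 \<le> p" and \<rho>: "0 < \<rho>" "\<And>t. t \<in> S \<Longrightarrow> d \<one> t \<le> \<rho>"
    and fin: "emeasure \<mu> (depth A 3) < \<infinity>"
    and pos: "0 < measure \<mu> (depth A (N + 3))"
    and X: "0 < X" "measure \<mu> (depth A 3) \<le> X * measure \<mu> (depth A (N + 3))"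
  shows "ennreal (N / (\<rho> * (2 * X) powr (1 / p))) \<le> isop_ratio G \<mu> S p (depth A 3)"
proof -
  let ?u = "plateau A N" and ?D = "depth A 3" and ?E = "depth A (N + 3)"
  have N0: "0 \<le> N" using N by simp
  have p0: "0 < p" using p by simp
  have um: "?u \<in> borel_measurable \<mu>" by (rule plateau_measurable[OF N0])
  have Df: "?D \<in> fmeasurable \<mu>" using fin sets_depth by (intro fmeasurableI)
  have ED: "?E \<subseteq> ?D" using N by (intro depth_mono) simp
  have Ef: "?E \<in> fmeasurable \<mu>" by (rule fmeasurableI2[OF Df ED sets_depth])
  have intD: "integrable \<mu> (\<lambda>x. C * indicator ?D x)" for C :: real
    using Df by (simp add: fmeasurable_def)
  have intE: "integrable \<mu> (\<lambda>x. C * indicator ?E x)" for C :: real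
    using Ef by (simp add: fmeasurable_def)
  have ub: "\<bar>?u x\<bar> powr p \<le> N powr p * indicator ?D x" if x: "x \<in> space \<mu>" for x
  proof (cases "x \<in> ?D")
    case True
    then show ?thesis using plateau_nonneg[OF N0, of A x] plateau_le[OF N0, of A x] p0 by (simp add: powr_mono2)
  next
    case False
    then show ?thesis using plateau_support[OF N0 _ False] x space_\<mu> p0 by simp
  qed
  have iu: "integrable \<mu> (\<lambda>x. \<bar>?u x\<bar> powr p)"
    by (rule Bochner_Integration.integrable_bound[OF intD[of "N powr p"]])
       (use um ub in \<open>auto intro!: AE_I2 simp: abs_mult\<close>)
  have uLp: "?u \<in> Lp p \<mu>" unfolding Lp_def using um iu by blast
  have uE: "N powr p * measure \<mu> ?E \<le> (LINT x|\<mu>. \<bar>?u x\<bar> powr p)"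
  proof -
    have "(LINT x|\<mu>. N powr p * indicator ?E x) \<le> (LINT x|\<mu>. \<bar>?u x\<bar> powr p)"
    proof (rule integral_mono[OF intE iu])
      fix x
      show "N powr p * indicator ?E x \<le> \<bar>?u x\<bar> powr p"
        using plateau_top[OF N0, of x A] N by (cases "x \<in> ?E") auto
    qed
    moreover have "(LINT x|\<mu>. N powr p * indicator ?E x) = N powr p * measure \<mu> ?E"
      using sets.Int_space_eq2[OF sets_depth[of A "N + 3"]] by simp
    ultimately show ?thesis using N by auto
  qed
  let ?m = "measure \<mu> ?E powr (1 / p)"
  have norm_u: "N * ?m \<le> Lp_norm p \<mu> ?u"
  proof -
    have "(N powr p * measure \<mu> ?E) powr (1 / p) \<le> Lp_norm p \<mu> ?u"
      unfolding Lp_norm_def using uE p0 by (intro powr_mono2) auto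
    then show ?thesis using N p0 by (simp add: powr_mult powr_powr)
  qed
  have grad_t: "Lp_norm p \<mu> (\<lambda>g. ?u g - ?u (g \<otimes> t)) \<le> \<rho> * (2 * X) powr (1 / p) * ?m" if t: "t \<in> S" for t
  proof -
    have tG: "t \<in> carrier G" using t S_carrier by blast
    let ?D' = "?D #> inv t"
    have memD': "g \<in> ?D'" if "g \<in> carrier G" "g \<otimes> t \<in> ?D" for g
    proof -
      have "g = (g \<otimes> t) \<otimes> inv t" using that tG by (simp add: m_assoc)
      then show ?thesis unfolding r_coset_def using that(2) by blast
    qed
    have oD': "openin T ?D'"
    proof -
      have "?D' = {g \<in> topspace T. g \<otimes> t \<in> ?D}"
      proof (intro equalityI subsetI)
        fix g assume "g \<in> ?D'"
        then obtain h where h: "h \<in> ?D" "g = h \<otimes> inv t" unfolding r_coset_def by blast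
        then have "h \<in> carrier G" using depth_carrier by blast
        then show "g \<in> {g \<in> topspace T. g \<otimes> t \<in> ?D}" using h tG by (simp add: top_T m_assoc)
      qed (use memD' top_T in auto)
      moreover have "continuous_map T T (\<lambda>g. g \<otimes> t)" using tG by (intro cont_mult2) (auto simp: top_T)
      ultimately show ?thesis using openin_continuous_map_preimage[OF _ openin_depth] by metis
    qed
    have eD': "emeasure \<mu> ?D' = emeasure \<mu> ?D" by (rule emeasure_right[OF inv_closed[OF tG] sets_depth])
    have D'f: "?D' \<in> fmeasurable \<mu>" using fin eD' open_sets[OF oD'] by (intro fmeasurableI) auto
    let ?h = "\<lambda>x. \<rho> powr p * (indicator ?D x + indicator ?D' x) :: real"
    have ih: "integrable \<mu> ?h" using Df D'f by (simp add: fmeasurable_def)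
    have "(LINT g|\<mu>. \<bar>?u g - ?u (g \<otimes> t)\<bar> powr p) \<le> (LINT g|\<mu>. ?h g)"
    proof (rule integral_mono'[OF ih])
      fix g assume "g \<in> space \<mu>"
      then have g: "g \<in> carrier G" "g \<otimes> t \<in> carrier G" using space_\<mu> tG by auto
      show "\<bar>?u g - ?u (g \<otimes> t)\<bar> powr p \<le> ?h g"
      proof (cases "g \<in> ?D \<or> g \<otimes> t \<in> ?D")
        case True
        have "\<bar>?u g - ?u (g \<otimes> t)\<bar> \<le> d g (g \<otimes> t)" by (rule plateau_lipschitz[OF N0 g])
        also have "\<dots> \<le> \<rho>" using d_right[OF g(1) tG] \<rho>(2)[OF t] by simp
        finally have "\<bar>?u g - ?u (g \<otimes> t)\<bar> powr p \<le> \<rho> powr p" using p0 by (intro powr_mono2) auto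
        also have "\<dots> \<le> ?h g" using True memD'[OF g(1)] by (auto simp: indicator_def)
        finally show ?thesis .
      next
        case False
        then show ?thesis using plateau_support[OF N0 g(1)] plateau_support[OF N0 g(2)] p0 by simp
      qed
      show "0 \<le> ?h g" by simp
    qed
    also have "(LINT g|\<mu>. ?h g) = \<rho> powr p * (measure \<mu> ?D + measure \<mu> ?D')"
      using Df D'f sets.Int_space_eq2[OF sets_depth[of A 3]] sets.Int_space_eq2[OF open_sets[OF oD']]
      by (simp add: fmeasurable_def)
    also have "\<dots> = \<rho> powr p * (2 * measure \<mu> ?D)" using eD' by (simp add: measure_def)
    also have "\<dots> \<le> \<rho> powr p * (2 * (X * measure \<mu> ?E))" using X(2) by (intro mult_left_mono) auto
    finally have "Lp_norm p \<mu> (\<lambda>g. ?u g - ?u (g \<otimes> t)) \<le> (\<rho> powr p * (2 * X * measure \<mu> ?E)) powr (1 / p)"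
      unfolding Lp_norm_def using p0 by (intro powr_mono2) (auto simp: mult.assoc intro: integral_nonneg)
    also have "\<dots> = \<rho> * (2 * X) powr (1 / p) * ?m"
      using \<rho>(1) X(1) p0 by (simp add: powr_mult powr_powr)
    finally show ?thesis .
  qed
  have grad: "right_gradient_norm G \<mu> S p ?u \<le> ennreal (\<rho> * (2 * X) powr (1 / p) * ?m)"
    unfolding right_gradient_norm_def by (rule SUP_least) (use grad_t in \<open>auto intro: ennreal_leI\<close>)
  have "ennreal (N / (\<rho> * (2 * X) powr (1 / p))) \<le> ennreal (Lp_norm p \<mu> ?u) / right_gradient_norm G \<mu> S p ?u"
  proof (rule ennreal_ratio[OF _ _ _ grad])
    show "0 < \<rho> * (2 * X) powr (1 / p) * ?m" using \<rho>(1) X(1) pos by simp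
    show "0 < N / (\<rho> * (2 * X) powr (1 / p))" using \<rho>(1) X(1) N by simp
    show "N / (\<rho> * (2 * X) powr (1 / p)) * (\<rho> * (2 * X) powr (1 / p) * ?m) \<le> Lp_norm p \<mu> ?u"
      using norm_u \<rho>(1) X(1) by simp
  qed
  also have "\<dots> \<le> isop_ratio G \<mu> S p ?D" unfolding isop_ratio_def
  proof (rule SUP_upper, intro CollectI conjI)
    show "?u \<in> Lp p \<mu>" by (rule uLp)
    show "AE x in \<mu>. x \<notin> ?D \<longrightarrow> ?u x = 0"
      by (rule AE_I2) (use plateau_support[OF N0] space_\<mu> in auto)
    show "\<not> (AE x in \<mu>. ?u x = 0)"
    proof
      assume "AE x in \<mu>. ?u x = 0"
      then have ae: "AE x in \<mu>. x \<notin> ?E" by eventually_elim (use plateau_top[OF N0] N in force)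
      have eq: "{x \<in> space \<mu>. \<not> x \<notin> ?E} = ?E" using depth_carrier space_\<mu> by auto
      from AE_iff_measurable[OF sets_depth eq] ae have "emeasure \<mu> ?E = 0" by (rule iffD1)
      then show False using pos by (simp add: measure_def)
    qed
  qed
  finally show ?thesis .
qed

theorem log_isop_profile:
  assumes am: "amenable G \<mu>" and p: "1 \<le> p" and \<rho>: "0 < \<rho>" and C: "1 \<le> C"
    and cov: "\<And>n. 1 \<le> n \<Longrightarrow> \<exists>\<U>. volume_cover (carrier G) d \<rho> M C n \<U>"
  shows "(\<lambda>t. ennreal (ln t)) \<preceq> isop_profile G \<mu> S p"
proof -
  obtain \<sigma> where \<sigma>: "0 < \<sigma>" "\<And>t. t \<in> S \<Longrightarrow> d \<one> t \<le> \<sigma>" using S_bounded by blast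
  define b1 where "b1 = measure \<mu> (mball \<one> 1)"
  define b2 where "b2 = measure \<mu> (mball \<one> 2)"
  have fb: "emeasure \<mu> (mball \<one> r) = ennreal (measure \<mu> (mball \<one> r))" for r
    using emeasure_ball_finite[OF one_closed, of r] by (simp add: emeasure_eq_ennreal_measure less_top[symmetric])
  have b: "0 < b1" "0 < b2"
    unfolding b1_def b2_def using emeasure_ball_pos[of 1] emeasure_ball_pos[of 2] fb by (metis ennreal_less_zero_iff zero_less_numeral zero_less_one)+
  \<comment> \<open>The factor b2 / b1 comes from comparing \<open>depth A 3\<close> with the
    inverse of \<open>depth A 2\<close>, the factor M + 1 from the mass transport.\<close>
  define X where "X = b2 / b1 * (real M + 1)"
  have X: "0 < X" unfolding X_def using b by simp
  define \<kappa> where "\<kappa> = \<sigma> * (2 * X) powr (1 / p)"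
  have \<kappa>: "0 < \<kappa>" unfolding \<kappa>_def using \<sigma>(1) X by simp
  \<comment> \<open>\<open>B ^ n\<close> bounds the volume of a member of the cover at scale n; the
    lower bound 3 ensures that ln B is positive.\<close>
  define B where "B = max 3 (real C * max 1 (measure \<mu> (mball \<one> \<rho>)))"
  have B: "3 \<le> B" "real C * max 1 (measure \<mu> (mball \<one> \<rho>)) \<le> B" unfolding B_def by auto
  \<comment> \<open>Mass transport with a = N + 3 requires each point to have depth greater than N +
    4 in some member, so the cover is taken at scale N + 5.\<close>
  have main: "ennreal (real N / \<kappa>) \<le> isop_profile G \<mu> S p v" if N: "1 \<le> N" and v: "B ^ (N + 5) \<le> v" for N :: nat and v
  proof -
    have "1 \<le> N + 5" by simp
    from cov[OF this] obtain \<U> where U0: "volume_cover (carrier G) d \<rho> M C (N + 5) \<U>" ..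
    note U = U0[unfolded volume_cover_def]
    note U1 = U[THEN conjunct1, THEN bspec]
    note U2 = U[THEN conjunct2, THEN conjunct1, THEN bspec]
    note U3 = U[THEN conjunct2, THEN conjunct2, THEN conjunct1, THEN bspec]
    note U4 = U[THEN conjunct2, THEN conjunct2, THEN conjunct2, THEN conjunct1]
    from U[THEN conjunct2, THEN conjunct2, THEN conjunct2, THEN conjunct2]
    obtain R where "\<forall>A\<in>\<U>. \<forall>x\<in>A. \<forall>y\<in>A. d x y \<le> R" ..
    note R = this[THEN bspec, THEN bspec, THEN bspec]
    have leb: "\<exists>A\<in>\<U>. x \<in> depth A (real N + 3 + 1)" if x: "x \<in> carrier G" for x
    proof -
      obtain A where A: "A \<in> \<U>" "mball x (real (N + 5)) \<subseteq> A" using U3[OF x] by blast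
      have "x \<in> depth A (real N + 3 + 1)" unfolding depth_def
        using A(2) x by (intro CollectI conjI exI[of _ "real (N + 5)"]) auto
      then show ?thesis using A(1) by blast
    qed
    obtain A where A: "A \<in> \<U>" "depth A (real N + 3 + 1) \<noteq> {}"
      "measure \<mu> ((\<lambda>x. inv x) ` depth A 2) \<le> (real M + 1) * measure \<mu> (depth A (real N + 3))"
    proof -
      have "\<exists>A\<in>\<U>. depth A (real N + 3 + 1) \<noteq> {} \<and>
          measure \<mu> ((\<lambda>x. inv x) ` depth A 2) \<le> (real M + 1) * measure \<mu> (depth A (real N + 3))"
        by (rule mass_transport[OF am U1 U2 leb R]) simp_all
      then show ?thesis using that by blast
    qed
    let ?D = "depth A 3" and ?E = "depth A (real N + 3)"
    have AG: "A \<subseteq> carrier G" by (rule U1[OF A(1)])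
    obtain x where x: "x \<in> depth A (real N + 3 + 1)" using A(2) by blast
    have xG: "x \<in> carrier G" using x depth_carrier by blast
    have xA: "x \<in> A" using x depth_subset[of "real N + 3 + 1" A] by auto
    have fin: "emeasure \<mu> B < \<infinity>" if "B \<subseteq> A" for B
    proof (rule emeasure_bounded[OF _ xG])
      show "B \<subseteq> mcball x R"
      proof
        fix y assume "y \<in> B"
        then have "y \<in> A" "y \<in> carrier G" using that AG by blast+
        then show "y \<in> mcball x R" using R[OF A(1) xA] xG by simp
      qed
    qed
    have DA: "?D \<subseteq> A" "?E \<subseteq> A" "depth A 2 \<subseteq> A" by (rule depth_subset, simp)+
    have e: "emeasure \<mu> Z = ennreal (measure \<mu> Z)" if "emeasure \<mu> Z < \<infinity>" for Z
      using that by (simp add: emeasure_eq_ennreal_measure less_top[symmetric])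
    have "mball x 1 \<subseteq> ?E" using depth_move[OF x] by auto
    then have "emeasure \<mu> (mball x 1) \<le> emeasure \<mu> ?E" by (rule emeasure_mono[OF _ sets_depth])
    then have Epos: "0 < measure \<mu> ?E"
      using emeasure_ball[OF xG, of 1] emeasure_ball_pos[of 1] fin[OF DA(2)]
      by (simp add: measure_def enn2real_positive_iff less_top)
    have invfin: "emeasure \<mu> ((\<lambda>x. inv x) ` depth A 2) < \<infinity>"
    proof (rule emeasure_bounded[OF _ one_closed])
      show "(\<lambda>x. inv x) ` depth A 2 \<subseteq> mcball \<one> (d \<one> x + R)"
      proof
        fix y assume "y \<in> (\<lambda>x. inv x) ` depth A 2"
        then obtain z where z: "z \<in> depth A 2" "y = inv z" by blast
        have zA: "z \<in> A" "z \<in> carrier G" using z(1) DA(3) AG by blast+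
        have "d \<one> y = d \<one> z" unfolding z(2) by (rule d_one_inv[OF zA(2)])
        also have "\<dots> \<le> d \<one> x + d x z" using xG zA by (intro triangle) auto
        also have "\<dots> \<le> d \<one> x + R" using R[OF A(1) xA zA(1)] by simp
        finally show "y \<in> mcball \<one> (d \<one> x + R)" using zA z(2) by simp
      qed
    qed
    have "emeasure \<mu> (depth A (2 + 1)) * emeasure \<mu> (mball \<one> 1)
      \<le> emeasure \<mu> (mball \<one> 2) * emeasure \<mu> ((\<lambda>x. inv x) ` depth A 2)"
      by (rule emeasure_depth_le_inverse[of A R]) (use R A(1) in auto)
    then have "ennreal (measure \<mu> ?D * b1) \<le> ennreal (b2 * measure \<mu> ((\<lambda>x. inv x) ` depth A 2))"
      using e[OF fin[OF DA(1)]] e[OF invfin] fb[of 1] fb[of 2]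
      unfolding b1_def b2_def by (simp add: ennreal_mult)
    then have "measure \<mu> ?D * b1 \<le> b2 * measure \<mu> ((\<lambda>x. inv x) ` depth A 2)"
      using b by (simp add: ennreal_le_iff)
    also have "\<dots> \<le> b2 * ((real M + 1) * measure \<mu> ?E)" using A(3) b by (intro mult_left_mono) auto
    finally have DX: "measure \<mu> ?D \<le> X * measure \<mu> ?E" unfolding X_def using b by (simp add: field_simps)
    have ratio: "ennreal (real N / \<kappa>) \<le> isop_ratio G \<mu> S p ?D" unfolding \<kappa>_def
      by (rule plateau_ratio[OF _ p \<sigma> fin[OF DA(1)] Epos X DX]) (use N in simp_all)
    have vol: "emeasure \<mu> ?D \<le> ennreal v"
    proof -
      from U4[THEN bspec, OF A(1)] obtain F where F: "F \<subseteq> carrier G" "finite F" "card F \<le> C ^ (N + 5)"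
        "A \<subseteq> (\<Union>c\<in>F. mball c \<rho>)" by (elim exE conjE) (rule that)
      let ?\<beta> = "measure \<mu> (mball \<one> \<rho>)"
      have "emeasure \<mu> ?D \<le> emeasure \<mu> (\<Union>c\<in>F. mball c \<rho>)"
        by (rule emeasure_mono) (use DA(1) F(4) sets.finite_UN[OF F(2) sets_ball] in auto)
      also have "\<dots> \<le> (\<Sum>c\<in>F. emeasure \<mu> (mball c \<rho>))"
        by (rule emeasure_subadditive_finite[OF F(2)]) (use sets_ball in blast)
      also have "\<dots> = (\<Sum>c\<in>F. ennreal ?\<beta>)"
        by (rule sum.cong[OF refl]) (use emeasure_ball fb F(1) in \<open>metis subsetD\<close>)
      also have "\<dots> = ennreal (real (card F) * ?\<beta>)" by (simp add: ennreal_mult ennreal_of_nat_eq_real_of_nat)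
      also have "\<dots> \<le> ennreal v"
      proof (rule ennreal_leI)
        have "real (card F) * ?\<beta> \<le> real (C ^ (N + 5)) * max 1 ?\<beta>" using F(3) by (intro mult_mono of_nat_mono) auto
        also have "\<dots> \<le> real (C ^ (N + 5)) * max 1 ?\<beta> ^ (N + 5)" by (intro mult_left_mono self_le_power) auto
        also have "\<dots> = (real C * max 1 ?\<beta>) ^ (N + 5)" by (simp add: power_mult_distrib)
        also have "\<dots> \<le> B ^ (N + 5)" using B(2) by (intro power_mono) auto
        finally show "real (card F) * ?\<beta> \<le> v" using v by simp
      qed
      finally show ?thesis .
    qed
    have "isop_ratio G \<mu> S p ?D \<le> isop_profile G \<mu> S p v"
      unfolding isop_profile_def by (rule SUP_upper) (use vol sets_depth in simp)
    then show ?thesis using ratio by (rule order_trans[rotated])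
  qed
  define c1 where "c1 = ln B"
  have c1: "0 < c1" unfolding c1_def using B(1) by simp
  have eB: "exp c1 = B" unfolding c1_def using B(1) by simp
  \<comment> \<open>With y = ln t / c1 and N = floor y - 5, one has N > y - 6 \<ge> y / 7 as soon as
    y \<ge> 7; hence ln t \<le> 7 * c1 * N.\<close>
  define K where "K = 7 * c1 * \<kappa>"
  have K: "0 < K" unfolding K_def using c1 \<kappa> by simp
  have "\<forall>\<^sub>F t in at_top. ennreal (ln t) \<le> ennreal K * isop_profile G \<mu> S p (1 * t)"
  proof (rule eventually_at_top_linorderI[of "exp (7 * c1)"])
    fix t :: real assume t: "exp (7 * c1) \<le> t"
    have t0: "0 < t" using t exp_gt_zero less_le_trans by blast
    define y where "y = ln t / c1"
    have "7 * c1 \<le> ln t" using t t0 by (metis exp_le_cancel_iff exp_ln)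
    then have y7: "7 \<le> y" unfolding y_def using c1 by (simp add: field_simps)
    define N where "N = nat \<lfloor>y\<rfloor> - 5"
    have fl: "7 \<le> \<lfloor>y\<rfloor>" using y7 by linarith
    have N5: "int (N + 5) = \<lfloor>y\<rfloor>" unfolding N_def using fl by linarith
    have N5r: "real (N + 5) = of_int \<lfloor>y\<rfloor>" using N5 by (metis of_int_of_nat_eq)
    have N1: "1 \<le> N" using N5 fl by linarith
    have Ny: "y / 7 \<le> real N"
    proof -
      have "real N + 5 = of_int \<lfloor>y\<rfloor>" using N5r by simp
      then have "y < real N + 6" using real_of_int_floor_add_one_gt[of y] by linarith
      then show ?thesis using y7 by linarith
    qed
    have "B ^ (N + 5) \<le> t"
    proof -
      have "B ^ (N + 5) = exp (real (N + 5) * c1)" unfolding eB[symmetric] by (rule exp_of_nat_mult[symmetric])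
      also have "\<dots> \<le> exp (y * c1)" using N5r c1 by (intro exp_mono mult_right_mono) auto
      also have "y * c1 = ln t" unfolding y_def using c1 by simp
      finally show ?thesis using t0 by simp
    qed
    from main[OF N1 this] have m: "ennreal (real N / \<kappa>) \<le> isop_profile G \<mu> S p t" .
    have "ln t = y * c1" unfolding y_def using c1 by simp
    also have "\<dots> \<le> 7 * real N * c1" using Ny c1 by (intro mult_right_mono) auto
    also have "\<dots> = K * (real N / \<kappa>)" unfolding K_def using \<kappa> by simp
    finally have "ennreal (ln t) \<le> ennreal (K * (real N / \<kappa>))" by (rule ennreal_leI)
    also have "\<dots> = ennreal K * ennreal (real N / \<kappa>)" by (rule ennreal_mult) (use K \<kappa> in simp_all)
    also have "\<dots> \<le> ennreal K * isop_profile G \<mu> S p t" by (rule mult_left_mono[OF m]) simp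
    finally show "ennreal (ln t) \<le> ennreal K * isop_profile G \<mu> S p (1 * t)" by simp
  qed
  then show ?thesis unfolding asymp_le_def by (intro exI[of _ 1] conjI exI[of _ K]) simp_all
qed

end

theorem corollary3:
  fixes G :: "('g, 'm) monoid_scheme"
    and TG :: "'g topology"
    and SG :: "'g set"
    and dG :: "'g \<Rightarrow> 'g \<Rightarrow> real"
    and \<mu> :: "'g measure"
    and I :: "'i set"
    and K :: "'i \<Rightarrow> ('k, 'n) ring_scheme"
    and TK :: "'i \<Rightarrow> 'k topology"
    and d :: nat
    and SH :: "(nat \<times> nat \<Rightarrow> 'i \<Rightarrow> 'k) set"
    and dH :: "(nat \<times> nat \<Rightarrow> 'i \<Rightarrow> 'k) \<Rightarrow> (nat \<times> nat \<Rightarrow> 'i \<Rightarrow> 'k) \<Rightarrow> real"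
    and p :: real
  assumes "lcsc_group G TG"
    and "compact_symmetric_generating G TG SG"
    and "admissible_metric G TG SG dG"
    and "left_haar_measure G TG \<mu>"
    and "unimodular G TG"
    and "amenable G \<mu>"
    and "finite I"
    and "\<And>i. i \<in> I \<Longrightarrow> local_field (K i) (TK i)"
    and "d \<ge> 1"
    and "compact_symmetric_generating (GL d (product_ring I K))
           (GL_topology d (product_ring I K) (product_topology TK I)) SH"
    and "admissible_metric (GL d (product_ring I K))
           (GL_topology d (product_ring I K) (product_topology TK I)) SH dH"
    and "\<exists>f. regular_embedding (carrier G) dG (carrier (GL d (product_ring I K))) dH f"
    and "1 \<le> p"
  shows "(\<lambda>t. ennreal (ln t)) \<preceq> isop_profile G \<mu> SG p"
proof -
  have "topological_group G TG" using assms(1) by (simp add: lcsc_group_def)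
  then have "group G" by (simp add: topological_group_def)
  then have "admissible_group G TG SG dG"
    using assms(2,3) by (simp add: admissible_group_def admissible_group_axioms_def)
  then interpret haar_group G TG SG dG \<mu>
    using \<open>topological_group G TG\<close> assms(4,5) by (simp add: haar_group_def haar_group_axioms_def)
  from assms(12) obtain f
    where f: "regular_embedding (carrier G) dG (carrier (GL d (product_ring I K))) dH f" ..
  have "admissible_group (GL d (product_ring I K)) (GL_topology d (product_ring I K) (product_topology TK I)) SH dH"
    "finite_asdim_AN (carrier (GL d (product_ring I K))) dH"
    by (rule GL_finite_asdim[OF assms(7) _ assms(10,11)], rule assms(8), assumption)+
  from regular_pullback_cover[OF Metric_space_axioms this f]
  obtain \<rho> M C where "0 < \<rho>" "1 \<le> C"
    "\<forall>n\<ge>1. \<exists>\<U>. volume_cover (carrier G) dG \<rho> M C n \<U>"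
    by (elim exE conjE) (rule that)
  then show ?thesis using log_isop_profile[OF assms(6,13), of \<rho> C M] by simp
qed

end
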